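(* Let $f:E\to X$ be a fibrewise pointed map over $B$ between fibrewise well-pointed spaces, and assume either that $E$ and $X$ are normal, or that $f$ is a closed fibrewise pointed cofibration and $X$ is normal. Then for every $n\ge0$ the following are equivalent: (i) $\mathrm{secat}^B_B(f)\le n$; (ii) the diagonal $\Delta_{n+1}:X\to\prod^{n+1}_BX$ factors up to fibrewise pointed homotopy through the fibrewise $n$-fat wedge, i.e. there is a fibrewise pointed map $\varphi:X\to T^n_B(f)$ with $j_n\varphi\simeq^B_B\Delta_{n+1}$; (iii) the $n$-th fibrewise Ganea map $p_n:G^n_B(f)\to X$ admits a fibrewise pointed homotopy section, i.e. a fibrewise pointed map $\sigma:X\to G^n_B(f)$ with $p_n\sigma\simeq^B_B\mathrm{id}_X$.
   Context: Fibrewise pointed space over $B$: a space $X$ with map $p_X:X\to B$ and section $s_X$; fibrewise pointed map: $p_Yf=p_X$, $fs_X=s_Y$. Fibrewise products $X\times_BY=\{(x,y):p_X(x)=p_Y(y)\}$ carry section $b\mapsto(s_X(b),s_Y(b))$; $\prod^n_BX$ is the $n$-fold product, $\Delta_{n+1}$ the diagonal. A fibrewise homotopy $H$ satisfies $p_Y(H(x,t))=p_X(x)$; it is fibrewise pointed if also $H(s_X(b),t)=s_Y(b)$ ($\simeq^B_B$). A fibrewise map $j:A\to X$ is a fibrewise cofibration if it has the homotopy extension property for fibrewise homotopies; closed if $j(A)$ is closed. A closed fibrewise pointed cofibration is a fibrewise pointed map with $j(A)$ closed having the homotopy extension property for fibrewise pointed homotopies. $X$ is fibrewise well-pointed if $s_X$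 is a closed fibrewise cofibration. $\mathrm{secat}^B_B(f)$: least $n$ such that $X$ is covered by $n+1$ open sets $U\supseteq s_X(B)$ each with a fibrewise pointed map $s:U\to E$, $fs\simeq^B_B$ inclusion ($\infty$ if none). Fibrewise (pointed) join: for fibrewise pointed $h:Y\to K$, $k:Z\to K$, let $P_B(K)=\{(b,\theta)\in B\times K^{[0,1]}:p_K\theta\equiv b\}$ and $E_{h,k}=\{(y,(b,\theta),z):h(y)=\theta(0),k(z)=\theta(1)\}$ with section $\sigma(b)=(s_Y(b),(b,\text{const}_{s_K(b)}),s_Z(b))$. The join is the quotient of $Y\sqcup(E_{h,k}\times[0,1])\sqcup Z$ by $(y,\xi,z,0)\sim y$, $(y,\xi,z,1)\sim z$, and collapsing each segment $\{\sigma(b)\}\times[0,1]$ to a point (identified with $s_Y(b)$ and $s_Z(b)$); its section is $b\mapsto s_Y(b)$, and the join map to $K$ is $h$, $k$ and $(y,(b,\theta),z,t)\mapsto\theta(t)$. $T^0_B(f)=E$, $j_0=f$; for $n\ge1$, $j_n:T^n_B(f)\to\prod^{n+1}_BX$ is the join map of the join of $f\times_B\mathrm{id}:E\times_B\prod^n_BX\to\prod^{n+1}_BX$ and $\mathrm{id}_X\times_Bj_{n-1}:X\times_BT^{n-1}_B(f)\to\prod^{n+1}_BX$. $G^0_B(f)=E$, $p_0=f$; for $n\ge1$, $p_n:G^n_B(f)\to X$ is the join map of the join of $p_{n-1}$ and $f$. *)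

theory Defs
  imports "HOL-Analysis.Analysis" "HOL-Library.Extended_Nat"
begin

record ('a, 'b) fsp =
  tsp :: "'a topology"
  prj :: "'a \<Rightarrow> 'b"
  sct :: "'b \<Rightarrow> 'a"

definition fibrewise_pointed_space :: "'b topology \<Rightarrow> ('a, 'b) fsp \<Rightarrow> bool" where
  "fibrewise_pointed_space B X \<longleftrightarrow>
     continuous_map (tsp X) B (prj X) \<and> continuous_map B (tsp X) (sct X) \<and>
     (\<forall>b\<in>topspace B. prj X (sct X b) = b)"

definition fp_map :: "'b topology \<Rightarrow> ('a, 'b) fsp \<Rightarrow> ('c, 'b) fsp \<Rightarrow> ('a \<Rightarrow> 'c) \<Rightarrow> bool" where
  "fp_map B X Y g \<longleftrightarrow>
     continuous_map (tsp X) (tsp Y) g \<and>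
     (\<forall>x\<in>topspace (tsp X). prj Y (g x) = prj X x) \<and>
     (\<forall>b\<in>topspace B. g (sct X b) = sct Y b)"

definition fp_homotopic ::
  "'b topology \<Rightarrow> ('a, 'b) fsp \<Rightarrow> ('c, 'b) fsp \<Rightarrow> ('a \<Rightarrow> 'c) \<Rightarrow> ('a \<Rightarrow> 'c) \<Rightarrow> bool" where
  "fp_homotopic B X Y g0 g1 \<longleftrightarrow>
     homotopic_with
       (\<lambda>g. (\<forall>x\<in>topspace (tsp X). prj Y (g x) = prj X x) \<and> (\<forall>b\<in>topspace B. g (sct X b) = sct Y b))
       (tsp X) (tsp Y) g0 g1"

definition fib_cofibration ::
  "'b topology \<Rightarrow> 'a topology \<Rightarrow> ('a \<Rightarrow> 'b) \<Rightarrow> 'c topology \<Rightarrow> ('c \<Rightarrow> 'b) \<Rightarrow> ('a \<Rightarrow> 'c)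
    \<Rightarrow> 'd itself \<Rightarrow> bool" where
  "fib_cofibration B A pA X pX j (_::'d itself) \<longleftrightarrow>
     continuous_map A X j \<and> (\<forall>a\<in>topspace A. pX (j a) = pA a) \<and>
     (\<forall>(Y::'d topology) pY g H.
        continuous_map Y B pY \<and> continuous_map X Y g \<and> (\<forall>x\<in>topspace X. pY (g x) = pX x) \<and>
        continuous_map (prod_topology A (top_of_set {0..1::real})) Y H \<and>
        (\<forall>a\<in>topspace A. \<forall>t\<in>{0..1}. pY (H (a, t)) = pA a) \<and>
        (\<forall>a\<in>topspace A. H (a, 0) = g (j a))
        \<longrightarrow> (\<exists>G. continuous_map (prod_topology X (top_of_set {0..1::real})) Y G \<and>
               (\<forall>x\<in>topspace X. \<forall>t\<in>{0..1}. pY (G (x, t)) = pX x) \<and>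
               (\<forall>x\<in>topspace X. G (x, 0) = g x) \<and>
               (\<forall>a\<in>topspace A. \<forall>t\<in>{0..1}. G (j a, t) = H (a, t))))"

definition fib_well_pointed :: "'b topology \<Rightarrow> ('a, 'b) fsp \<Rightarrow> 'd itself \<Rightarrow> bool" where
  "fib_well_pointed B X D \<longleftrightarrow>
     closedin (tsp X) (sct X ` topspace B) \<and>
     fib_cofibration B B id (tsp X) (prj X) (sct X) D"

definition fp_closed_cofibration ::
  "'b topology \<Rightarrow> ('a, 'b) fsp \<Rightarrow> ('c, 'b) fsp \<Rightarrow> ('a \<Rightarrow> 'c) \<Rightarrow> 'd itself \<Rightarrow> bool" where
  "fp_closed_cofibration B A X j (_::'d itself) \<longleftrightarrow>
     fp_map B A X j \<and> closedin (tsp X) (j ` topspace (tsp A)) \<and>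
     (\<forall>(Y::('d, 'b) fsp) g H.
        fibrewise_pointed_space B Y \<and> fp_map B X Y g \<and>
        continuous_map (prod_topology (tsp A) (top_of_set {0..1::real})) (tsp Y) H \<and>
        (\<forall>a\<in>topspace (tsp A). \<forall>t\<in>{0..1}. prj Y (H (a, t)) = prj A a) \<and>
        (\<forall>b\<in>topspace B. \<forall>t\<in>{0..1}. H (sct A b, t) = sct Y b) \<and>
        (\<forall>a\<in>topspace (tsp A). H (a, 0) = g (j a))
        \<longrightarrow> (\<exists>G. continuous_map (prod_topology (tsp X) (top_of_set {0..1::real})) (tsp Y) G \<and>
               (\<forall>x\<in>topspace (tsp X). \<forall>t\<in>{0..1}. prj Y (G (x, t)) = prj X x) \<and>
               (\<forall>b\<in>topspace B. \<forall>t\<in>{0..1}. G (sct X b, t) = sct Y b) \<and>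
               (\<forall>x\<in>topspace (tsp X). G (x, 0) = g x) \<and>
               (\<forall>a\<in>topspace (tsp A). \<forall>t\<in>{0..1}. G (j a, t) = H (a, t))))"

definition secat_le :: "'b topology \<Rightarrow> ('e, 'b) fsp \<Rightarrow> ('x, 'b) fsp \<Rightarrow> ('e \<Rightarrow> 'x) \<Rightarrow> nat \<Rightarrow> bool" where
  "secat_le B E X f n \<longleftrightarrow>
     (\<exists>U :: nat \<Rightarrow> 'x set.
        (\<Union>i\<le>n. U i) = topspace (tsp X) \<and>
        (\<forall>i\<le>n. openin (tsp X) (U i) \<and> sct X ` topspace B \<subseteq> U i \<and>
           (\<exists>s. fp_map B (X\<lparr>tsp := subtopology (tsp X) (U i)\<rparr>) E s \<and>
                fp_homotopic B (X\<lparr>tsp := subtopology (tsp X) (U i)\<rparr>) X (f \<circ> s) id)))"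

text \<open>Least n with an (n+1)-element cover as above; \<infinity> if there is none (Inf {} = \<infinity>).\<close>
definition secat :: "'b topology \<Rightarrow> ('e, 'b) fsp \<Rightarrow> ('x, 'b) fsp \<Rightarrow> ('e \<Rightarrow> 'x) \<Rightarrow> enat" where
  "secat B E X f = Inf {enat n | n. secat_le B E X f n}"

text \<open>Points of all spaces built below (E, X, iterated fibrewise products, joins) are encoded
  in one datatype: UE/UX embed E and X, UP forms pairs (fibre products), UL/UR/UJ are the
  three summands Y, E_{h,k} x [0,1], Z of the join before taking the quotient, and UC is an
  extra cylinder coordinate (so the universe also contains mapping cylinders).\<close>
datatype ('b, 'e, 'x) U =
    UE 'e | UX 'x | UP "('b, 'e, 'x) U" "('b, 'e, 'x) U"
  | UL "('b, 'e, 'x) U" | UR "('b, 'e, 'x) U"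
  | UJ "('b, 'e, 'x) U" 'b "real \<Rightarrow> ('b, 'e, 'x) U" "('b, 'e, 'x) U" real
  | UC "('b, 'e, 'x) U" real

type_synonym ('b, 'e, 'x) usp = "(('b, 'e, 'x) U, 'b) fsp"

definition final_top :: "'a topology \<Rightarrow> ('a \<Rightarrow> 'u) \<Rightarrow> 'u topology" where
  "final_top T g = topology (\<lambda>S. S \<subseteq> g ` topspace T \<and> openin T {x \<in> topspace T. g x \<in> S})"

definition final_top3 :: "'p topology \<Rightarrow> ('p \<Rightarrow> 'u) \<Rightarrow> 'q topology \<Rightarrow> ('q \<Rightarrow> 'u)
    \<Rightarrow> 'r topology \<Rightarrow> ('r \<Rightarrow> 'u) \<Rightarrow> 'u topology" where
  "final_top3 T1 g1 T2 g2 T3 g3 = topology (\<lambda>S.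
     S \<subseteq> g1 ` topspace T1 \<union> g2 ` topspace T2 \<union> g3 ` topspace T3 \<and>
     openin T1 {x \<in> topspace T1. g1 x \<in> S} \<and>
     openin T2 {x \<in> topspace T2. g2 x \<in> S} \<and>
     openin T3 {x \<in> topspace T3. g3 x \<in> S})"

definition liftE :: "('e, 'b) fsp \<Rightarrow> ('b, 'e, 'x) usp" where
  "liftE E = \<lparr>tsp = final_top (tsp E) UE,
              prj = (\<lambda>u. case u of UE e \<Rightarrow> prj E e | _ \<Rightarrow> undefined),
              sct = (\<lambda>b. UE (sct E b))\<rparr>"

definition liftX :: "('x, 'b) fsp \<Rightarrow> ('b, 'e, 'x) usp" where
  "liftX X = \<lparr>tsp = final_top (tsp X) UX,
              prj = (\<lambda>u. case u of UX x \<Rightarrow> prj X x | _ \<Rightarrow> undefined),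
              sct = (\<lambda>b. UX (sct X b))\<rparr>"

definition liftf :: "('e \<Rightarrow> 'x) \<Rightarrow> ('b, 'e, 'x) U \<Rightarrow> ('b, 'e, 'x) U" where
  "liftf f = (\<lambda>u. case u of UE e \<Rightarrow> UX (f e) | _ \<Rightarrow> undefined)"

definition fprod :: "('b, 'e, 'x) usp \<Rightarrow> ('b, 'e, 'x) usp \<Rightarrow> ('b, 'e, 'x) usp" where
  "fprod X Y = \<lparr>tsp = final_top (subtopology (prod_topology (tsp X) (tsp Y))
                                    {(x, y). prj X x = prj Y y}) (\<lambda>(x, y). UP x y),
                prj = (\<lambda>u. case u of UP x y \<Rightarrow> prj X x | _ \<Rightarrow> undefined),
                sct = (\<lambda>b. UP (sct X b) (sct Y b))\<rparr>"

text \<open>fpow X n is the (n+1)-fold fibrewise product; diag n is the diagonal \<Delta>_{n+1}.\<close>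
primrec fpow :: "('b, 'e, 'x) usp \<Rightarrow> nat \<Rightarrow> ('b, 'e, 'x) usp" where
  "fpow X 0 = X"
| "fpow X (Suc n) = fprod X (fpow X n)"

primrec diag :: "nat \<Rightarrow> ('b, 'e, 'x) U \<Rightarrow> ('b, 'e, 'x) U" where
  "diag 0 = (\<lambda>x. x)"
| "diag (Suc n) = (\<lambda>x. UP x (diag n x))"

text \<open>Paths [0,1] \<rightarrow> K (normalised to be undefined outside [0,1]) with the compact-open topology.\<close>
definition paths :: "'a topology \<Rightarrow> (real \<Rightarrow> 'a) set" where
  "paths K = {\<theta>. continuous_map (top_of_set {0..1}) K \<theta> \<and> \<theta> \<in> extensional {0..1}}"

definition path_top :: "'a topology \<Rightarrow> (real \<Rightarrow> 'a) topology" where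
  "path_top K = topology_generated_by
     {{\<theta> \<in> paths K. \<theta> ` C \<subseteq> V} | C V. compact C \<and> C \<subseteq> {0..1} \<and> openin K V}"

definition PB :: "'b topology \<Rightarrow> ('a, 'b) fsp \<Rightarrow> ('b \<times> (real \<Rightarrow> 'a)) topology" where
  "PB B K = subtopology (prod_topology B (path_top (tsp K)))
              {(b, \<theta>). \<forall>t\<in>{0..1}. prj K (\<theta> t) = b}"

definition Ehk :: "'b topology \<Rightarrow> ('y, 'b) fsp \<Rightarrow> ('z, 'b) fsp \<Rightarrow> ('a, 'b) fsp
    \<Rightarrow> ('y \<Rightarrow> 'a) \<Rightarrow> ('z \<Rightarrow> 'a) \<Rightarrow> ('y \<times> ('b \<times> (real \<Rightarrow> 'a)) \<times> 'z) topology" where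
  "Ehk B Y Z K h k = subtopology (prod_topology (tsp Y) (prod_topology (PB B K) (tsp Z)))
     {(y, (b, \<theta>), z). h y = \<theta> 0 \<and> k z = \<theta> 1}"

definition const_path :: "'a \<Rightarrow> real \<Rightarrow> 'a" where
  "const_path a = restrict (\<lambda>_. a) {0..1}"

definition join_rel :: "'b topology \<Rightarrow> ('b, 'e, 'x) usp \<Rightarrow> ('b, 'e, 'x) usp \<Rightarrow> ('b, 'e, 'x) usp
    \<Rightarrow> (('b, 'e, 'x) U \<Rightarrow> ('b, 'e, 'x) U) \<Rightarrow> (('b, 'e, 'x) U \<Rightarrow> ('b, 'e, 'x) U)
    \<Rightarrow> ('b, 'e, 'x) U \<Rightarrow> ('b, 'e, 'x) U \<Rightarrow> bool" where
  "join_rel B Y Z K h k u v \<longleftrightarrow>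
     (\<exists>y b \<theta> z. (y, (b, \<theta>), z) \<in> topspace (Ehk B Y Z K h k) \<and>
        ((u = UJ y b \<theta> z 0 \<and> v = UL y) \<or> (u = UJ y b \<theta> z 1 \<and> v = UR z))) \<or>
     (\<exists>b\<in>topspace B. \<exists>t\<in>{0..1}.
        u = UJ (sct Y b) b (const_path (sct K b)) (sct Z b) t \<and> v = UL (sct Y b)) \<or>
     (\<exists>b\<in>topspace B. u = UR (sct Z b) \<and> v = UL (sct Y b))"

definition join_rep :: "'b topology \<Rightarrow> ('b, 'e, 'x) usp \<Rightarrow> ('b, 'e, 'x) usp \<Rightarrow> ('b, 'e, 'x) usp
    \<Rightarrow> (('b, 'e, 'x) U \<Rightarrow> ('b, 'e, 'x) U) \<Rightarrow> (('b, 'e, 'x) U \<Rightarrow> ('b, 'e, 'x) U)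
    \<Rightarrow> ('b, 'e, 'x) U \<Rightarrow> ('b, 'e, 'x) U" where
  "join_rep B Y Z K h k u = (SOME v. equivclp (join_rel B Y Z K h k) u v)"

text \<open>The fibrewise pointed join of h : Y \<rightarrow> K and k : Z \<rightarrow> K, together with the join map to K.
  The join carries the quotient topology of the disjoint union Y \<squnion> (E_{h,k} \<times> [0,1]) \<squnion> Z.\<close>
definition fjoin :: "'b topology \<Rightarrow> ('b, 'e, 'x) usp \<Rightarrow> ('b, 'e, 'x) usp \<Rightarrow> ('b, 'e, 'x) usp
    \<Rightarrow> (('b, 'e, 'x) U \<Rightarrow> ('b, 'e, 'x) U) \<Rightarrow> (('b, 'e, 'x) U \<Rightarrow> ('b, 'e, 'x) U)
    \<Rightarrow> ('b, 'e, 'x) usp \<times> (('b, 'e, 'x) U \<Rightarrow> ('b, 'e, 'x) U)" where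
  "fjoin B Y Z K h k =
     (let r = join_rep B Y Z K h k in
      (\<lparr>tsp = final_top3
                (tsp Y) (\<lambda>y. r (UL y))
                (prod_topology (Ehk B Y Z K h k) (top_of_set {0..1::real}))
                  (\<lambda>((y, (b, \<theta>), z), t). r (UJ y b \<theta> z t))
                (tsp Z) (\<lambda>z. r (UR z)),
        prj = (\<lambda>u. case u of UL y \<Rightarrow> prj Y y | UR z \<Rightarrow> prj Z z | UJ y b \<theta> z t \<Rightarrow> b
                            | _ \<Rightarrow> undefined),
        sct = (\<lambda>b. r (UL (sct Y b)))\<rparr>,
       (\<lambda>u. case u of UL y \<Rightarrow> h y | UR z \<Rightarrow> k z | UJ y b \<theta> z t \<Rightarrow> \<theta> t | _ \<Rightarrow> undefined)))"

fun fatwedge :: "'b topology \<Rightarrow> ('b, 'e, 'x) usp \<Rightarrow> ('b, 'e, 'x) usp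
    \<Rightarrow> (('b, 'e, 'x) U \<Rightarrow> ('b, 'e, 'x) U) \<Rightarrow> nat
    \<Rightarrow> ('b, 'e, 'x) usp \<times> (('b, 'e, 'x) U \<Rightarrow> ('b, 'e, 'x) U)" where
  "fatwedge B E X f 0 = (E, f)"
| "fatwedge B E X f (Suc n) =
     (let (T, j) = fatwedge B E X f n in
      fjoin B (fprod E (fpow X n)) (fprod X T) (fpow X (Suc n))
        (\<lambda>u. case u of UP e w \<Rightarrow> UP (f e) w | _ \<Rightarrow> undefined)
        (\<lambda>u. case u of UP x w \<Rightarrow> UP x (j w) | _ \<Rightarrow> undefined))"

fun ganea :: "'b topology \<Rightarrow> ('b, 'e, 'x) usp \<Rightarrow> ('b, 'e, 'x) usp
    \<Rightarrow> (('b, 'e, 'x) U \<Rightarrow> ('b, 'e, 'x) U) \<Rightarrow> nat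
    \<Rightarrow> ('b, 'e, 'x) usp \<times> (('b, 'e, 'x) U \<Rightarrow> ('b, 'e, 'x) U)" where
  "ganea B E X f 0 = (E, f)"
| "ganea B E X f (Suc n) = (let (G, p) = ganea B E X f n in fjoin B G E X p f)"

end

theory Submission
  imports Defs
begin

text \<open>
  Both constructions are iterated joins, so everything reduces to one join of \<open>h : Y \<rightarrow> K\<close> and
  \<open>k : Z \<rightarrow> K\<close>. A map \<open>W \<rightarrow> K\<close> that lifts up to homotopy through \<open>h\<close> where \<open>\<tau> < 1\<close> and through \<open>k\<close>
  where \<open>\<tau> > 0\<close> lifts through the join, with join parameter a clamped multiple of \<open>\<tau>\<close>: it is locally
  constant near the ends, which makes the map continuous for the quotient topology. Normality of \<open>X\<close>
  turns the open cover that witnesses \<open>secat\<close> into such functions.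

  Conversely, the join is covered by the open sets \<open>t < 2/3\<close> and \<open>t > 1/3\<close>, which deform to \<open>Y\<close> and
  \<open>Z\<close>; but \<open>t\<close> is undefined on the section, which every member of the cover has to contain. Since \<open>X\<close> is
  well-pointed there are a homotopy \<open>id \<simeq> c\<close> and an open \<open>V\<close> around the section that \<open>c\<close> retracts to
  the section, and similarly for \<open>E\<close>. After composing with \<open>c\<close>, all lifts and homotopies become equal to
  the section on a small neighbourhood of it, and can be extended over that neighbourhood by
  the section. This property is inherited by joins, so the argument can be iterated.
\<close>

subsection \<open>Final topologies and path spaces\<close>

text \<open>In the converse, the halves of a join with the section removed are not pointed, and a
  lift that is merely pointed need not extend over a neighbourhood of the collapsed segments. The
  induction therefore carries a stronger statement: for maps \<open>g i\<close> from
  \<open>Y\<close> to \<open>X\<close> there are open sets covering \<open>Y\<close>, all containing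
  one common neighbourhood of the section on which the lifts of \<open>c \<circ> g i\<close> and the
  homotopies are equal to the section. This pulls back along every pointed map, and under a join the
  index sets add up: one index for each copy of \<open>E\<close>, hence \<open>n + 1\<close> open
  sets. For Ganea spaces every \<open>g i\<close> is the structure map, for fat wedges
  \<open>g i\<close> is the i-th coordinate of it. Only at the end is the cover pulled back to
  \<open>X\<close>, where the given homotopy and \<open>c \<simeq> id\<close> turn the lifts into
  pointed local sections. The pair \<open>V\<close>, \<open>c\<close> comes from testing the
  cofibration property on the cylinder \<open>X \<times> {0} \<union> s(B) \<times> [0,1]\<close>,
  encoded by the constructor \<open>UC\<close>.\<close>

lemma continuous_map_locally:
  assumes "\<And>x. x \<in> topspace X \<Longrightarrow> \<exists>U. openin X U \<and> x \<in> U \<and> continuous_map (subtopology X U) Y f"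
  shows "continuous_map X Y f"
proof -
  have im: "f x \<in> topspace Y" if "x \<in> topspace X" for x
    using assms[OF that] that by (auto simp: continuous_map_def)
  have "openin X {x \<in> topspace X. f x \<in> V}" if V: "openin Y V" for V
  proof (subst openin_subopen, intro ballI)
    fix x assume x: "x \<in> {x \<in> topspace X. f x \<in> V}"
    then obtain U where U: "openin X U" "x \<in> U" "continuous_map (subtopology X U) Y f"
      using assms by blast
    have "openin (subtopology X U) {x \<in> topspace (subtopology X U). f x \<in> V}"
      using U(3) V by (simp add: continuous_map_def)
    hence "openin X {x \<in> topspace (subtopology X U). f x \<in> V}"
      using U(1) openin_trans_full by blast
    moreover have "{x \<in> topspace (subtopology X U). f x \<in> V} \<subseteq> {x \<in> topspace X. f x \<in> V}"
      by auto
    moreover have "x \<in> {x \<in> topspace (subtopology X U). f x \<in> V}"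
      using x U by auto
    ultimately show "\<exists>T. openin X T \<and> x \<in> T \<and> T \<subseteq> {x \<in> topspace X. f x \<in> V}" by blast
  qed
  thus ?thesis using im by (auto simp: continuous_map_def)
qed

lemma continuous_map_paste_open:
  assumes S: "openin X S" and T: "openin X T"
    and f: "continuous_map (subtopology X S) Y f" and g: "continuous_map (subtopology X T) Y g"
    and "\<And>x. x \<in> S \<Longrightarrow> F x = f x" and "\<And>x. x \<in> T \<Longrightarrow> F x = g x"
  shows "continuous_map (subtopology X (S \<union> T)) Y F"
proof (rule continuous_map_locally)
  fix x assume x: "x \<in> topspace (subtopology X (S \<union> T))"
  have s: "(S \<union> T) \<inter> S = S" "(S \<union> T) \<inter> T = T" by auto
  have "continuous_map (subtopology (subtopology X (S \<union> T)) S) Y F"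
    unfolding subtopology_subtopology s by (rule continuous_map_eq[OF f]) (use assms in auto)
  moreover have "continuous_map (subtopology (subtopology X (S \<union> T)) T) Y F"
    unfolding subtopology_subtopology s by (rule continuous_map_eq[OF g]) (use assms in auto)
  moreover have "openin (subtopology X (S \<union> T)) S" "openin (subtopology X (S \<union> T)) T"
    using S T by (auto simp: openin_subtopology)
  ultimately show "\<exists>U. openin (subtopology X (S \<union> T)) U \<and> x \<in> U \<and>
      continuous_map (subtopology (subtopology X (S \<union> T)) U) Y F"
    using x by auto
qed

text \<open>This is the tube lemma: projection along a compact factor is a closed map, and the
  complement of the set is the projection of the closed preimage of the complement of
  \<open>V\<close>.\<close>

lemma openin_forall_compact:
  assumes T: "compact_space T" and F: "continuous_map (prod_topology X T) Y F" and V: "openin Y V"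
  shows "openin X {x \<in> topspace X. \<forall>t\<in>topspace T. F (x, t) \<in> V}"
proof -
  let ?C = "{p \<in> topspace (prod_topology X T). F p \<in> topspace Y - V}"
  have "closedin (prod_topology X T) ?C"
    using closedin_continuous_map_preimage[OF F, of "topspace Y - V"] V by auto
  hence "closedin X (fst ` ?C)"
    using closed_map_fst[OF T, of X] by (auto simp: closed_map_def)
  moreover have "topspace X - fst ` ?C = {x \<in> topspace X. \<forall>t\<in>topspace T. F (x, t) \<in> V}"
  proof (intro set_eqI iffI)
    fix x assume x: "x \<in> topspace X - fst ` ?C"
    have "F (x, t) \<in> V" if "t \<in> topspace T" for t
    proof (rule ccontr)
      assume "F (x, t) \<notin> V"
      moreover have "F (x, t) \<in> topspace Y"
        using continuous_map_image_subset_topspace[OF F] x that by (auto simp: image_subset_iff)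
      ultimately have "(x, t) \<in> ?C" using x that by simp
      thus False using x by (metis (no_types, lifting) DiffD2 fst_conv imageI)
    qed
    thus "x \<in> {x \<in> topspace X. \<forall>t\<in>topspace T. F (x, t) \<in> V}" using x by simp
  next
    fix x assume "x \<in> {x \<in> topspace X. \<forall>t\<in>topspace T. F (x, t) \<in> V}"
    thus "x \<in> topspace X - fst ` ?C" by auto
  qed
  moreover have "openin X (topspace X - fst ` ?C)" using calculation(1) by (simp add: closedin_def)
  ultimately show ?thesis by simp
qed

lemma openin_forall_unit:
  assumes F: "continuous_map (prod_topology X (top_of_set {0..1::real})) Y F" and V: "openin Y V"
  shows "openin X {x \<in> topspace X. \<forall>t\<in>{0..1}. F (x, t) \<in> V}"
  using openin_forall_compact[OF _ F V] by (simp add: compact_space_subtopology)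

lemma openin_preimage_Int:
  assumes "openin T {x \<in> topspace T. g x \<in> S}" "openin T {x \<in> topspace T. g x \<in> S'}"
  shows "openin T {x \<in> topspace T. g x \<in> S \<inter> S'}"
proof -
  have "{x \<in> topspace T. g x \<in> S} \<inter> {x \<in> topspace T. g x \<in> S'} = {x \<in> topspace T. g x \<in> S \<inter> S'}"
    by auto
  thus ?thesis using openin_Int[OF assms] by simp
qed

lemma openin_preimage_Union:
  assumes "\<And>K. K \<in> \<K> \<Longrightarrow> openin T {x \<in> topspace T. g x \<in> K}"
  shows "openin T {x \<in> topspace T. g x \<in> \<Union>\<K>}"
proof -
  have "(\<Union>K\<in>\<K>. {x \<in> topspace T. g x \<in> K}) = {x \<in> topspace T. g x \<in> \<Union>\<K>}" by auto
  moreover have "openin T (\<Union>K\<in>\<K>. {x \<in> topspace T. g x \<in> K})" using assms by blast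
  ultimately show ?thesis by simp
qed

text \<open>The predicate in the definition is a topology, so \<open>topology\<close> returns
  exactly these open sets.\<close>

lemma openin_final_top:
  "openin (final_top T g) S \<longleftrightarrow> S \<subseteq> g ` topspace T \<and> openin T {x \<in> topspace T. g x \<in> S}"
proof -
  have "istopology (\<lambda>S. S \<subseteq> g ` topspace T \<and> openin T {x \<in> topspace T. g x \<in> S})"
    unfolding istopology_def
    by (intro conjI allI impI openin_preimage_Int openin_preimage_Union) (blast | simp)+
  thus ?thesis unfolding final_top_def by (simp add: topology_inverse')
qed

lemma topspace_final_top [simp]: "topspace (final_top T g) = g ` topspace T"
proof -
  have "openin (final_top T g) (g ` topspace T)"
    by (auto simp: openin_final_top cong: conj_cong)
  thus ?thesis by (metis openin_final_top openin_subset openin_topspace subset_antisym)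
qed

lemma continuous_map_into_final_top: "continuous_map T (final_top T g) g"
  by (auto simp: continuous_map_def openin_final_top)

lemma continuous_map_from_final_top:
  assumes "continuous_map T S (F \<circ> g)"
  shows "continuous_map (final_top T g) S F"
proof -
  have "{x \<in> topspace T. g x \<in> g ` topspace T \<and> F (g x) \<in> V} = {x \<in> topspace T. F (g x) \<in> V}" for V
    by auto
  thus ?thesis using assms by (auto simp: continuous_map_def openin_final_top)
qed

lemma openin_final_top3:
  "openin (final_top3 T1 g1 T2 g2 T3 g3) S \<longleftrightarrow>
     S \<subseteq> g1 ` topspace T1 \<union> g2 ` topspace T2 \<union> g3 ` topspace T3 \<and>
     openin T1 {x \<in> topspace T1. g1 x \<in> S} \<and>
     openin T2 {x \<in> topspace T2. g2 x \<in> S} \<and>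
     openin T3 {x \<in> topspace T3. g3 x \<in> S}"
proof -
  have "istopology (\<lambda>S. S \<subseteq> g1 ` topspace T1 \<union> g2 ` topspace T2 \<union> g3 ` topspace T3 \<and>
     openin T1 {x \<in> topspace T1. g1 x \<in> S} \<and>
     openin T2 {x \<in> topspace T2. g2 x \<in> S} \<and>
     openin T3 {x \<in> topspace T3. g3 x \<in> S})"
    unfolding istopology_def
    by (intro conjI allI impI openin_preimage_Int openin_preimage_Union) (blast | simp)+
  thus ?thesis unfolding final_top3_def by (simp add: topology_inverse')
qed

lemma topspace_final_top3 [simp]:
  "topspace (final_top3 T1 g1 T2 g2 T3 g3) =
    g1 ` topspace T1 \<union> g2 ` topspace T2 \<union> g3 ` topspace T3" (is "_ = ?R")
proof
  have "openin (final_top3 T1 g1 T2 g2 T3 g3) ?R"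
    by (auto simp: openin_final_top3 cong: conj_cong)
  thus "?R \<subseteq> topspace (final_top3 T1 g1 T2 g2 T3 g3)" by (rule openin_subset)
  show "topspace (final_top3 T1 g1 T2 g2 T3 g3) \<subseteq> ?R"
    using openin_final_top3[of T1 g1 T2 g2 T3 g3 "topspace (final_top3 T1 g1 T2 g2 T3 g3)"] by simp
qed

section \<open>Path spaces with the compact-open topology\<close>

lemma Union_path_subbasis:
  "\<Union>{{\<theta> \<in> paths K. \<theta> ` C \<subseteq> V} |C V. compact C \<and> C \<subseteq> {0..1::real} \<and> openin K V} = paths K"
  (is "\<Union>?S = _")
proof
  \<comment> \<open>\<open>C = V = {}\<close> imposes no condition, so a single subbasic set is
    already all of \<open>paths K\<close>.\<close>
  have "{\<theta> \<in> paths K. \<theta> ` {} \<subseteq> {}} \<in> ?S" by blast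
  thus "paths K \<subseteq> \<Union>?S" by auto
qed auto

lemma topspace_path_top [simp]: "topspace (path_top K) = paths K"
  unfolding path_top_def topology_generated_by_topspace by (rule Union_path_subbasis)

text \<open>One half of the exponential law. The preimage of a subbasic set consists of the
  \<open>x\<close> with \<open>F (x, t) \<in> V\<close> for all \<open>t\<close> in a compact
  \<open>C\<close>, so the tube lemma applies. The \<open>restrict\<close> matches the normalisation
  of \<open>paths\<close>.\<close>

lemma continuous_map_curry_path:
  assumes F: "continuous_map (prod_topology W (top_of_set {0..1::real})) K F"
  shows "continuous_map W (path_top K) (\<lambda>x. restrict (\<lambda>t. F (x, t)) {0..1})"
  unfolding path_top_def
proof (rule continuous_on_generated_topo)
  have p: "restrict (\<lambda>t. F (x, t)) {0..1} \<in> paths K" if "x \<in> topspace W" for x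
  proof -
    have "continuous_map (top_of_set {0..1}) (prod_topology W (top_of_set {0..1::real})) (\<lambda>t. (x, t))"
      using that by (simp add: continuous_map_pairwise o_def)
    from continuous_map_compose[OF this F]
    have "continuous_map (top_of_set {0..1}) K (\<lambda>t. F (x, t))" by (simp add: o_def)
    hence "continuous_map (top_of_set {0..1}) K (restrict (\<lambda>t. F (x, t)) {0..1})"
      by (rule continuous_map_eq) auto
    thus ?thesis by (simp add: paths_def)
  qed
  show "(\<lambda>x. restrict (\<lambda>t. F (x, t)) {0..1}) ` topspace W
      \<subseteq> \<Union> {{\<theta> \<in> paths K. \<theta> ` C \<subseteq> V} |C V. compact C \<and> C \<subseteq> {0..1} \<and> openin K V}"
    unfolding Union_path_subbasis using p by auto
  fix S assume "S \<in> {{\<theta> \<in> paths K. \<theta> ` C \<subseteq> V} |C V. compact C \<and> C \<subseteq> {0..1} \<and> openin K V}"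
  then obtain C V where S: "S = {\<theta> \<in> paths K. \<theta> ` C \<subseteq> V}" and C: "compact C" "C \<subseteq> {0..1}"
    and V: "openin K V" by blast
  have "continuous_map (prod_topology W (top_of_set C)) K F"
  proof -
    have "continuous_map (prod_topology W (top_of_set C)) (top_of_set {0..1}) snd"
      using C(2) by (auto simp: continuous_map_in_subtopology
          intro: continuous_map_into_fulltopology[OF continuous_map_snd])
    hence "continuous_map (prod_topology W (top_of_set C)) (prod_topology W (top_of_set {0..1})) (\<lambda>p. p)"
      by (simp add: continuous_map_pairwise o_def continuous_map_fst)
    from continuous_map_compose[OF this F] show ?thesis by (simp add: o_def)
  qed
  hence "openin W {x \<in> topspace W. \<forall>t\<in>topspace (top_of_set C). F (x, t) \<in> V}"
    using V C(1) by (intro openin_forall_compact) (auto simp: compact_space_subtopology)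
  moreover have "(\<lambda>x. restrict (\<lambda>t. F (x, t)) {0..1}) -` S \<inter> topspace W
     = {x \<in> topspace W. \<forall>t\<in>topspace (top_of_set C). F (x, t) \<in> V}"
    using p C(2) unfolding S by (auto simp: image_subset_iff subset_eq)
  ultimately show "openin W ((\<lambda>x. restrict (\<lambda>t. F (x, t)) {0..1}) -` S \<inter> topspace W)" by simp
qed

text \<open>Evaluation is continuous for the compact-open topology because \<open>[0,1]\<close> is
  locally compact.\<close>

lemma continuous_map_eval_path:
  "continuous_map (prod_topology (path_top K) (top_of_set {0..1::real})) K (\<lambda>(\<theta>, t). \<theta> t)"
proof -
  have im: "\<theta> t \<in> topspace K" if "\<theta> \<in> paths K" "t \<in> {0..1}" for \<theta> t
    using that by (auto simp: paths_def continuous_map_def)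
  have "openin (prod_topology (path_top K) (top_of_set {0..1::real}))
      {p \<in> paths K \<times> {0..1}. (case p of (\<theta>, t) \<Rightarrow> \<theta> t) \<in> V}" (is "openin ?P ?S") if V: "openin K V" for V
  proof (subst openin_subopen, intro ballI)
    fix p assume "p \<in> ?S"
    then obtain \<theta> t where p: "p = (\<theta>, t)" and \<theta>: "\<theta> \<in> paths K" and t: "t \<in> {0..1}" "\<theta> t \<in> V" by auto
    have "openin (top_of_set {0..1}) {s \<in> {0..1}. \<theta> s \<in> V}"
      using \<theta> V by (auto simp: paths_def continuous_map_def)
    then obtain e where e: "e > 0" "\<And>s. s \<in> {0..1} \<Longrightarrow> dist s t < e \<Longrightarrow> \<theta> s \<in> V"
      using t unfolding openin_euclidean_subtopology_iff by blast
    \<comment> \<open>The closed ball of radius \<open>e/2\<close> is the compact set of a subbasic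
      condition: it stays inside the \<open>e\<close>-ball that \<open>\<theta>\<close> sends into
      \<open>V\<close>, and it contains an open neighbourhood of \<open>t\<close>.\<close>
    define C where "C = cball t (e/2) \<inter> {0..1}"
    have C: "compact C" "C \<subseteq> {0..1}" unfolding C_def by (auto intro: closed_Int_compact compact_Int_closed)
    have "openin (path_top K) {\<eta> \<in> paths K. \<eta> ` C \<subseteq> V}"
      unfolding path_top_def using C V by (intro topology_generated_by_Basis) blast
    moreover have "openin (top_of_set {0..1}) ({0..1} \<inter> ball t (e/2))"
      by (simp add: openin_open_Int)
    ultimately have "openin ?P ({\<eta> \<in> paths K. \<eta> ` C \<subseteq> V} \<times> ({0..1} \<inter> ball t (e/2)))"
      by (simp add: openin_prod_Times_iff)
    moreover have "p \<in> {\<eta> \<in> paths K. \<eta> ` C \<subseteq> V} \<times> ({0..1} \<inter> ball t (e/2))"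
      using p \<theta> t e by (auto simp: C_def dist_commute)
    moreover have "{\<eta> \<in> paths K. \<eta> ` C \<subseteq> V} \<times> ({0..1} \<inter> ball t (e/2)) \<subseteq> ?S"
      unfolding C_def by auto
    ultimately show "\<exists>T. openin ?P T \<and> p \<in> T \<and> T \<subseteq> ?S" by blast
  qed
  thus ?thesis using im by (auto simp: continuous_map_def)
qed

lemma continuous_map_path_at:
  assumes "continuous_map W (path_top K) \<Theta>" and "continuous_map W (top_of_set {0..1::real}) t"
  shows "continuous_map W K (\<lambda>w. \<Theta> w (t w))"
proof -
  have "continuous_map W (prod_topology (path_top K) (top_of_set {0..1})) (\<lambda>w. (\<Theta> w, t w))"
    using assms by (simp add: continuous_map_pairwise o_def)
  from continuous_map_compose[OF this continuous_map_eval_path] show ?thesis by (simp add: o_def)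
qed

subsection \<open>Fibrewise pointed homotopies and neighbourhoods of the section\<close>

lemma homotopic_withI:
  assumes "continuous_map (prod_topology (top_of_set {0..1::real}) X) Y H"
    and "\<And>x. x \<in> topspace X \<Longrightarrow> H (0, x) = p x" and "\<And>x. x \<in> topspace X \<Longrightarrow> H (1, x) = q x"
    and "\<And>h k. (\<And>x. x \<in> topspace X \<Longrightarrow> h x = k x) \<Longrightarrow> P h = P k"
    and "\<And>t. t \<in> {0..1} \<Longrightarrow> P (\<lambda>x. H (t, x))"
  shows "homotopic_with P X Y p q"
  using assms by (subst homotopic_with) blast+

text \<open>Continuity of \<open>j\<close> is added to \<open>p\<close>, so that the check of
  \<open>q\<close> may use that \<open>j\<close> maps into \<open>X2\<close>; a fibrewise condition
  on \<open>h\<close> is known only at points of \<open>X2\<close>.\<close>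

lemma homotopic_with_compose_left:
  assumes "homotopic_with p X1 X2 f g" and "continuous_map X2 X3 h"
    and "\<And>j. continuous_map X1 X2 j \<Longrightarrow> p j \<Longrightarrow> q (h \<circ> j)"
  shows "homotopic_with q X1 X3 (h \<circ> f) (h \<circ> g)"
proof -
  have "homotopic_with (\<lambda>j. continuous_map X1 X2 j \<and> p j) X1 X2 f g"
    by (rule homotopic_with_mono[OF assms(1)]) auto
  thus ?thesis by (rule homotopic_with_compose_continuous_map_left[OF _ assms(2)]) (use assms(3) in auto)
qed

lemma homotopic_with_compose_right:
  assumes "homotopic_with p X2 X3 f g" and "continuous_map X1 X2 h"
    and "\<And>j. continuous_map X2 X3 j \<Longrightarrow> p j \<Longrightarrow> q (j \<circ> h)"
  shows "homotopic_with q X1 X3 (f \<circ> h) (g \<circ> h)"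
proof -
  have "homotopic_with (\<lambda>j. continuous_map X2 X3 j \<and> p j) X2 X3 f g"
    by (rule homotopic_with_mono[OF assms(1)]) auto
  thus ?thesis by (rule homotopic_with_compose_continuous_map_right[OF _ assms(2)]) (use assms(3) in auto)
qed

lemma continuous_map_image_mem: "continuous_map X Y f \<Longrightarrow> x \<in> topspace X \<Longrightarrow> f x \<in> topspace Y"
  by (auto simp: continuous_map_def)

lemma fp_homotopic_compose_left:
  assumes "fp_homotopic B X Y g0 g1" and "fp_map B Y Z h"
  shows "fp_homotopic B X Z (h \<circ> g0) (h \<circ> g1)"
  using assms unfolding fp_homotopic_def fp_map_def
  by (auto intro!: homotopic_with_compose_left dest: continuous_map_image_mem)

lemma fp_homotopic_compose_right:
  assumes "fp_homotopic B Y Z g0 g1" and "fp_map B X Y h"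
  shows "fp_homotopic B X Z (g0 \<circ> h) (g1 \<circ> h)"
  using assms unfolding fp_homotopic_def fp_map_def
  by (auto intro!: homotopic_with_compose_right dest: continuous_map_image_mem)

lemma fp_homotopic_sym: "fp_homotopic B X Y g0 g1 \<Longrightarrow> fp_homotopic B X Y g1 g0"
  unfolding fp_homotopic_def by (rule homotopic_with_symD)

lemma fp_homotopic_trans:
  "fp_homotopic B X Y g0 g1 \<Longrightarrow> fp_homotopic B X Y g1 g2 \<Longrightarrow> fp_homotopic B X Y g0 g2"
  unfolding fp_homotopic_def by (rule homotopic_with_trans)

lemma fp_map_compose: "fp_map B X Y g \<Longrightarrow> fp_map B Y Z h \<Longrightarrow> fp_map B X Z (h \<circ> g)"
  unfolding fp_map_def by (auto intro: continuous_map_compose dest: continuous_map_image_mem)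

lemma fp_homotopic_refl: "fp_map B X Y g \<Longrightarrow> fp_homotopic B X Y g g"
  unfolding fp_homotopic_def fp_map_def by simp

lemma fp_map_eq:
  assumes "fibrewise_pointed_space B X" "fp_map B X Y g" "\<And>x. x \<in> topspace (tsp X) \<Longrightarrow> g x = g' x"
  shows "fp_map B X Y g'"
proof -
  have "sct X b \<in> topspace (tsp X)" if "b \<in> topspace B" for b
    using assms(1) that by (auto simp: fibrewise_pointed_space_def dest: continuous_map_image_mem)
  thus ?thesis using assms unfolding fp_map_def by (auto intro: continuous_map_eq)
qed

lemma fp_homotopic_eq:
  assumes X: "fibrewise_pointed_space B X" and g: "fp_homotopic B X Y g0 g1"
    and eq: "\<And>x. x \<in> topspace (tsp X) \<Longrightarrow> g0 x = g0' x" "\<And>x. x \<in> topspace (tsp X) \<Longrightarrow> g1 x = g1' x"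
  shows "fp_homotopic B X Y g0' g1'"
proof -
  have s: "sct X b \<in> topspace (tsp X)" if "b \<in> topspace B" for b
    using X that by (auto simp: fibrewise_pointed_space_def dest: continuous_map_image_mem)
  show ?thesis
    using g unfolding fp_homotopic_def
    by (rule homotopic_with_eq) (use s eq in auto)
qed

lemma sct_mem: "fibrewise_pointed_space B X \<Longrightarrow> b \<in> topspace B \<Longrightarrow> sct X b \<in> topspace (tsp X)"
  by (auto simp: fibrewise_pointed_space_def dest: continuous_map_image_mem)

lemma prj_mem: "fibrewise_pointed_space B X \<Longrightarrow> x \<in> topspace (tsp X) \<Longrightarrow> prj X x \<in> topspace B"
  by (auto simp: fibrewise_pointed_space_def dest: continuous_map_image_mem)

lemma prj_sct: "fibrewise_pointed_space B X \<Longrightarrow> b \<in> topspace B \<Longrightarrow> prj X (sct X b) = b"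
  by (auto simp: fibrewise_pointed_space_def)

lemma fp_map_id: "fibrewise_pointed_space B X \<Longrightarrow> fp_map B X X id"
  by (simp add: fp_map_def)

lemma fp_map_mem: "fp_map B X Y g \<Longrightarrow> x \<in> topspace (tsp X) \<Longrightarrow> g x \<in> topspace (tsp Y)"
  by (auto simp: fp_map_def dest: continuous_map_image_mem)

lemma fp_map_prj: "fp_map B X Y g \<Longrightarrow> x \<in> topspace (tsp X) \<Longrightarrow> prj Y (g x) = prj X x"
  by (auto simp: fp_map_def)

lemma fp_map_sct: "fp_map B X Y g \<Longrightarrow> b \<in> topspace B \<Longrightarrow> g (sct X b) = sct Y b"
  by (auto simp: fp_map_def)

text \<open>The extension property is tested on the cylinder over the section, glued to
  \<open>X\<close> at height 0: \<open>x\<close> goes to \<open>(x, 0)\<close> and the section rises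
  along its cylinder. The extension is a fibrewise retraction of \<open>X \<times> [0,1]\<close>
  onto this space, and \<open>c\<close> is its \<open>X\<close>-coordinate at time 1. The injection
  \<open>\<iota>\<close> moves the space into the type over which the cofibration property
  quantifies.\<close>

lemma well_pointed_halo:
  fixes X :: "('a, 'b) fsp" and \<iota> :: "'a \<times> real \<Rightarrow> 'd"
  assumes inj: "inj \<iota>" and X: "fibrewise_pointed_space B X"
    and wp: "fib_well_pointed B X TYPE('d)"
  obtains V c where "openin (tsp X) V" "sct X ` topspace B \<subseteq> V" "fp_homotopic B X X id c"
    "\<And>x. x \<in> V \<Longrightarrow> c x = sct X (prj X x)"
proof -
  let ?I = "top_of_set {0..1::real}"
  define S where "S = subtopology (prod_topology (tsp X) ?I) {(x, t). t = 0 \<or> x \<in> sct X ` topspace B}"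
  define Y where "Y = final_top S \<iota>"
  note hep = wp[unfolded fib_well_pointed_def fib_cofibration_def, THEN conjunct2, THEN conjunct2,
      THEN conjunct2]
  have inv: "inv \<iota> (\<iota> p) = p" for p using inj by simp
  have pX: "continuous_map (tsp X) B (prj X)" and sX: "continuous_map B (tsp X) (sct X)"
    using X by (auto simp: fibrewise_pointed_space_def)
  have inv_cont: "continuous_map Y S (inv \<iota>)"
    unfolding Y_def by (rule continuous_map_from_final_top) (simp add: o_def inv)
  have fstS: "continuous_map S (tsp X) fst" and sndS: "continuous_map S euclideanreal snd"
    unfolding S_def
    by (auto intro!: continuous_map_from_subtopology continuous_map_fst
        continuous_map_into_fulltopology[OF continuous_map_snd])
  have pY: "continuous_map Y B (prj X \<circ> fst \<circ> inv \<iota>)"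
    using continuous_map_compose[OF continuous_map_compose[OF inv_cont fstS] pX] by (simp add: o_assoc)
  have "continuous_map (tsp X) S (\<lambda>x. (x, 0))"
    unfolding S_def by (auto simp: continuous_map_in_subtopology continuous_map_pairwise o_def)
  hence g: "continuous_map (tsp X) Y (\<lambda>x. \<iota> (x, 0))"
    using continuous_map_compose[OF _ continuous_map_into_final_top[of S \<iota>]] unfolding Y_def by (auto simp: o_def)
  have "continuous_map (prod_topology B ?I) S (\<lambda>p. (sct X (fst p), snd p))"
    unfolding S_def
    by (auto simp: continuous_map_in_subtopology continuous_map_pairwise o_def
        intro!: continuous_map_compose[OF continuous_map_fst sX, unfolded o_def]
          continuous_map_into_fulltopology[OF continuous_map_snd])
  hence H: "continuous_map (prod_topology B ?I) Y (\<lambda>p. \<iota> (sct X (fst p), snd p))"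
    using continuous_map_compose[OF _ continuous_map_into_final_top[of S \<iota>]] unfolding Y_def by (auto simp: o_def)
  have "\<exists>G. continuous_map (prod_topology (tsp X) ?I) Y G \<and>
      (\<forall>x\<in>topspace (tsp X). \<forall>t\<in>{0..1}. (prj X \<circ> fst \<circ> inv \<iota>) (G (x, t)) = prj X x) \<and>
      (\<forall>x\<in>topspace (tsp X). G (x, 0) = \<iota> (x, 0)) \<and>
      (\<forall>b\<in>topspace B. \<forall>t\<in>{0..1}. G (sct X b, t) = \<iota> (sct X (fst (b, t)), snd (b, t)))"
  proof (rule hep[THEN spec, THEN spec, THEN spec, THEN spec, THEN mp], intro conjI)
  qed (use pY g H X in \<open>auto simp: inv prj_sct o_def\<close>)
  then obtain G where G: "continuous_map (prod_topology (tsp X) ?I) Y G"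
    and Gp: "\<And>x t. x \<in> topspace (tsp X) \<Longrightarrow> t \<in> {0..1} \<Longrightarrow> prj X (fst (inv \<iota> (G (x, t)))) = prj X x"
    and G0: "\<And>x. x \<in> topspace (tsp X) \<Longrightarrow> G (x, 0) = \<iota> (x, 0)"
    and Gs: "\<And>b t. b \<in> topspace B \<Longrightarrow> t \<in> {0..1} \<Longrightarrow> G (sct X b, t) = \<iota> (sct X b, t)" by auto
  have \<gamma>: "continuous_map (prod_topology (tsp X) ?I) S (inv \<iota> \<circ> G)"
    by (rule continuous_map_compose[OF G inv_cont])
  \<comment> \<open>Positive height at time 1 means that the retraction has landed on the cylinder
    over the section; being fibrewise, it then hits the section point of the same fibre. Section
    points themselves have height 1.\<close>
  define V where "V = {x \<in> topspace (tsp X). snd (inv \<iota> (G (x, 1))) > 0}"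
  define c where "c = (\<lambda>x. fst (inv \<iota> (G (x, 1))))"
  have "continuous_map (tsp X) (prod_topology (tsp X) ?I) (\<lambda>x. (x, 1))"
    by (auto simp: continuous_map_pairwise o_def)
  from continuous_map_compose[OF continuous_map_compose[OF this \<gamma>] sndS]
  have "continuous_map (tsp X) euclideanreal (\<lambda>x. snd (inv \<iota> (G (x, 1))))" by (simp add: o_def)
  hence 1: "openin (tsp X) V"
    unfolding V_def using openin_continuous_map_preimage[of "tsp X" euclideanreal _ "{0<..}"] by simp
  have 2: "sct X ` topspace B \<subseteq> V"
    using X by (auto simp: V_def Gs inv sct_mem)
  have 3: "fp_homotopic B X X id c"
    unfolding fp_homotopic_def
  proof (rule homotopic_withI)
    have "continuous_map (prod_topology ?I (tsp X)) (prod_topology (tsp X) ?I) (\<lambda>p. (snd p, fst p))"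
      by (simp add: continuous_map_pairwise o_def continuous_map_fst continuous_map_snd)
    from continuous_map_compose[OF continuous_map_compose[OF this \<gamma>] fstS]
    show "continuous_map (prod_topology ?I (tsp X)) (tsp X) (\<lambda>p. fst (inv \<iota> (G (snd p, fst p))))"
      by (simp add: o_def)
  qed (use X in \<open>auto simp: G0 Gs Gp inv c_def sct_mem\<close>)
  have 4: "c x = sct X (prj X x)" if "x \<in> V" for x
  proof -
    have x: "x \<in> topspace (tsp X)" "snd (inv \<iota> (G (x, 1))) > 0" using that by (auto simp: V_def)
    have "inv \<iota> (G (x, 1)) \<in> topspace S"
      using continuous_map_image_mem[OF \<gamma>, of "(x, 1)"] x by simp
    then obtain b where b: "b \<in> topspace B" "c x = sct X b"
      using x by (auto simp: S_def c_def)
    have "prj X (c x) = prj X x" using Gp[of x 1] x by (simp add: c_def)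
    thus ?thesis using b X by (simp add: prj_sct)
  qed
  show ?thesis using that 1 2 3 4 by blast
qed

subsection \<open>The fibrewise pointed join\<close>

lemma openin_preimage_on:
  assumes "openin A {x \<in> topspace A. Q x}"
    and "continuous_map (subtopology A {x \<in> topspace A. Q x}) T G" and "openin T V"
  shows "openin A {x \<in> topspace A. Q x \<and> G x \<in> V}"
proof -
  have "openin (subtopology A {x \<in> topspace A. Q x}) {x \<in> topspace (subtopology A {x \<in> topspace A. Q x}). G x \<in> V}"
    using openin_continuous_map_preimage[OF assms(2,3)] .
  hence "openin A {x \<in> topspace (subtopology A {x \<in> topspace A. Q x}). G x \<in> V}"
    using assms(1) openin_trans_full by blast
  moreover have "{x \<in> topspace (subtopology A {x \<in> topspace A. Q x}). G x \<in> V} = {x \<in> topspace A. Q x \<and> G x \<in> V}"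
    by auto
  ultimately show ?thesis by simp
qed

locale join_data =
  fixes B :: "'b topology" and Y Z K :: "('b, 'e, 'x) usp"
    and h k :: "('b, 'e, 'x) U \<Rightarrow> ('b, 'e, 'x) U"
  assumes Y: "fibrewise_pointed_space B Y" and Z: "fibrewise_pointed_space B Z"
    and K: "fibrewise_pointed_space B K" and h: "fp_map B Y K h" and k: "fp_map B Z K k"
begin

abbreviation "J \<equiv> fst (fjoin B Y Z K h k)"
abbreviation "jmap \<equiv> snd (fjoin B Y Z K h k)"
abbreviation "rel \<equiv> join_rel B Y Z K h k"
abbreviation "rep \<equiv> join_rep B Y Z K h k"
definition "EI = prod_topology (Ehk B Y Z K h k) (top_of_set {0..1::real})"

text \<open>The components of \<open>q = ((y, (b, \<theta>), z), t)\<close>.\<close>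

abbreviation "yc q \<equiv> fst (fst q)"
abbreviation "bc q \<equiv> fst (fst (snd (fst q)))"
abbreviation "pc q \<equiv> snd (fst (snd (fst q)))"
abbreviation "zc q \<equiv> snd (snd (fst q))"
abbreviation "uj q \<equiv> UJ (yc q) (bc q) (pc q) (zc q) (snd q)"

lemma tsp_J: "tsp J = final_top3 (tsp Y) (\<lambda>y. rep (UL y)) EI (\<lambda>q. rep (uj q)) (tsp Z) (\<lambda>z. rep (UR z))"
  by (simp add: fjoin_def Let_def case_prod_unfold EI_def)

lemma prj_J: "prj J (UL y) = prj Y y" "prj J (UR z) = prj Z z" "prj J (UJ y b \<theta> z t) = b"
  by (simp_all add: fjoin_def Let_def)

lemma sct_J: "sct J b = rep (UL (sct Y b))"
  by (simp add: fjoin_def Let_def)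

lemma jmap: "jmap (UL y) = h y" "jmap (UR z) = k z" "jmap (UJ y b \<theta> z t) = \<theta> t"
  by (simp_all add: fjoin_def Let_def)

lemma mem_Ehk:
  "(y, (b, \<theta>), z) \<in> topspace (Ehk B Y Z K h k) \<longleftrightarrow>
     y \<in> topspace (tsp Y) \<and> b \<in> topspace B \<and> \<theta> \<in> paths (tsp K) \<and> (\<forall>t\<in>{0..1}. prj K (\<theta> t) = b) \<and>
     z \<in> topspace (tsp Z) \<and> h y = \<theta> 0 \<and> k z = \<theta> 1"
  by (auto simp: Ehk_def PB_def)

lemma mem_EI:
  "q \<in> topspace EI \<longleftrightarrow>
     yc q \<in> topspace (tsp Y) \<and> bc q \<in> topspace B \<and> pc q \<in> paths (tsp K) \<and>
     (\<forall>t\<in>{0..1}. prj K (pc q t) = bc q) \<and>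
     zc q \<in> topspace (tsp Z) \<and> h (yc q) = pc q 0 \<and> k (zc q) = pc q 1 \<and> snd q \<in> {0..1}"
proof -
  obtain y b \<theta> z t where q: "q = ((y, (b, \<theta>), z), t)" by (metis surj_pair)
  show ?thesis unfolding q EI_def by (auto simp: mem_Ehk)
qed

text \<open>Points of the join are representatives chosen by \<open>SOME\<close>; a function defined by cases on
  the three summands descends to the join exactly when it is invariant under \<open>rel\<close>.\<close>

lemma rep_invariant:
  assumes "\<And>u v. rel u v \<Longrightarrow> F u = F v"
  shows "F (rep u) = F u"
proof -
  have "equivclp rel u (rep u)"
    unfolding join_rep_def by (rule someI[of _ u]) (simp add: equivclp_def)
  hence "(\<lambda>a b. rel a b \<or> rel b a)\<^sup>*\<^sup>* u (rep u)"
    unfolding equivclp_def symclp_def .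
  thus ?thesis by (induction rule: rtranclp_induct) (use assms in \<open>metis+\<close>)
qed

lemma rep_eq:
  assumes "rel u v" shows "rep u = rep v"
proof -
  have "equivclp rel u w = equivclp rel v w" for w
    using assms by (meson equivclp_sym equivclp_trans r_into_equivclp)
  thus ?thesis by (simp add: join_rep_def)
qed

text \<open>Replacing \<open>F\<close> by \<open>undefined\<close> off the saturated set
  \<open>P\<close> makes it invariant everywhere, and then the total version applies.\<close>

lemma rep_invariant_on:
  assumes P: "\<And>u v. rel u v \<Longrightarrow> P u = P v" and F: "\<And>u v. rel u v \<Longrightarrow> P u \<Longrightarrow> F u = F v" and "P u"
  shows "F (rep u) = F u"
proof -
  have "(if P (rep u) then F (rep u) else undefined) = (if P u then F u else undefined)"
    by (rule rep_invariant) (use P F in auto)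
  thus ?thesis using rep_invariant[of P, OF P] assms(3) by (auto split: if_splits)
qed

lemma relE:
  assumes "rel u v"
  obtains q where "q \<in> topspace EI" "u = uj q" "snd q = 0" "v = UL (yc q)"
  | q where "q \<in> topspace EI" "u = uj q" "snd q = 1" "v = UR (zc q)"
  | b t where "b \<in> topspace B" "t \<in> {0..1}" "u = UJ (sct Y b) b (const_path (sct K b)) (sct Z b) t"
      "v = UL (sct Y b)"
  | b where "b \<in> topspace B" "u = UR (sct Z b)" "v = UL (sct Y b)"
proof -
  consider y b \<theta> z where "(y, (b, \<theta>), z) \<in> topspace (Ehk B Y Z K h k)" "u = UJ y b \<theta> z 0" "v = UL y"
    | y b \<theta> z where "(y, (b, \<theta>), z) \<in> topspace (Ehk B Y Z K h k)" "u = UJ y b \<theta> z 1" "v = UR z"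
    | b t where "b \<in> topspace B" "t \<in> {0..1}" "u = UJ (sct Y b) b (const_path (sct K b)) (sct Z b) t"
      "v = UL (sct Y b)"
    | b where "b \<in> topspace B" "u = UR (sct Z b)" "v = UL (sct Y b)"
    using assms unfolding join_rel_def by metis
  thus thesis
  proof cases
    case (1 y b \<theta> z) thus ?thesis using that(1)[of "((y, (b, \<theta>), z), 0)"] by (simp add: EI_def)
  next
    case (2 y b \<theta> z) thus ?thesis using that(2)[of "((y, (b, \<theta>), z), 1)"] by (simp add: EI_def)
  qed (use that in blast)+
qed

lemma rep_0:
  assumes "q \<in> topspace EI" "snd q = 0"
  shows "rep (uj q) = rep (UL (yc q))"
proof (rule rep_eq)
  obtain y b \<theta> z where q: "q = ((y, (b, \<theta>), z), 0)" using assms(2) by (metis prod.collapse)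
  show "rel (uj q) (UL (yc q))" unfolding join_rel_def using assms(1) unfolding q EI_def by auto
qed

lemma rep_1:
  assumes "q \<in> topspace EI" "snd q = 1"
  shows "rep (uj q) = rep (UR (zc q))"
proof (rule rep_eq)
  obtain y b \<theta> z where q: "q = ((y, (b, \<theta>), z), 1)" using assms(2) by (metis prod.collapse)
  show "rel (uj q) (UR (zc q))" unfolding join_rel_def using assms(1) unfolding q EI_def by auto
qed

lemma rep_sct_UJ:
  assumes "b \<in> topspace B" "t \<in> {0..1}"
  shows "rep (UJ (sct Y b) b (const_path (sct K b)) (sct Z b) t) = sct J b"
  unfolding sct_J by (rule rep_eq) (use assms in \<open>auto simp: join_rel_def\<close>)

lemma rep_sct_UR: "b \<in> topspace B \<Longrightarrow> rep (UR (sct Z b)) = sct J b"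
  unfolding sct_J by (rule rep_eq) (auto simp: join_rel_def)

lemma J_cases:
  assumes "u \<in> topspace (tsp J)"
  obtains y where "y \<in> topspace (tsp Y)" "u = rep (UL y)"
  | q where "q \<in> topspace EI" "u = rep (uj q)"
  | z where "z \<in> topspace (tsp Z)" "u = rep (UR z)"
  using assms unfolding tsp_J topspace_final_top3 by blast

lemma J_mem:
  "y \<in> topspace (tsp Y) \<Longrightarrow> rep (UL y) \<in> topspace (tsp J)"
  "q \<in> topspace EI \<Longrightarrow> rep (uj q) \<in> topspace (tsp J)"
  "z \<in> topspace (tsp Z) \<Longrightarrow> rep (UR z) \<in> topspace (tsp J)"
  unfolding tsp_J topspace_final_top3 by blast+

lemma openin_J:
  assumes inv: "\<And>u v. rel u v \<Longrightarrow> P u = P v"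
    and "openin (tsp Y) {y \<in> topspace (tsp Y). P (UL y)}"
    and "openin EI {q \<in> topspace EI. P (uj q)}"
    and "openin (tsp Z) {z \<in> topspace (tsp Z). P (UR z)}"
  shows "openin (tsp J) {u \<in> topspace (tsp J). P u}"
proof -
  have P: "P (rep u) = P u" for u by (rule rep_invariant) (rule inv)
  have "{y \<in> topspace (tsp Y). rep (UL y) \<in> {u \<in> topspace (tsp J). P u}} = {y \<in> topspace (tsp Y). P (UL y)}"
    "{q \<in> topspace EI. rep (uj q) \<in> {u \<in> topspace (tsp J). P u}} = {q \<in> topspace EI. P (uj q)}"
    "{z \<in> topspace (tsp Z). rep (UR z) \<in> {u \<in> topspace (tsp J). P u}} = {z \<in> topspace (tsp Z). P (UR z)}"
    using J_mem P by blast+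
  thus ?thesis using assms(2-4) unfolding openin_final_top3 tsp_J topspace_final_top3 by fastforce
qed

text \<open>A quotient map restricted to a saturated open set is again a quotient map. The relative
  form is needed because the end maps and tracks of the two halves are invariant only on such a set
  \<open>P\<close>.\<close>

lemma continuous_map_from_J:
  assumes P: "\<And>u v. rel u v \<Longrightarrow> P u = P v" and F: "\<And>u v. rel u v \<Longrightarrow> P u \<Longrightarrow> F u = F v"
    and oY: "openin (tsp Y) {y \<in> topspace (tsp Y). P (UL y)}"
    and oE: "openin EI {q \<in> topspace EI. P (uj q)}"
    and oZ: "openin (tsp Z) {z \<in> topspace (tsp Z). P (UR z)}"
    and cY: "continuous_map (subtopology (tsp Y) {y \<in> topspace (tsp Y). P (UL y)}) T (\<lambda>y. F (UL y))"
    and cE: "continuous_map (subtopology EI {q \<in> topspace EI. P (uj q)}) T (\<lambda>q. F (uj q))"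
    and cZ: "continuous_map (subtopology (tsp Z) {z \<in> topspace (tsp Z). P (UR z)}) T (\<lambda>z. F (UR z))"
  shows "continuous_map (subtopology (tsp J) {u \<in> topspace (tsp J). P u}) T F"
proof -
  have Fr: "F (rep u) = F u" if "P u" for u by (rule rep_invariant_on[of P F, OF P F that])
  have Pr: "P (rep u) = P u" for u by (rule rep_invariant) (rule P)
  have im: "F u \<in> topspace T" if u: "u \<in> topspace (tsp J)" "P u" for u
    using u(1)
  proof (cases rule: J_cases)
    case (1 y) thus ?thesis using u Fr Pr continuous_map_image_mem[OF cY, of y] by simp
  next
    case (2 q) thus ?thesis using u Fr Pr continuous_map_image_mem[OF cE, of q] by simp
  next
    case (3 z) thus ?thesis using u Fr Pr continuous_map_image_mem[OF cZ, of z] by simp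
  qed
  show ?thesis
    unfolding continuous_map_def
  proof (intro conjI allI impI)
    show "F \<in> topspace (subtopology (tsp J) {u \<in> topspace (tsp J). P u}) \<rightarrow> topspace T"
      using im by auto
    fix V assume V: "openin T V"
    have "openin (tsp J) {u \<in> topspace (tsp J). P u \<and> F u \<in> V}"
    proof (rule openin_J)
      show "(P u \<and> F u \<in> V) = (P v \<and> F v \<in> V)" if "rel u v" for u v
        using P[OF that] F[OF that] by metis
    qed (rule openin_preimage_on[OF oY cY V] openin_preimage_on[OF oE cE V] openin_preimage_on[OF oZ cZ V])+
    moreover have "{u \<in> topspace (subtopology (tsp J) {u \<in> topspace (tsp J). P u}). F u \<in> V}
        = {u \<in> topspace (tsp J). P u \<and> F u \<in> V}" by auto
    ultimately show "openin (subtopology (tsp J) {u \<in> topspace (tsp J). P u})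
        {u \<in> topspace (subtopology (tsp J) {u \<in> topspace (tsp J). P u}). F u \<in> V}"
      by (auto simp: openin_subtopology)
  qed
qed

lemma continuous_map_from_J_all:
  assumes "\<And>u v. rel u v \<Longrightarrow> F u = F v"
    and "continuous_map (tsp Y) T (\<lambda>y. F (UL y))" and "continuous_map EI T (\<lambda>q. F (uj q))"
    and "continuous_map (tsp Z) T (\<lambda>z. F (UR z))"
  shows "continuous_map (tsp J) T F"
proof -
  have "continuous_map (subtopology (tsp J) {u \<in> topspace (tsp J). True}) T F"
    by (rule continuous_map_from_J) (use assms in auto)
  thus ?thesis by simp
qed

lemma continuous_map_into_J:
  "continuous_map (tsp Y) (tsp J) (\<lambda>y. rep (UL y))"
  "continuous_map EI (tsp J) (\<lambda>q. rep (uj q))"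
  "continuous_map (tsp Z) (tsp J) (\<lambda>z. rep (UR z))"
  by (auto simp: continuous_map_def tsp_J openin_final_top3)

lemma continuous_map_components:
  "continuous_map EI (tsp Y) (\<lambda>q. yc q)"
  "continuous_map EI B (\<lambda>q. bc q)"
  "continuous_map EI (path_top (tsp K)) (\<lambda>q. pc q)"
  "continuous_map EI (tsp Z) (\<lambda>q. zc q)"
  "continuous_map EI (top_of_set {0..1::real}) snd"
proof -
  have E: "continuous_map EI (Ehk B Y Z K h k) fst" unfolding EI_def by (rule continuous_map_fst)
  have "continuous_map (Ehk B Y Z K h k) (prod_topology (tsp Y) (prod_topology (PB B K) (tsp Z))) (\<lambda>p. p)"
    unfolding Ehk_def by (intro continuous_map_from_subtopology) simp
  from continuous_map_compose[OF E this]
  have 1: "continuous_map EI (tsp Y) (\<lambda>q. yc q)" "continuous_map EI (PB B K) (\<lambda>q. fst (snd (fst q)))"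
     "continuous_map EI (tsp Z) (\<lambda>q. zc q)"
    by (auto simp: continuous_map_pairwise o_def)
  have "continuous_map (PB B K) (prod_topology B (path_top (tsp K))) (\<lambda>p. p)"
    unfolding PB_def by (intro continuous_map_from_subtopology) simp
  from continuous_map_compose[OF 1(2) this]
  have 2: "continuous_map EI B (\<lambda>q. bc q)" "continuous_map EI (path_top (tsp K)) (\<lambda>q. pc q)"
    by (auto simp: continuous_map_pairwise o_def)
  show "continuous_map EI (tsp Y) (\<lambda>q. yc q)" "continuous_map EI B (\<lambda>q. bc q)"
    "continuous_map EI (path_top (tsp K)) (\<lambda>q. pc q)" "continuous_map EI (tsp Z) (\<lambda>q. zc q)"
    "continuous_map EI (top_of_set {0..1::real}) snd"
    using 1 2 by (auto simp: EI_def intro: continuous_map_snd)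
qed

text \<open>The path lies over \<open>bc q\<close> and begins at \<open>h (yc q)\<close>.\<close>

lemma prj_yc: "q \<in> topspace EI \<Longrightarrow> prj Y (yc q) = bc q"
  using fp_map_prj[OF h, of "yc q"] by (auto simp: mem_EI)

lemma prj_zc: "q \<in> topspace EI \<Longrightarrow> prj Z (zc q) = bc q"
  using fp_map_prj[OF k, of "zc q"] by (auto simp: mem_EI)

lemma prj_J_invariant: "rel u v \<Longrightarrow> prj J u = prj J v"
  by (erule relE) (use Y Z in \<open>auto simp: prj_J prj_yc prj_zc prj_sct\<close>)

lemma jmap_invariant: "rel u v \<Longrightarrow> jmap u = jmap v"
  by (erule relE) (auto simp: jmap mem_EI const_path_def fp_map_sct[OF h] fp_map_sct[OF k])

lemma prj_rep [simp]: "prj J (rep u) = prj J u"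
  by (rule rep_invariant) (rule prj_J_invariant)

lemma jmap_rep [simp]: "jmap (rep u) = jmap u"
  by (rule rep_invariant) (rule jmap_invariant)

lemma fibrewise_pointed_space_J: "fibrewise_pointed_space B J"
  unfolding fibrewise_pointed_space_def
proof (intro conjI ballI)
  show "continuous_map (tsp J) B (prj J)"
  proof (rule continuous_map_from_J_all)
    show "prj J u = prj J v" if "rel u v" for u v using that by (rule prj_J_invariant)
    show "continuous_map EI B (\<lambda>q. prj J (uj q))" using continuous_map_components(2) by (simp add: prj_J)
  qed (use Y Z in \<open>auto simp: prj_J fibrewise_pointed_space_def\<close>)
  have "continuous_map B (tsp Y) (sct Y)" using Y by (simp add: fibrewise_pointed_space_def)
  from continuous_map_compose[OF this continuous_map_into_J(1)]
  show "continuous_map B (tsp J) (sct J)" unfolding o_def sct_J .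
  show "prj J (sct J b) = b" if "b \<in> topspace B" for b
    using that Y unfolding sct_J by (simp add: prj_J prj_sct)
qed

lemma fp_map_jmap: "fp_map B J K jmap"
  unfolding fp_map_def
proof (intro conjI ballI)
  show "continuous_map (tsp J) (tsp K) jmap"
  proof (rule continuous_map_from_J_all)
    show "jmap u = jmap v" if "rel u v" for u v using that by (rule jmap_invariant)
    show "continuous_map EI (tsp K) (\<lambda>q. jmap (uj q))"
      using continuous_map_path_at[OF continuous_map_components(3,5)] by (simp add: jmap)
  qed (use h k in \<open>auto simp: jmap fp_map_def\<close>)
  show "prj K (jmap u) = prj J u" if "u \<in> topspace (tsp J)" for u
    using that
    by (cases rule: J_cases)
      (auto simp: jmap prj_J fp_map_prj[OF h] fp_map_prj[OF k] mem_EI)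
  show "jmap (sct J b) = sct K b" if "b \<in> topspace B" for b
    using that by (simp add: sct_J jmap fp_map_sct[OF h])
qed

text \<open>The preimage of the section in the three summands. To be saturated it must contain,
  besides the collapsed segments, the ends \<open>t = 0\<close> and \<open>t = 1\<close> that are
  glued to section points of \<open>Y\<close> and \<open>Z\<close>, whatever the path does. On the
  segments it is enough to ask that the path stays in the section of \<open>K\<close>; the fibre
  condition makes such a path constant.\<close>

definition in_section :: "('b, 'e, 'x) U \<Rightarrow> bool" where
  "in_section u = (case u of UL y \<Rightarrow> y \<in> sct Y ` topspace B | UR z \<Rightarrow> z \<in> sct Z ` topspace B
     | UJ y b \<theta> z t \<Rightarrow> t = 0 \<and> y \<in> sct Y ` topspace B \<or> t = 1 \<and> z \<in> sct Z ` topspace B \<or>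
         y \<in> sct Y ` topspace B \<and> (\<forall>s\<in>{0..1}. \<theta> s \<in> sct K ` topspace B) \<and> z \<in> sct Z ` topspace B
     | _ \<Rightarrow> False)"

lemma in_section_invariant: "rel u v \<Longrightarrow> in_section u = in_section v"
  by (erule relE) (auto simp: in_section_def const_path_def)

lemma in_section_rep [simp]: "in_section (rep u) = in_section u"
  by (rule rep_invariant) (rule in_section_invariant)

lemma in_section_iff:
  assumes "u \<in> topspace (tsp J)"
  shows "in_section u \<longleftrightarrow> u \<in> sct J ` topspace B"
proof
  assume "u \<in> sct J ` topspace B"
  then obtain b where "b \<in> topspace B" "u = rep (UL (sct Y b))" by (auto simp: sct_J)
  thus "in_section u" unfolding \<open>u = _\<close> in_section_rep by (simp add: in_section_def)
next
  assume s: "in_section u"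
  show "u \<in> sct J ` topspace B" using assms
  proof (cases rule: J_cases)
    case (1 y)
    hence "in_section (UL y)" using s by simp
    thus ?thesis using 1 by (auto simp: in_section_def sct_J)
  next
    case (3 z)
    hence "in_section (UR z)" using s by simp
    thus ?thesis using 3 by (auto simp: in_section_def rep_sct_UR)
  next
    case (2 q)
    have "in_section (uj q)" using s 2 by simp
    then consider "snd q = 0" "yc q \<in> sct Y ` topspace B" | "snd q = 1" "zc q \<in> sct Z ` topspace B"
      | "yc q \<in> sct Y ` topspace B" "\<forall>s\<in>{0..1}. pc q s \<in> sct K ` topspace B" "zc q \<in> sct Z ` topspace B"
      by (auto simp: in_section_def)
    thus ?thesis
    proof cases
      case 1 thus ?thesis using 2 rep_0[of q] by (auto simp: sct_J)
    next
      case c: 2 thus ?thesis using 2 rep_1[of q] by (auto simp: rep_sct_UR)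
    next
      case 3
      have q: "pc q \<in> paths (tsp K)" "\<forall>s\<in>{0..1}. prj K (pc q s) = bc q" "bc q \<in> topspace B"
        "snd q \<in> {0..1}" using 2(1) by (simp_all add: mem_EI)
      have y: "yc q = sct Y (bc q)" using 3(1) prj_yc[OF 2(1)] Y by (auto simp: prj_sct)
      have z: "zc q = sct Z (bc q)" using 3(3) prj_zc[OF 2(1)] Z by (auto simp: prj_sct)
      \<comment> \<open>A value of the path lies in the section and over \<open>bc q\<close>, which
        leaves one point.\<close>
      have "pc q s = sct K (bc q)" if s: "s \<in> {0..1}" for s
      proof -
        obtain b where b: "b \<in> topspace B" "pc q s = sct K b" using bspec[OF 3(2) s] by (elim imageE)
        have "prj K (pc q s) = bc q" by (rule bspec[OF q(2) s])
        thus ?thesis using b prj_sct[OF K b(1)] by simp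
      qed
      hence "pc q = const_path (sct K (bc q))"
        using q(1) unfolding const_path_def paths_def
        by (intro extensionalityI[of _ "{0..1}"]) auto
      hence "u = sct J (bc q)" using rep_sct_UJ[OF q(3,4)] 2(2) y z by simp
      thus ?thesis using q(3) by blast
    qed
  qed
qed

text \<open>On \<open>EI\<close> the predicate is a finite union of closed conditions; the clause on
  the path is the intersection over \<open>s\<close> of the closed conditions given by evaluation at
  \<open>s\<close>.\<close>

lemma closedin_section_preds:
  assumes cY: "closedin (tsp Y) (sct Y ` topspace B)" and cZ: "closedin (tsp Z) (sct Z ` topspace B)"
    and cK: "closedin (tsp K) (sct K ` topspace B)"
  shows "openin (tsp Y) {y \<in> topspace (tsp Y). \<not> in_section (UL y)}"
    and "openin EI {q \<in> topspace EI. \<not> in_section (uj q)}"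
    and "openin (tsp Z) {z \<in> topspace (tsp Z). \<not> in_section (UR z)}"
proof -
  show "openin (tsp Y) {y \<in> topspace (tsp Y). \<not> in_section (UL y)}"
    "openin (tsp Z) {z \<in> topspace (tsp Z). \<not> in_section (UR z)}"
    using cY cZ by (simp_all add: in_section_def closedin_def set_diff_eq)
  have y: "closedin EI {q \<in> topspace EI. yc q \<in> sct Y ` topspace B}"
    by (rule closedin_continuous_map_preimage[OF continuous_map_components(1) cY])
  have z: "closedin EI {q \<in> topspace EI. zc q \<in> sct Z ` topspace B}"
    by (rule closedin_continuous_map_preimage[OF continuous_map_components(4) cZ])
  have p: "closedin EI {q \<in> topspace EI. pc q s \<in> sct K ` topspace B}" if "s \<in> {0..1}" for s
    by (rule closedin_continuous_map_preimage[OF continuous_map_path_at[OF continuous_map_components(3)] cK])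
      (use that in simp)
  have t: "continuous_map EI euclideanreal snd"
    using continuous_map_components(5) by (simp add: continuous_map_in_subtopology)
  have t0: "closedin EI {q \<in> topspace EI. snd q \<in> {c}}" for c
    by (rule closedin_continuous_map_preimage[OF t]) simp
  have "closedin EI (({q \<in> topspace EI. snd q \<in> {0}} \<inter> {q \<in> topspace EI. yc q \<in> sct Y ` topspace B})
      \<union> ({q \<in> topspace EI. snd q \<in> {1}} \<inter> {q \<in> topspace EI. zc q \<in> sct Z ` topspace B})
      \<union> ({q \<in> topspace EI. yc q \<in> sct Y ` topspace B} \<inter>
         (\<Inter>s\<in>{0..1}. {q \<in> topspace EI. pc q s \<in> sct K ` topspace B}) \<inter>
         {q \<in> topspace EI. zc q \<in> sct Z ` topspace B}))" (is "closedin EI ?C")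
    by (intro closedin_Un closedin_Int y z p t0 closedin_INT) auto
  hence "openin EI (topspace EI - ?C)" by (rule openin_diff[OF openin_topspace])
  also have "topspace EI - ?C = {q \<in> topspace EI. \<not> in_section (uj q)}"
    by (auto simp: in_section_def)
  finally show "openin EI {q \<in> topspace EI. \<not> in_section (uj q)}" .
qed

lemma closedin_sct_J:
  assumes "closedin (tsp Y) (sct Y ` topspace B)" "closedin (tsp Z) (sct Z ` topspace B)"
    "closedin (tsp K) (sct K ` topspace B)"
  shows "closedin (tsp J) (sct J ` topspace B)"
proof -
  have "openin (tsp J) {u \<in> topspace (tsp J). \<not> in_section u}"
    by (rule openin_J) (use in_section_invariant closedin_section_preds[OF assms] in auto)
  moreover have "{u \<in> topspace (tsp J). \<not> in_section u} = topspace (tsp J) - sct J ` topspace B"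
    using in_section_iff by auto
  ultimately show ?thesis
    using sct_mem[OF fibrewise_pointed_space_J] by (auto simp: closedin_def)
qed

end

subsection \<open>An open cover of the join\<close>

context join_data
begin

text \<open>On this neighbourhood of the section the deformation \<open>t \<rightarrow> 0\<close> stays in \<open>V\<close> and ends in \<open>M\<close>
  whenever \<open>t \<le> 2/3\<close>, and dually for \<open>t \<rightarrow> 1\<close>. Asking for both conditions at every \<open>t\<close>
  would not give a saturated set.\<close>

definition near_section :: "('b, 'e, 'x) U set \<Rightarrow> ('b, 'e, 'x) U set \<Rightarrow> ('b, 'e, 'x) U set \<Rightarrow> ('b, 'e, 'x) U \<Rightarrow> bool"
where "near_section M N V u = (case u of UL y \<Rightarrow> y \<in> M | UR z \<Rightarrow> z \<in> N
   | UJ y b \<theta> z t \<Rightarrow> (t > 2/3 \<or> y \<in> M \<and> (\<forall>s\<in>{0..1}. \<theta> (t * s) \<in> V)) \<and>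
        (t < 1/3 \<or> z \<in> N \<and> (\<forall>s\<in>{0..1}. \<theta> (1 - (1 - t) * s) \<in> V))
   | _ \<Rightarrow> False)"

text \<open>Removing the section makes the set saturated: the collapsed segments run through all
  \<open>t\<close> and would otherwise leave it. The bound \<open>2/3\<close> is that of
  \<open>near_section\<close>, whose first clause cannot hold by \<open>t > 2/3\<close> here, so its
  condition on the deformation to \<open>t = 0\<close> is available.\<close>

definition left_part :: "('b, 'e, 'x) U \<Rightarrow> bool" where
  "left_part u \<longleftrightarrow> \<not> in_section u \<and> (case u of UL y \<Rightarrow> True | UJ y b \<theta> z t \<Rightarrow> t < 2/3 | _ \<Rightarrow> False)"

definition right_part :: "('b, 'e, 'x) U \<Rightarrow> bool" where
  "right_part u \<longleftrightarrow> \<not> in_section u \<and> (case u of UR z \<Rightarrow> True | UJ y b \<theta> z t \<Rightarrow> t > 1/3 | _ \<Rightarrow> False)"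

definition left_end :: "('b, 'e, 'x) U \<Rightarrow> ('b, 'e, 'x) U" where
  "left_end u = (case u of UL y \<Rightarrow> y | UJ y b \<theta> z t \<Rightarrow> y | _ \<Rightarrow> u)"

definition right_end :: "('b, 'e, 'x) U \<Rightarrow> ('b, 'e, 'x) U" where
  "right_end u = (case u of UR z \<Rightarrow> z | UJ y b \<theta> z t \<Rightarrow> z | _ \<Rightarrow> u)"

text \<open>Homotopies on the join are encoded as maps to the path space, so that their continuity can be
  tested on the three summands without forming products of quotient maps.\<close>

definition left_track :: "('b, 'e, 'x) U \<Rightarrow> real \<Rightarrow> ('b, 'e, 'x) U" where
  "left_track u = (case u of UL y \<Rightarrow> (\<lambda>s\<in>{0..1}. h y) | UJ y b \<theta> z t \<Rightarrow> (\<lambda>s\<in>{0..1}. \<theta> (t * (1 - s)))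
    | _ \<Rightarrow> undefined)"

definition right_track :: "('b, 'e, 'x) U \<Rightarrow> real \<Rightarrow> ('b, 'e, 'x) U" where
  "right_track u = (case u of UR z \<Rightarrow> (\<lambda>s\<in>{0..1}. k z)
    | UJ y b \<theta> z t \<Rightarrow> (\<lambda>s\<in>{0..1}. \<theta> (1 - (1 - t) * (1 - s))) | _ \<Rightarrow> undefined)"

lemma left_end_simps: "left_end (UL y) = y" "left_end (UJ y b \<theta> z t) = y"
  by (simp_all add: left_end_def)

lemma right_end_simps: "right_end (UR z) = z" "right_end (UJ y b \<theta> z t) = z"
  by (simp_all add: right_end_def)

lemma left_track_simps:
  "left_track (UL y) = (\<lambda>s\<in>{0..1}. h y)"
  "left_track (UJ y b \<theta> z t) = (\<lambda>s\<in>{0..1}. \<theta> (t * (1 - s)))"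
  by (simp_all add: left_track_def)

lemma right_track_simps:
  "right_track (UR z) = (\<lambda>s\<in>{0..1}. k z)"
  "right_track (UJ y b \<theta> z t) = (\<lambda>s\<in>{0..1}. \<theta> (1 - (1 - t) * (1 - s)))"
  by (simp_all add: right_track_def)

lemma left_part_invariant: "rel u v \<Longrightarrow> left_part u = left_part v"
  by (elim relE) (auto simp: left_part_def in_section_def const_path_def)

lemma right_part_invariant: "rel u v \<Longrightarrow> right_part u = right_part v"
  by (elim relE) (auto simp: right_part_def in_section_def const_path_def)

text \<open>Of the four generating identifications only the one at \<open>t = 0\<close> meets
  \<open>left_part\<close>, and there the track is constant at
  \<open>\<theta> 0 = h y\<close>.\<close>

lemma left_invariant:
  assumes "rel u v" "left_part u"
  shows "left_end u = left_end v" "left_track u = left_track v"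
  using assms
  by (auto elim!: relE simp: left_part_def left_end_def left_track_def in_section_def const_path_def mem_EI)

lemma right_invariant:
  assumes "rel u v" "right_part u"
  shows "right_end u = right_end v" "right_track u = right_track v"
  using assms
  by (auto elim!: relE simp: right_part_def right_end_def right_track_def in_section_def const_path_def mem_EI)

lemma mult_unit: "s \<in> {0..1} \<Longrightarrow> t \<in> {0..1} \<Longrightarrow> s * t \<in> {0..1::real}"
  by (auto intro: mult_le_one)

lemma mult_unit': "s \<in> {0..1} \<Longrightarrow> t \<in> {0..1} \<Longrightarrow> 1 - (1 - s) * t \<in> {0..1::real}"
  by (auto intro: mult_le_one)

lemma left_part_rep [simp]: "left_part (rep u) = left_part u"
  by (rule rep_invariant) (rule left_part_invariant)

lemma right_part_rep [simp]: "right_part (rep u) = right_part u"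
  by (rule rep_invariant) (rule right_part_invariant)

lemma left_rep:
  assumes "left_part u" shows "left_end (rep u) = left_end u" "left_track (rep u) = left_track u"
  by (rule rep_invariant_on[of left_part]; use assms left_part_invariant left_invariant in blast)+

lemma right_rep:
  assumes "right_part u" shows "right_end (rep u) = right_end u" "right_track (rep u) = right_track u"
  by (rule rep_invariant_on[of right_part]; use assms right_part_invariant right_invariant in blast)+

lemma continuous_map_snd_real: "continuous_map EI euclideanreal snd"
  using continuous_map_components(5) by (simp add: continuous_map_in_subtopology)

lemma continuous_map_EI_path:
  assumes "continuous_map W EI g" and "continuous_map W euclideanreal \<tau>"
    and "\<And>w. w \<in> topspace W \<Longrightarrow> \<tau> w \<in> {0..1}"
  shows "continuous_map W (tsp K) (\<lambda>w. pc (g w) (\<tau> w))"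
proof (rule continuous_map_path_at)
  show "continuous_map W (path_top (tsp K)) (\<lambda>w. pc (g w))"
    using continuous_map_compose[OF assms(1) continuous_map_components(3)] by (simp add: o_def)
  show "continuous_map W (top_of_set {0..1}) \<tau>"
    using assms(2,3) by (auto simp: continuous_map_in_subtopology)
qed

text \<open>The first two maps are the deformations in \<open>near_section\<close>, needed for its
  openness; the last two are the same with time reversed, as in \<open>left_track\<close> and
  \<open>right_track\<close>.\<close>

lemma continuous_map_tracks:
  defines "I \<equiv> top_of_set {0..1::real}"
  shows "continuous_map (prod_topology EI I) (tsp K) (\<lambda>p. pc (fst p) (snd (fst p) * snd p))"
    "continuous_map (prod_topology EI I) (tsp K) (\<lambda>p. pc (fst p) (1 - (1 - snd (fst p)) * snd p))"
    "continuous_map (prod_topology EI I) (tsp K) (\<lambda>p. pc (fst p) (snd (fst p) * (1 - snd p)))"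
    "continuous_map (prod_topology EI I) (tsp K) (\<lambda>p. pc (fst p) (1 - (1 - snd (fst p)) * (1 - snd p)))"
proof -
  let ?W = "prod_topology EI I"
  have g: "continuous_map ?W EI fst" by (rule continuous_map_fst)
  have t: "continuous_map ?W euclideanreal (\<lambda>p. snd (fst p))"
    using continuous_map_compose[OF g continuous_map_snd_real] by (simp add: o_def)
  have s: "continuous_map ?W euclideanreal snd"
    unfolding I_def by (rule continuous_map_into_fulltopology[OF continuous_map_snd])
  have r: "snd (fst p) \<in> {0..1}" "snd p \<in> {0..1}" "1 - snd p \<in> {0..1}" if "p \<in> topspace ?W" for p
    using that by (auto simp: I_def mem_EI)
  show "continuous_map ?W (tsp K) (\<lambda>p. pc (fst p) (snd (fst p) * snd p))"
    by (rule continuous_map_EI_path[OF g]) (intro continuous_intros s t mult_unit r | assumption)+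
  show "continuous_map ?W (tsp K) (\<lambda>p. pc (fst p) (1 - (1 - snd (fst p)) * snd p))"
    by (rule continuous_map_EI_path[OF g]) (intro continuous_intros s t mult_unit' r | assumption)+
  show "continuous_map ?W (tsp K) (\<lambda>p. pc (fst p) (snd (fst p) * (1 - snd p)))"
    by (rule continuous_map_EI_path[OF g]) (intro continuous_intros s t mult_unit r | assumption)+
  show "continuous_map ?W (tsp K) (\<lambda>p. pc (fst p) (1 - (1 - snd (fst p)) * (1 - snd p)))"
    by (rule continuous_map_EI_path[OF g]) (intro continuous_intros s t mult_unit' r | assumption)+
qed

lemma openin_EI_less: "openin EI {q \<in> topspace EI. snd q < a}" "openin EI {q \<in> topspace EI. snd q > a}"
  using openin_continuous_map_preimage[OF continuous_map_snd_real, of "{..<a}"]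
    openin_continuous_map_preimage[OF continuous_map_snd_real, of "{a<..}"] by simp_all

lemma left_part_opens:
  assumes "closedin (tsp Y) (sct Y ` topspace B)" "closedin (tsp Z) (sct Z ` topspace B)"
    "closedin (tsp K) (sct K ` topspace B)"
  shows "openin (tsp Y) {y \<in> topspace (tsp Y). left_part (UL y)}"
    "openin EI {q \<in> topspace EI. left_part (uj q)}"
    "openin (tsp Z) {z \<in> topspace (tsp Z). left_part (UR z)}"
proof -
  note c = closedin_section_preds[OF assms]
  show "openin (tsp Y) {y \<in> topspace (tsp Y). left_part (UL y)}"
    using c(1) by (simp add: left_part_def)
  show "openin (tsp Z) {z \<in> topspace (tsp Z). left_part (UR z)}" by (simp add: left_part_def)
  have "{q \<in> topspace EI. left_part (uj q)} = {q \<in> topspace EI. \<not> in_section (uj q)} \<inter> {q \<in> topspace EI. snd q < 2/3}"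
    by (auto simp: left_part_def)
  thus "openin EI {q \<in> topspace EI. left_part (uj q)}"
    using openin_Int[OF c(2) openin_EI_less(1)[of "2/3"]] by simp
qed

lemma right_part_opens:
  assumes "closedin (tsp Y) (sct Y ` topspace B)" "closedin (tsp Z) (sct Z ` topspace B)"
    "closedin (tsp K) (sct K ` topspace B)"
  shows "openin (tsp Y) {y \<in> topspace (tsp Y). right_part (UL y)}"
    "openin EI {q \<in> topspace EI. right_part (uj q)}"
    "openin (tsp Z) {z \<in> topspace (tsp Z). right_part (UR z)}"
proof -
  note c = closedin_section_preds[OF assms]
  show "openin (tsp Z) {z \<in> topspace (tsp Z). right_part (UR z)}"
    using c(3) by (simp add: right_part_def)
  show "openin (tsp Y) {y \<in> topspace (tsp Y). right_part (UL y)}" by (simp add: right_part_def)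
  have "{q \<in> topspace EI. right_part (uj q)} = {q \<in> topspace EI. \<not> in_section (uj q)} \<inter> {q \<in> topspace EI. snd q > 1/3}"
    by (auto simp: right_part_def)
  thus "openin EI {q \<in> topspace EI. right_part (uj q)}"
    using openin_Int[OF c(2) openin_EI_less(2)[of "1/3"]] by simp
qed

context
  fixes M N V
  assumes M: "openin (tsp Y) M" "sct Y ` topspace B \<subseteq> M" "h ` M \<subseteq> V"
    and N: "openin (tsp Z) N" "sct Z ` topspace B \<subseteq> N" "k ` N \<subseteq> V"
    and V: "openin (tsp K) V" "sct K ` topspace B \<subseteq> V"
begin

text \<open>At \<open>t = 0\<close> the second clause is void and the path in the first is constant
  at \<open>h y\<close>, so only \<open>y \<in> M\<close> remains, as \<open>h\<close> maps
  \<open>M\<close> into \<open>V\<close>. At \<open>t = 1\<close> the roles are exchanged with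
  \<open>k\<close> and \<open>N\<close>. On collapsed segments all conditions hold.\<close>

lemma near_section_invariant: "rel u v \<Longrightarrow> near_section M N V u = near_section M N V v"
proof (elim relE)
  fix q assume "q \<in> topspace EI" "u = uj q" "snd q = 0" "v = UL (yc q)"
  thus ?thesis using M(3) by (auto simp: near_section_def mem_EI)
next
  fix q assume "q \<in> topspace EI" "u = uj q" "snd q = 1" "v = UR (zc q)"
  thus ?thesis using N(3) by (auto simp: near_section_def mem_EI)
next
  fix b and t :: real assume b: "b \<in> topspace B" "t \<in> {0..1}"
    "u = UJ (sct Y b) b (const_path (sct K b)) (sct Z b) t" "v = UL (sct Y b)"
  have "sct K b \<in> V" "sct Y b \<in> M" "sct Z b \<in> N" using V(2) M(2) N(2) b(1) by auto
  moreover have "const_path (sct K b) (t * s) = sct K b" if "s \<in> {0..1}" for s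
    using mult_unit[OF b(2) that] by (simp add: const_path_def)
  moreover have "const_path (sct K b) (1 - (1 - t) * s) = sct K b" if "s \<in> {0..1}" for s
    using mult_unit'[OF b(2) that] unfolding const_path_def by simp
  ultimately show ?thesis using b by (auto simp: near_section_def)
next
  fix b assume "b \<in> topspace B" "u = UR (sct Z b)" "v = UL (sct Y b)"
  thus ?thesis using M(2) N(2) by (auto simp: near_section_def)
qed

lemma near_section_rep [simp]: "near_section M N V (rep u) = near_section M N V u"
  by (rule rep_invariant) (rule near_section_invariant)

lemma openin_near_section: "openin (tsp J) {u \<in> topspace (tsp J). near_section M N V u}"
proof (rule openin_J)
  show "openin (tsp Y) {y \<in> topspace (tsp Y). near_section M N V (UL y)}"
    "openin (tsp Z) {z \<in> topspace (tsp Z). near_section M N V (UR z)}"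
    using M(1) N(1) by (simp_all add: near_section_def Collect_conj_eq openin_Int)
  have y: "openin EI {q \<in> topspace EI. yc q \<in> M}"
    by (rule openin_continuous_map_preimage[OF continuous_map_components(1) M(1)])
  have z: "openin EI {q \<in> topspace EI. zc q \<in> N}"
    by (rule openin_continuous_map_preimage[OF continuous_map_components(4) N(1)])
  \<comment> \<open>The condition for all \<open>s\<close> is open by the tube lemma over the unit
    interval.\<close>
  have a: "openin EI {q \<in> topspace EI. \<forall>s\<in>{0..1}. pc q (snd q * s) \<in> V}"
    using openin_forall_unit[OF continuous_map_tracks(1) V(1)] by simp
  have b: "openin EI {q \<in> topspace EI. \<forall>s\<in>{0..1}. pc q (1 - (1 - snd q) * s) \<in> V}"
    using openin_forall_unit[OF continuous_map_tracks(2) V(1)] by simp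
  have "openin EI (({q \<in> topspace EI. snd q > 2/3} \<union>
       ({q \<in> topspace EI. yc q \<in> M} \<inter> {q \<in> topspace EI. \<forall>s\<in>{0..1}. pc q (snd q * s) \<in> V})) \<inter>
       ({q \<in> topspace EI. snd q < 1/3} \<union>
       ({q \<in> topspace EI. zc q \<in> N} \<inter> {q \<in> topspace EI. \<forall>s\<in>{0..1}. pc q (1 - (1 - snd q) * s) \<in> V})))"
    by (intro openin_Int openin_Un y z a b openin_EI_less)
  also have "\<dots> = {q \<in> topspace EI. near_section M N V (uj q)}" (is "?L = ?R")
    unfolding near_section_def by (intro set_eqI) (simp, blast)
  finally show "openin EI {q \<in> topspace EI. near_section M N V (uj q)}" .
qed (rule near_section_invariant)

lemma jmap_near_section:
  assumes u: "u \<in> topspace (tsp J)" "near_section M N V u" shows "jmap u \<in> V"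
  using u(1)
proof (cases rule: J_cases)
  case (1 y)
  hence "near_section M N V (UL y)" using u(2) by simp
  thus ?thesis using 1 M(3) by (auto simp: jmap near_section_def)
next
  case (3 z)
  hence "near_section M N V (UR z)" using u(2) by simp
  thus ?thesis using 3 N(3) by (auto simp: jmap near_section_def)
next
  case (2 q)
  have "near_section M N V (uj q)" using u(2) 2 by simp
  hence "(snd q > 2/3 \<or> (\<forall>s\<in>{0..1}. pc q (snd q * s) \<in> V)) \<and>
      (snd q < 1/3 \<or> (\<forall>s\<in>{0..1}. pc q (1 - (1 - snd q) * s) \<in> V))"
    by (auto simp: near_section_def)
  \<comment> \<open>At \<open>s = 1\<close> both deformations are at the point
    \<open>\<theta> t\<close> itself, and at least one of the two clauses is in force.\<close>
  hence "pc q (snd q) \<in> V"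
    by (cases "snd q > 2/3") (auto dest: bspec[where x=1])
  thus ?thesis using 2 by (simp add: jmap)
qed

lemma near_section_sct:
  assumes "b \<in> topspace B" shows "near_section M N V (sct J b)"
proof -
  have "near_section M N V (UL (sct Y b))" using assms M(2) by (auto simp: near_section_def)
  thus ?thesis by (simp add: sct_J)
qed

lemma join_cover:
  assumes u: "u \<in> topspace (tsp J)"
  shows "near_section M N V u \<or> left_part u \<or> right_part u"
proof (cases "in_section u")
  case True thus ?thesis using in_section_iff[OF u] near_section_sct by auto
next
  case False
  show ?thesis using u
  proof (cases rule: J_cases)
    case (1 y)
    hence "left_part (UL y)" using False by (simp add: left_part_def)
    thus ?thesis using 1 by simp
  next
    case (2 q)
    \<comment> \<open>Since \<open>1/3 < 2/3\<close>, every \<open>t\<close> satisfies one of the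
      two strict bounds.\<close>
    hence "left_part (uj q) \<or> right_part (uj q)" using False by (simp add: left_part_def right_part_def) linarith
    thus ?thesis using 2 by auto
  next
    case (3 z)
    hence "right_part (UR z)" using False by (simp add: right_part_def)
    thus ?thesis using 3 by simp
  qed
qed

text \<open>This is all that the left half contributes to a cover: sliding \<open>t\<close> to 0
  along the path deforms the join map into \<open>h \<circ> left_end\<close>. Close to the section
  the deformation stays in \<open>V\<close> and ends over \<open>M\<close>, which later allows
  everything there to be collapsed by \<open>c\<close>.\<close>

lemma left_part_maps:
  assumes closed: "closedin (tsp Y) (sct Y ` topspace B)" "closedin (tsp Z) (sct Z ` topspace B)"
    "closedin (tsp K) (sct K ` topspace B)"
  defines "A \<equiv> {u \<in> topspace (tsp J). left_part u}"
  shows "openin (tsp J) A"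
    and "continuous_map (subtopology (tsp J) A) (tsp Y) left_end"
    and "\<And>u. u \<in> A \<Longrightarrow> prj Y (left_end u) = prj J u"
    and "\<And>u. u \<in> A \<Longrightarrow> near_section M N V u \<Longrightarrow> left_end u \<in> M"
    and "homotopic_with (\<lambda>g. \<forall>u\<in>A. prj K (g u) = prj J u \<and> (near_section M N V u \<longrightarrow> g u \<in> V))
      (subtopology (tsp J) A) (tsp K) jmap (h \<circ> left_end)"
proof -
  note opens = left_part_opens[OF closed]
  \<comment> \<open>No point of \<open>Z\<close> lies in the left half, so the third summand
    contributes maps on an empty space.\<close>
  have none: "{z \<in> topspace (tsp Z). left_part (UR z)} = {}" by (simp add: left_part_def)
  show "openin (tsp J) A" unfolding A_def
    by (rule openin_J) (use left_part_invariant opens in auto)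
  show "continuous_map (subtopology (tsp J) A) (tsp Y) left_end" unfolding A_def
  proof (rule continuous_map_from_J[OF _ _ opens])
    show "continuous_map (subtopology EI {q \<in> topspace EI. left_part (uj q)}) (tsp Y) (\<lambda>q. left_end (uj q))"
      by (intro continuous_map_from_subtopology) (simp add: left_end_simps continuous_map_components)
    show "continuous_map (subtopology (tsp Y) {y \<in> topspace (tsp Y). left_part (UL y)}) (tsp Y) (\<lambda>y. left_end (UL y))"
      by (intro continuous_map_from_subtopology) (simp add: left_end_simps)
    show "continuous_map (subtopology (tsp Z) {z \<in> topspace (tsp Z). left_part (UR z)}) (tsp Y) (\<lambda>z. left_end (UR z))"
      unfolding none by (simp add: continuous_map_def)
  qed (use left_part_invariant left_invariant(1) in blast)+
  have track: "continuous_map (subtopology (tsp J) A) (path_top (tsp K)) left_track" unfolding A_def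
  proof (rule continuous_map_from_J[OF _ _ opens])
    show "continuous_map (subtopology EI {q \<in> topspace EI. left_part (uj q)}) (path_top (tsp K)) (\<lambda>q. left_track (uj q))"
      using continuous_map_curry_path[OF continuous_map_tracks(3)]
      by (intro continuous_map_from_subtopology) (simp add: left_track_simps)
    have "continuous_map (prod_topology (tsp Y) (top_of_set {0..1::real})) (tsp K) (h \<circ> fst)"
      using h by (intro continuous_map_compose[OF continuous_map_fst]) (simp add: fp_map_def)
    from continuous_map_curry_path[OF this]
    show "continuous_map (subtopology (tsp Y) {y \<in> topspace (tsp Y). left_part (UL y)}) (path_top (tsp K)) (\<lambda>y. left_track (UL y))"
      by (intro continuous_map_from_subtopology) (simp add: left_track_simps)
    show "continuous_map (subtopology (tsp Z) {z \<in> topspace (tsp Z). left_part (UR z)}) (path_top (tsp K)) (\<lambda>z. left_track (UR z))"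
      unfolding none by (simp add: continuous_map_def)
  qed (use left_part_invariant left_invariant(2) in blast)+
  have cases: "P u" if u: "u \<in> A"
    and "\<And>y. y \<in> topspace (tsp Y) \<Longrightarrow> u = rep (UL y) \<Longrightarrow> left_part (UL y) \<Longrightarrow> P u"
    and "\<And>q. q \<in> topspace EI \<Longrightarrow> u = rep (uj q) \<Longrightarrow> left_part (uj q) \<Longrightarrow> P u" for P u
  proof -
    have u': "u \<in> topspace (tsp J)" "left_part u" using u by (auto simp: A_def)
    have "\<not> left_part (UR z)" for z by (simp add: left_part_def)
    with u' that(2,3) show ?thesis by (elim J_cases) auto
  qed
  show "prj Y (left_end u) = prj J u" if "u \<in> A" for u
    using that by (rule cases) (auto simp: left_rep(1) prj_J left_end_simps prj_yc prj_zc)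
  show "left_end u \<in> M" if "u \<in> A" and n: "near_section M N V u" for u
    using that(1)
  proof (rule cases)
    fix y assume y: "u = rep (UL y)" "left_part (UL y)"
    have "near_section M N V (UL y)" using n y(1) by simp
    thus ?thesis using y by (simp add: left_rep(1)) (simp add: left_end_simps near_section_def)
  next
    fix q assume q: "u = rep (uj q)" "left_part (uj q)"
    have "near_section M N V (uj q)" using n q(1) by simp
    hence "left_end (uj q) \<in> M" using q(2) by (auto simp: left_end_simps near_section_def left_part_def)
    thus ?thesis using q by (simp add: left_rep(1))
  qed
  show "homotopic_with (\<lambda>g. \<forall>u\<in>A. prj K (g u) = prj J u \<and> (near_section M N V u \<longrightarrow> g u \<in> V))
      (subtopology (tsp J) A) (tsp K) jmap (h \<circ> left_end)"
  proof (rule homotopic_withI)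
    let ?W = "prod_topology (top_of_set {0..1::real}) (subtopology (tsp J) A)"
    \<comment> \<open>The homotopy is the continuous family of tracks, evaluated at the time
      coordinate.\<close>
    have "continuous_map ?W (path_top (tsp K)) (left_track \<circ> snd)"
      by (rule continuous_map_compose[OF continuous_map_snd track])
    from continuous_map_path_at[OF this continuous_map_fst]
    show "continuous_map ?W (tsp K) (\<lambda>p. left_track (snd p) (fst p))" by (simp add: o_def)
  next
    fix u assume "u \<in> topspace (subtopology (tsp J) A)"
    hence u: "u \<in> A" by simp
    show "left_track (snd (0, u)) (fst (0::real, u)) = jmap u" using u
      by (rule cases) (auto simp: left_rep(2) jmap left_track_simps)
    show "left_track (snd (1, u)) (fst (1::real, u)) = (h \<circ> left_end) u" using u
      by (rule cases) (auto simp: left_rep jmap left_track_simps left_end_simps mem_EI)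
  next
    fix g g' :: "('b, 'e, 'x) U \<Rightarrow> ('b, 'e, 'x) U"
    assume eq: "\<And>x. x \<in> topspace (subtopology (tsp J) A) \<Longrightarrow> g x = g' x"
    have "g u = g' u" if "u \<in> A" for u using that by (intro eq) (simp add: A_def)
    thus "(\<forall>u\<in>A. prj K (g u) = prj J u \<and> (near_section M N V u \<longrightarrow> g u \<in> V)) \<longleftrightarrow>
        (\<forall>u\<in>A. prj K (g' u) = prj J u \<and> (near_section M N V u \<longrightarrow> g' u \<in> V))" by simp
  next
    fix t :: real assume t: "t \<in> {0..1}"
    hence t': "1 - t \<in> {0..1}" by simp
    show "\<forall>u\<in>A. prj K (left_track (snd (t, u)) (fst (t, u))) = prj J u \<and>
        (near_section M N V u \<longrightarrow> left_track (snd (t, u)) (fst (t, u)) \<in> V)"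
    proof
      fix u assume "u \<in> A"
      thus "prj K (left_track (snd (t, u)) (fst (t, u))) = prj J u \<and>
        (near_section M N V u \<longrightarrow> left_track (snd (t, u)) (fst (t, u)) \<in> V)"
      proof (rule cases)
        fix y assume y: "y \<in> topspace (tsp Y)" "u = rep (UL y)" "left_part (UL y)"
        have eq: "left_track u t = h y" using y t by (simp add: left_rep(2)) (simp add: left_track_simps)
        have "h y \<in> V" if "near_section M N V u"
        proof -
          have "near_section M N V (UL y)" using that y(2) by simp
          thus ?thesis using M(3) by (auto simp: near_section_def)
        qed
        thus ?thesis using fp_map_prj[OF h y(1)] by (simp add: eq) (simp add: y(2) prj_J)
      next
        fix q assume q: "q \<in> topspace EI" "u = rep (uj q)" "left_part (uj q)"
        have s: "snd q \<in> {0..1}" using q(1) by (simp add: mem_EI)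
        have eq: "left_track u t = pc q (snd q * (1 - t))"
          using q t by (simp add: left_rep(2)) (simp add: left_track_simps)
        have "\<forall>s\<in>{0..1}. prj K (pc q s) = bc q" using q(1) by (simp add: mem_EI)
        from bspec[OF this mult_unit[OF s t']]
        have "prj K (left_track u t) = prj J u" unfolding eq unfolding q(2) prj_rep prj_J .
        moreover have "left_track u t \<in> V" if "near_section M N V u"
        proof -
          have "near_section M N V (uj q)" using that q(2) by simp
          hence "\<forall>s\<in>{0..1}. pc q (snd q * s) \<in> V"
            using q(3) by (auto simp: near_section_def left_part_def)
          from bspec[OF this t'] show ?thesis unfolding eq .
        qed
        ultimately show ?thesis by simp
      qed
    qed
  qed
qed

text \<open>The mirror image under \<open>t \<mapsto> 1 - t\<close>, with \<open>Z\<close>,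
  \<open>k\<close> and the end of the path in place of \<open>Y\<close>, \<open>h\<close> and its
  beginning.\<close>

lemma right_part_maps:
  assumes closed: "closedin (tsp Y) (sct Y ` topspace B)" "closedin (tsp Z) (sct Z ` topspace B)"
    "closedin (tsp K) (sct K ` topspace B)"
  defines "A \<equiv> {u \<in> topspace (tsp J). right_part u}"
  shows "openin (tsp J) A"
    and "continuous_map (subtopology (tsp J) A) (tsp Z) right_end"
    and "\<And>u. u \<in> A \<Longrightarrow> prj Z (right_end u) = prj J u"
    and "\<And>u. u \<in> A \<Longrightarrow> near_section M N V u \<Longrightarrow> right_end u \<in> N"
    and "homotopic_with (\<lambda>g. \<forall>u\<in>A. prj K (g u) = prj J u \<and> (near_section M N V u \<longrightarrow> g u \<in> V))
      (subtopology (tsp J) A) (tsp K) jmap (k \<circ> right_end)"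
proof -
  note opens = right_part_opens[OF closed]
  have none: "{z \<in> topspace (tsp Y). right_part (UL z)} = {}" by (simp add: right_part_def)
  show "openin (tsp J) A" unfolding A_def
    by (rule openin_J) (use right_part_invariant opens in auto)
  show "continuous_map (subtopology (tsp J) A) (tsp Z) right_end" unfolding A_def
  proof (rule continuous_map_from_J[OF _ _ opens])
    show "continuous_map (subtopology EI {q \<in> topspace EI. right_part (uj q)}) (tsp Z) (\<lambda>q. right_end (uj q))"
      by (intro continuous_map_from_subtopology) (simp add: right_end_simps continuous_map_components)
    show "continuous_map (subtopology (tsp Z) {y \<in> topspace (tsp Z). right_part (UR y)}) (tsp Z) (\<lambda>y. right_end (UR y))"
      by (intro continuous_map_from_subtopology) (simp add: right_end_simps)
    show "continuous_map (subtopology (tsp Y) {z \<in> topspace (tsp Y). right_part (UL z)}) (tsp Z) (\<lambda>z. right_end (UL z))"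
      unfolding none by (simp add: continuous_map_def)
  qed (use right_part_invariant right_invariant(1) in blast)+
  have track: "continuous_map (subtopology (tsp J) A) (path_top (tsp K)) right_track" unfolding A_def
  proof (rule continuous_map_from_J[OF _ _ opens])
    show "continuous_map (subtopology EI {q \<in> topspace EI. right_part (uj q)}) (path_top (tsp K)) (\<lambda>q. right_track (uj q))"
      using continuous_map_curry_path[OF continuous_map_tracks(4)]
      by (intro continuous_map_from_subtopology) (simp add: right_track_simps)
    have "continuous_map (prod_topology (tsp Z) (top_of_set {0..1::real})) (tsp K) (k \<circ> fst)"
      using k by (intro continuous_map_compose[OF continuous_map_fst]) (simp add: fp_map_def)
    from continuous_map_curry_path[OF this]
    show "continuous_map (subtopology (tsp Z) {y \<in> topspace (tsp Z). right_part (UR y)}) (path_top (tsp K)) (\<lambda>y. right_track (UR y))"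
      by (intro continuous_map_from_subtopology) (simp add: right_track_simps)
    show "continuous_map (subtopology (tsp Y) {z \<in> topspace (tsp Y). right_part (UL z)}) (path_top (tsp K)) (\<lambda>z. right_track (UL z))"
      unfolding none by (simp add: continuous_map_def)
  qed (use right_part_invariant right_invariant(2) in blast)+
  have cases: "P u" if u: "u \<in> A"
    and "\<And>y. y \<in> topspace (tsp Z) \<Longrightarrow> u = rep (UR y) \<Longrightarrow> right_part (UR y) \<Longrightarrow> P u"
    and "\<And>q. q \<in> topspace EI \<Longrightarrow> u = rep (uj q) \<Longrightarrow> right_part (uj q) \<Longrightarrow> P u" for P u
  proof -
    have u': "u \<in> topspace (tsp J)" "right_part u" using u by (auto simp: A_def)
    have "\<not> right_part (UL z)" for z by (simp add: right_part_def)
    with u' that(2,3) show ?thesis by (elim J_cases) auto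
  qed
  show "prj Z (right_end u) = prj J u" if "u \<in> A" for u
    using that by (rule cases) (auto simp: right_rep(1) prj_J right_end_simps prj_yc prj_zc)
  show "right_end u \<in> N" if "u \<in> A" and n: "near_section M N V u" for u
    using that(1)
  proof (rule cases)
    fix y assume y: "u = rep (UR y)" "right_part (UR y)"
    have "near_section M N V (UR y)" using n y(1) by simp
    thus ?thesis using y by (simp add: right_rep(1)) (simp add: right_end_simps near_section_def)
  next
    fix q assume q: "u = rep (uj q)" "right_part (uj q)"
    have "near_section M N V (uj q)" using n q(1) by simp
    hence "right_end (uj q) \<in> N" using q(2) by (auto simp: right_end_simps near_section_def right_part_def)
    thus ?thesis using q by (simp add: right_rep(1))
  qed
  show "homotopic_with (\<lambda>g. \<forall>u\<in>A. prj K (g u) = prj J u \<and> (near_section M N V u \<longrightarrow> g u \<in> V))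
      (subtopology (tsp J) A) (tsp K) jmap (k \<circ> right_end)"
  proof (rule homotopic_withI)
    let ?W = "prod_topology (top_of_set {0..1::real}) (subtopology (tsp J) A)"
    have "continuous_map ?W (path_top (tsp K)) (right_track \<circ> snd)"
      by (rule continuous_map_compose[OF continuous_map_snd track])
    from continuous_map_path_at[OF this continuous_map_fst]
    show "continuous_map ?W (tsp K) (\<lambda>p. right_track (snd p) (fst p))" by (simp add: o_def)
  next
    fix u assume "u \<in> topspace (subtopology (tsp J) A)"
    hence u: "u \<in> A" by simp
    show "right_track (snd (0, u)) (fst (0::real, u)) = jmap u" using u
      by (rule cases) (auto simp: right_rep(2) jmap right_track_simps)
    show "right_track (snd (1, u)) (fst (1::real, u)) = (k \<circ> right_end) u" using u
      by (rule cases) (auto simp: right_rep jmap right_track_simps right_end_simps mem_EI)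
  next
    fix g g' :: "('b, 'e, 'x) U \<Rightarrow> ('b, 'e, 'x) U"
    assume eq: "\<And>x. x \<in> topspace (subtopology (tsp J) A) \<Longrightarrow> g x = g' x"
    have "g u = g' u" if "u \<in> A" for u using that by (intro eq) (simp add: A_def)
    thus "(\<forall>u\<in>A. prj K (g u) = prj J u \<and> (near_section M N V u \<longrightarrow> g u \<in> V)) \<longleftrightarrow>
        (\<forall>u\<in>A. prj K (g' u) = prj J u \<and> (near_section M N V u \<longrightarrow> g' u \<in> V))" by simp
  next
    fix t :: real assume t: "t \<in> {0..1}"
    hence t': "1 - t \<in> {0..1}" by simp
    show "\<forall>u\<in>A. prj K (right_track (snd (t, u)) (fst (t, u))) = prj J u \<and>
        (near_section M N V u \<longrightarrow> right_track (snd (t, u)) (fst (t, u)) \<in> V)"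
    proof
      fix u assume "u \<in> A"
      thus "prj K (right_track (snd (t, u)) (fst (t, u))) = prj J u \<and>
        (near_section M N V u \<longrightarrow> right_track (snd (t, u)) (fst (t, u)) \<in> V)"
      proof (rule cases)
        fix y assume y: "y \<in> topspace (tsp Z)" "u = rep (UR y)" "right_part (UR y)"
        have eq: "right_track u t = k y" using y t by (simp add: right_rep(2)) (simp add: right_track_simps)
        have "k y \<in> V" if "near_section M N V u"
        proof -
          have "near_section M N V (UR y)" using that y(2) by simp
          thus ?thesis using N(3) by (auto simp: near_section_def)
        qed
        thus ?thesis using fp_map_prj[OF k y(1)] by (simp add: eq) (simp add: y(2) prj_J)
      next
        fix q assume q: "q \<in> topspace EI" "u = rep (uj q)" "right_part (uj q)"
        have s: "snd q \<in> {0..1}" using q(1) by (simp add: mem_EI)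
        have eq: "right_track u t = pc q (1 - (1 - snd q) * (1 - t))"
          using q t by (simp add: right_rep(2)) (simp add: right_track_simps)
        have "\<forall>s\<in>{0..1}. prj K (pc q s) = bc q" using q(1) by (simp add: mem_EI)
        from bspec[OF this mult_unit'[OF s t']]
        have "prj K (right_track u t) = prj J u" unfolding eq unfolding q(2) prj_rep prj_J .
        moreover have "right_track u t \<in> V" if "near_section M N V u"
        proof -
          have "near_section M N V (uj q)" using that q(2) by simp
          hence "\<forall>s\<in>{0..1}. pc q (1 - (1 - snd q) * s) \<in> V"
            using q(3) by (auto simp: near_section_def right_part_def)
          from bspec[OF this t'] show ?thesis unfolding eq .
        qed
        ultimately show ?thesis by simp
      qed
    qed
  qed
qed

end

end

subsection \<open>Covers carrying partial lifts\<close>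

lemma fp_homotopic_imp_fp_map:
  assumes "fp_homotopic B X Y g0 g1" shows "fp_map B X Y g0" "fp_map B X Y g1"
  using homotopic_with_imp_property[OF assms[unfolded fp_homotopic_def]]
    homotopic_with_imp_continuous_maps[OF assms[unfolded fp_homotopic_def]]
  by (simp_all add: fp_map_def)

text \<open>The given homotopy equals \<open>\<sigma>\<close> on \<open>A \<inter> M\<close> at all
  times, so it agrees there with the constant homotopy at \<open>\<sigma>\<close> on
  \<open>M\<close>. Both domains are open, so the two can be pasted.\<close>

lemma homotopic_with_paste:
  fixes J :: "'a topology" and X :: "'b topology"
  assumes A: "openin J A" and M: "openin J M"
    and hom: "homotopic_with (\<lambda>k. \<forall>u\<in>A. P u (k u) \<and> (u \<in> M \<longrightarrow> k u = \<sigma> u)) (subtopology J A) X p q"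
    and \<sigma>: "continuous_map (subtopology J M) X \<sigma>" "\<And>u. u \<in> M \<Longrightarrow> P u (\<sigma> u)"
    and p: "\<And>u. u \<in> A \<Longrightarrow> p' u = p u" "\<And>u. u \<in> M \<Longrightarrow> p' u = \<sigma> u"
    and q: "\<And>u. u \<in> A \<Longrightarrow> q' u = q u" "\<And>u. u \<in> M \<Longrightarrow> q' u = \<sigma> u"
  shows "homotopic_with (\<lambda>k. \<forall>u\<in>A \<union> M. P u (k u) \<and> (u \<in> M \<longrightarrow> k u = \<sigma> u))
    (subtopology J (A \<union> M)) X p' q'"
proof -
  let ?I = "top_of_set {0..1::real}"
  obtain D where D: "continuous_map (prod_topology ?I (subtopology J A)) X D"
    and D0: "\<And>u. D (0, u) = p u" and D1: "\<And>u. D (1, u) = q u"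
    and DP: "\<And>t. t \<in> {0..1} \<Longrightarrow> \<forall>u\<in>A. P u (D (t, u)) \<and> (u \<in> M \<longrightarrow> D (t, u) = \<sigma> u)"
    using hom unfolding homotopic_with_def by blast
  have pt: "prod_topology ?I (subtopology J S) = subtopology (prod_topology ?I J) ({0..1} \<times> S)" for S
    using prod_topology_subtopology(2)[of ?I J S] by simp
  have sub: "A \<subseteq> topspace J" "M \<subseteq> topspace J" using A M openin_subset by auto
  define D' where "D' = (\<lambda>(t, u). if u \<in> M then \<sigma> u else D (t, u))"
  have o: "openin (prod_topology ?I J) ({0..1} \<times> S)" if "openin J S" for S
    using that by (simp add: openin_prod_Times_iff)
  have "continuous_map (subtopology (prod_topology ?I J) ({0..1} \<times> A \<union> {0..1} \<times> M)) X D'"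
  proof (rule continuous_map_paste_open[OF o[OF A] o[OF M]])
    show "continuous_map (subtopology (prod_topology ?I J) ({0..1} \<times> A)) X D" using D unfolding pt .
    show "continuous_map (subtopology (prod_topology ?I J) ({0..1} \<times> M)) X (\<sigma> \<circ> snd)"
      unfolding pt[symmetric] by (rule continuous_map_compose[OF continuous_map_snd \<sigma>(1)])
  qed (use DP in \<open>auto simp: D'_def\<close>)
  hence c: "continuous_map (prod_topology ?I (subtopology J (A \<union> M))) X D'"
    unfolding pt by (simp add: Sigma_Un_distrib2)
  show ?thesis
  proof (rule homotopic_withI[OF c])
    fix k k' :: "'a \<Rightarrow> 'b" assume "\<And>x. x \<in> topspace (subtopology J (A \<union> M)) \<Longrightarrow> k x = k' x"
    hence "k u = k' u" if "u \<in> A \<union> M" for u using that sub by auto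
    thus "(\<forall>u\<in>A \<union> M. P u (k u) \<and> (u \<in> M \<longrightarrow> k u = \<sigma> u)) = (\<forall>u\<in>A \<union> M. P u (k' u) \<and> (u \<in> M \<longrightarrow> k' u = \<sigma> u))"
      by simp
  qed (use D0 D1 DP \<sigma>(2) p q in \<open>auto simp: D'_def\<close>)
qed

section \<open>Lifts that are equal to the section near the section\<close>

locale halo_data =
  fixes B :: "'b topology" and E :: "('e, 'b) fsp" and X :: "('x, 'b) fsp" and f :: "'e \<Rightarrow> 'x"
    and V :: "'x set" and c :: "'x \<Rightarrow> 'x"
  assumes E: "fibrewise_pointed_space B E" and X: "fibrewise_pointed_space B X"
    and f: "fp_map B E X f" and V: "openin (tsp X) V" "sct X ` topspace B \<subseteq> V"
    and c: "fp_homotopic B X X id c" and cV: "\<And>x. x \<in> V \<Longrightarrow> c x = sct X (prj X x)"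
begin

lemma fp_map_c: "fp_map B X X c"
  by (rule fp_homotopic_imp_fp_map(2)[OF c])

text \<open>The homotopy is relative to \<open>M\<close>, where it is constantly the section; this is what allows
  gluing along \<open>M\<close> in a join. Composition with \<open>c\<close> makes this possible.\<close>

definition local_lift :: "('y, 'b) fsp \<Rightarrow> 'y set \<Rightarrow> ('y \<Rightarrow> 'x) \<Rightarrow> 'y set \<Rightarrow> ('y \<Rightarrow> 'e) \<Rightarrow> bool" where
  "local_lift Y M g W a \<longleftrightarrow> openin (tsp Y) W \<and> M \<subseteq> W \<and>
     continuous_map (subtopology (tsp Y) W) (tsp E) a \<and>
     (\<forall>u\<in>W. prj E (a u) = prj Y u) \<and> (\<forall>u\<in>M. a u = sct E (prj Y u)) \<and>
     homotopic_with (\<lambda>k. \<forall>u\<in>W. prj X (k u) = prj Y u \<and> (u \<in> M \<longrightarrow> k u = sct X (prj Y u)))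
       (subtopology (tsp Y) W) (tsp X) (c \<circ> g) (f \<circ> a)"

text \<open>One \<open>M\<close> serves all indices; since every \<open>W i\<close> contains it,
  every member of the cover contains the section. The map \<open>g i\<close> may vary with
  \<open>i\<close> because the coordinates of a fat wedge are lifted separately.\<close>

definition lift_cover :: "('y, 'b) fsp \<Rightarrow> (nat \<Rightarrow> 'y \<Rightarrow> 'x) \<Rightarrow> nat set \<Rightarrow> bool" where
  "lift_cover Y g I \<longleftrightarrow> (\<exists>M W a. openin (tsp Y) M \<and> sct Y ` topspace B \<subseteq> M \<and>
     topspace (tsp Y) \<subseteq> (\<Union>i\<in>I. W i) \<and> (\<forall>i\<in>I. local_lift Y M (g i) (W i) (a i)))"

lemma lift_coverE:
  assumes "lift_cover Y g I"
  obtains M W a where "openin (tsp Y) M" "sct Y ` topspace B \<subseteq> M"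
    "topspace (tsp Y) \<subseteq> (\<Union>i\<in>I. W i)" "\<And>i. i \<in> I \<Longrightarrow> local_lift Y M (g i) (W i) (a i)"
  using assms unfolding lift_cover_def by blast

lemma lift_coverI:
  assumes "openin (tsp Y) M" "sct Y ` topspace B \<subseteq> M"
    "topspace (tsp Y) \<subseteq> (\<Union>i\<in>I. W i)" "\<And>i. i \<in> I \<Longrightarrow> local_lift Y M (g i) (W i) (a i)"
  shows "lift_cover Y g I"
  using assms unfolding lift_cover_def by blast

text \<open>A join shrinks the neighbourhoods in \<open>Y\<close> and \<open>Z\<close> until the
  structure maps send them into one open subset of \<open>K\<close>.\<close>

lemma local_lift_mono:
  assumes "local_lift Y M g W a" "M' \<subseteq> M" shows "local_lift Y M' g W a"
proof -
  have "homotopic_with (\<lambda>k. \<forall>u\<in>W. prj X (k u) = prj Y u \<and> (u \<in> M' \<longrightarrow> k u = sct X (prj Y u)))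
       (subtopology (tsp Y) W) (tsp X) (c \<circ> g) (f \<circ> a)"
    by (rule homotopic_with_mono[of "\<lambda>k. \<forall>u\<in>W. prj X (k u) = prj Y u \<and> (u \<in> M \<longrightarrow> k u = sct X (prj Y u))"])
      (use assms in \<open>auto simp: local_lift_def\<close>)
  thus ?thesis using assms by (auto simp: local_lift_def)
qed

lemma local_lift_pullback:
  assumes l: "local_lift Y M g W a" and v: "fp_map B Y' Y v"
  shows "local_lift Y' {u \<in> topspace (tsp Y'). v u \<in> M} (g \<circ> v) {u \<in> topspace (tsp Y'). v u \<in> W} (a \<circ> v)"
proof -
  let ?W = "{u \<in> topspace (tsp Y'). v u \<in> W}"
  have vc: "continuous_map (tsp Y') (tsp Y) v" using v by (simp add: fp_map_def)
  have vW: "continuous_map (subtopology (tsp Y') ?W) (subtopology (tsp Y) W) v"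
    using vc by (auto simp: continuous_map_in_subtopology continuous_map_from_subtopology)
  have "openin (tsp Y') ?W" using openin_continuous_map_preimage[OF vc] l by (simp add: local_lift_def)
  moreover have "continuous_map (subtopology (tsp Y') ?W) (tsp E) (a \<circ> v)"
    using l continuous_map_compose[OF vW, of "tsp E" a] by (simp add: local_lift_def)
  moreover have "homotopic_with (\<lambda>k. \<forall>u\<in>?W. prj X (k u) = prj Y' u \<and>
        (u \<in> {u \<in> topspace (tsp Y'). v u \<in> M} \<longrightarrow> k u = sct X (prj Y' u)))
       (subtopology (tsp Y') ?W) (tsp X) ((c \<circ> g) \<circ> v) ((f \<circ> a) \<circ> v)"
    by (rule homotopic_with_compose_right[OF _ vW, of "\<lambda>k. \<forall>u\<in>W. prj X (k u) = prj Y u \<and> (u \<in> M \<longrightarrow> k u = sct X (prj Y u))"])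
      (use l in \<open>auto simp: local_lift_def fp_map_prj[OF v]\<close>)
  ultimately show ?thesis using l by (auto simp: local_lift_def fp_map_prj[OF v] o_assoc)
qed

lemma lift_cover_pullback:
  assumes "lift_cover Y g I" and Y': "fibrewise_pointed_space B Y'" and v: "fp_map B Y' Y v"
  shows "lift_cover Y' (\<lambda>i. g i \<circ> v) I"
proof -
  obtain M W a where M: "openin (tsp Y) M" "sct Y ` topspace B \<subseteq> M"
    and W: "topspace (tsp Y) \<subseteq> (\<Union>i\<in>I. W i)" and l: "\<forall>i\<in>I. local_lift Y M (g i) (W i) (a i)"
    using assms(1) unfolding lift_cover_def by blast
  have vc: "continuous_map (tsp Y') (tsp Y) v" using v by (simp add: fp_map_def)
  have "openin (tsp Y') {u \<in> topspace (tsp Y'). v u \<in> M}"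
    using openin_continuous_map_preimage[OF vc M(1)] .
  moreover have "sct Y' ` topspace B \<subseteq> {u \<in> topspace (tsp Y'). v u \<in> M}"
    using M(2) sct_mem[OF Y'] fp_map_sct[OF v] by auto
  moreover have "topspace (tsp Y') \<subseteq> (\<Union>i\<in>I. {u \<in> topspace (tsp Y'). v u \<in> W i})"
    using W fp_map_mem[OF v] by fastforce
  moreover have "\<forall>i\<in>I. local_lift Y' {u \<in> topspace (tsp Y'). v u \<in> M} (g i \<circ> v)
      {u \<in> topspace (tsp Y'). v u \<in> W i} (a i \<circ> v)"
    using l local_lift_pullback[OF _ v] by blast
  ultimately show ?thesis unfolding lift_cover_def
    by (intro exI[of _ "{u \<in> topspace (tsp Y'). v u \<in> M}"]
        exI[of _ "\<lambda>i. {u \<in> topspace (tsp Y'). v u \<in> W i}"] exI[of _ "\<lambda>i. a i \<circ> v"] conjI)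
qed

lemma local_lift_cong:
  fixes Y :: "('y, 'b) fsp"
  assumes l: "local_lift Y M g W a" and eq: "\<And>u. u \<in> topspace (tsp Y) \<Longrightarrow> g u = g' u"
  shows "local_lift Y M g' W a"
proof -
  have W: "W \<subseteq> topspace (tsp Y)" using l by (simp add: local_lift_def openin_subset)
  have "homotopic_with (\<lambda>k. \<forall>u\<in>W. prj X (k u) = prj Y u \<and> (u \<in> M \<longrightarrow> k u = sct X (prj Y u)))
       (subtopology (tsp Y) W) (tsp X) (c \<circ> g') (f \<circ> a)"
  proof (rule homotopic_with_eq[where f = "c \<circ> g" and g = "f \<circ> a"])
    fix k k' :: "'y \<Rightarrow> 'x"
    assume "\<And>x. x \<in> topspace (subtopology (tsp Y) W) \<Longrightarrow> k x = k' x"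
    hence "k u = k' u" if "u \<in> W" for u using that W by auto
    thus "(\<forall>u\<in>W. prj X (k u) = prj Y u \<and> (u \<in> M \<longrightarrow> k u = sct X (prj Y u))) =
      (\<forall>u\<in>W. prj X (k' u) = prj Y u \<and> (u \<in> M \<longrightarrow> k' u = sct X (prj Y u)))" by simp
  qed (use l eq in \<open>auto simp: local_lift_def\<close>)
  thus ?thesis using l by (simp add: local_lift_def)
qed

lemma lift_cover_cong:
  assumes "lift_cover Y g I" and "\<And>i u. i \<in> I \<Longrightarrow> u \<in> topspace (tsp Y) \<Longrightarrow> g i u = g' i u"
  shows "lift_cover Y g' I"
proof -
  obtain M W a where *: "openin (tsp Y) M" "sct Y ` topspace B \<subseteq> M"
    "topspace (tsp Y) \<subseteq> (\<Union>i\<in>I. W i)" and l: "\<forall>i\<in>I. local_lift Y M (g i) (W i) (a i)"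
    using assms(1) unfolding lift_cover_def by blast
  have "\<forall>i\<in>I. local_lift Y M (g' i) (W i) (a i)"
    using local_lift_cong[OF bspec[OF l]] assms(2) by blast
  thus ?thesis unfolding lift_cover_def using * by blast
qed

text \<open>The identity of \<open>E\<close> would lift \<open>f\<close>, but it is not equal to the
  section near the section; the lift is therefore \<open>c'\<close> on all of \<open>E\<close>. The
  homotopy is \<open>c \<circ> f \<simeq> c \<circ> f \<circ> c' \<simeq> f \<circ> c'\<close>,
  using \<open>id \<simeq> c'\<close> and then \<open>id \<simeq> c\<close> backwards.\<close>

lemma lift_cover_base:
  assumes V': "openin (tsp E) V'" "sct E ` topspace B \<subseteq> V'" and c': "fp_homotopic B E E id c'"
    and cV': "\<And>x. x \<in> V' \<Longrightarrow> c' x = sct E (prj E x)"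
  shows "lift_cover E (\<lambda>_. f) {i}"
proof -
  let ?I = "top_of_set {0..1::real}"
  obtain H where H: "continuous_map (prod_topology ?I (tsp E)) (tsp E) H"
    and H0: "\<And>u. H (0, u) = u" and H1: "\<And>u. H (1, u) = c' u"
    and Hp: "\<And>t u. t \<in> {0..1} \<Longrightarrow> u \<in> topspace (tsp E) \<Longrightarrow> prj E (H (t, u)) = prj E u"
    and Hs: "\<And>t b. t \<in> {0..1} \<Longrightarrow> b \<in> topspace B \<Longrightarrow> H (t, sct E b) = sct E b"
    using c' unfolding fp_homotopic_def homotopic_with_def by auto
  have fc: "continuous_map (tsp E) (tsp X) f" using f by (simp add: fp_map_def)
  have Hm: "H (t, u) \<in> topspace (tsp E)" if "t \<in> {0..1}" "u \<in> topspace (tsp E)" for t u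
    using continuous_map_image_mem[OF H, of "(t, u)"] that by simp
  \<comment> \<open>\<open>V'\<close> makes \<open>c'\<close> equal to the section, and the second
    condition keeps the homotopy from \<open>id\<close> to \<open>c'\<close> inside the region that
    \<open>c\<close> collapses after applying \<open>f\<close>.\<close>
  define M where "M = V' \<inter> {u \<in> topspace (tsp E). \<forall>t\<in>{0..1}. f (H (t, u)) \<in> V}"
  have "continuous_map (prod_topology (tsp E) ?I) (prod_topology ?I (tsp E)) (\<lambda>p. (snd p, fst p))"
    by (simp add: continuous_map_pairwise o_def continuous_map_fst continuous_map_snd)
  from openin_forall_unit[OF continuous_map_compose[OF continuous_map_compose[OF this H] fc] V(1)]
  have M: "openin (tsp E) M" unfolding M_def using V'(1) by (simp add: openin_Int)
  have M': "M \<subseteq> topspace (tsp E)" using M openin_subset by blast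
  have sM: "sct E ` topspace B \<subseteq> M"
    using V'(2) V(2) sct_mem[OF E] by (auto simp: M_def Hs fp_map_sct[OF f])
  have c'm: "fp_map B E E c'"
    by (rule fp_homotopic_imp_fp_map(2)[OF c'])
  let ?P = "\<lambda>k. \<forall>u\<in>topspace (tsp E). prj X (k u) = prj E u \<and> (u \<in> M \<longrightarrow> k u = sct X (prj E u))"
  \<comment> \<open>On \<open>M\<close> this homotopy is constant because \<open>c\<close> sends all
    of \<open>V\<close> to the section.\<close>
  have "homotopic_with ?P (tsp E) (tsp X) (c \<circ> f) (c \<circ> f \<circ> c')"
  proof (rule homotopic_withI)
    show "continuous_map (prod_topology ?I (tsp E)) (tsp X) (c \<circ> f \<circ> H)"
      using continuous_map_compose[OF H continuous_map_compose[OF fc, of "tsp X" c]] fp_map_c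
      by (simp add: fp_map_def)
    show "?P (\<lambda>u. (c \<circ> f \<circ> H) (t, u))" if t: "t \<in> {0..1}" for t
    proof (intro ballI conjI impI)
      fix u assume u: "u \<in> topspace (tsp E)"
      have 1: "prj X (f (H (t, u))) = prj E u" using Hp[OF t u] Hm[OF t u] fp_map_prj[OF f] by simp
      thus "prj X ((c \<circ> f \<circ> H) (t, u)) = prj E u"
        using fp_map_prj[OF fp_map_c fp_map_mem[OF f Hm[OF t u]]] by simp
      assume "u \<in> M"
      hence "f (H (t, u)) \<in> V" using t by (simp add: M_def)
      thus "(c \<circ> f \<circ> H) (t, u) = sct X (prj E u)" using 1 cV by simp
    qed
  qed (auto simp: H0 H1)
  \<comment> \<open>On \<open>M\<close> this one is constant for a different reason:
    \<open>c' u\<close> is a section point and the homotopy from \<open>id\<close> to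
    \<open>c\<close> is pointed.\<close>
  moreover have "homotopic_with ?P (tsp E) (tsp X) (id \<circ> (f \<circ> c')) (c \<circ> (f \<circ> c'))"
  proof (rule homotopic_with_compose_right)
    show "homotopic_with (\<lambda>g. (\<forall>x\<in>topspace (tsp X). prj X (g x) = prj X x) \<and> (\<forall>b\<in>topspace B. g (sct X b) = sct X b))
       (tsp X) (tsp X) id c" using c unfolding fp_homotopic_def .
    show "continuous_map (tsp E) (tsp X) (f \<circ> c')"
      using fp_map_compose[OF c'm f] by (simp add: fp_map_def)
    fix j assume j: "(\<forall>x\<in>topspace (tsp X). prj X (j x) = prj X x) \<and> (\<forall>b\<in>topspace B. j (sct X b) = sct X b)"
    show "?P (j \<circ> (f \<circ> c'))"
    proof (intro ballI conjI impI)
      fix u assume u: "u \<in> topspace (tsp E)"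
      note fm = fp_map_compose[OF c'm f]
      show "prj X ((j \<circ> (f \<circ> c')) u) = prj E u"
        using j fp_map_mem[OF fm u] fp_map_prj[OF fm u] by simp
      assume "u \<in> M"
      hence "c' u = sct E (prj E u)" using cV' by (simp add: M_def)
      thus "(j \<circ> (f \<circ> c')) u = sct X (prj E u)"
        using j prj_mem[OF E u] by (simp add: fp_map_sct[OF f])
    qed
  qed
  ultimately have "homotopic_with ?P (tsp E) (tsp X) (c \<circ> f) (f \<circ> c')"
    unfolding o_assoc id_o by (rule homotopic_with_trans[OF _ homotopic_with_symD])
  hence "local_lift E M f (topspace (tsp E)) c'"
    unfolding local_lift_def using M' c'm cV' by (auto simp: fp_map_def M_def)
  thus ?thesis unfolding lift_cover_def using M sM
    by (intro exI[of _ M] exI[of _ "\<lambda>_. topspace (tsp E)"] exI[of _ "\<lambda>_. c'"]) auto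
qed

text \<open>A lift on \<open>Y\<close> is pulled back along the end map \<open>\<rho>\<close> of one
  half of the join and continued over \<open>M\<close> by the section. The two agree on the overlap
  since \<open>\<rho>\<close> sends it into \<open>MY\<close>, where \<open>a\<close> is the
  section.\<close>

lemma local_lift_paste:
  assumes J: "fibrewise_pointed_space B J" and j: "fp_map B J K j" and \<pi>: "fp_map B K X \<pi>"
    and VK: "\<And>w. w \<in> VK \<Longrightarrow> \<pi> w \<in> V"
    and l: "local_lift Y MY (\<pi> \<circ> h) W a"
    and A: "openin (tsp J) A" and M: "openin (tsp J) M" and jM: "\<And>u. u \<in> M \<Longrightarrow> j u \<in> VK"
    and \<rho>: "continuous_map (subtopology (tsp J) A) (tsp Y) \<rho>"
      "\<And>u. u \<in> A \<Longrightarrow> prj Y (\<rho> u) = prj J u" "\<And>u. u \<in> A \<Longrightarrow> u \<in> M \<Longrightarrow> \<rho> u \<in> MY"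
    and hom: "homotopic_with (\<lambda>g. \<forall>u\<in>A. prj K (g u) = prj J u \<and> (u \<in> M \<longrightarrow> g u \<in> VK))
      (subtopology (tsp J) A) (tsp K) j (h \<circ> \<rho>)"
  shows "local_lift J M (\<pi> \<circ> j) ({u \<in> A. \<rho> u \<in> W} \<union> M) (\<lambda>u. if u \<in> M then sct E (prj J u) else a (\<rho> u))"
proof -
  define A' where "A' = {u \<in> A. \<rho> u \<in> W}"
  have AJ: "A \<subseteq> topspace (tsp J)" "M \<subseteq> topspace (tsp J)" using A M openin_subset by auto
  have lW: "openin (tsp Y) W" "MY \<subseteq> W" "continuous_map (subtopology (tsp Y) W) (tsp E) a"
    "\<And>u. u \<in> W \<Longrightarrow> prj E (a u) = prj Y u" "\<And>u. u \<in> MY \<Longrightarrow> a u = sct E (prj Y u)"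
    using l by (auto simp: local_lift_def)
  have ts: "topspace (subtopology (tsp J) A) = A" using AJ by auto
  have "openin (subtopology (tsp J) A) A'"
    using openin_continuous_map_preimage[OF \<rho>(1) lW(1)] unfolding ts A'_def .
  hence A': "openin (tsp J) A'" using A openin_trans_full by blast
  have sub: "subtopology (subtopology (tsp J) A) A' = subtopology (tsp J) A'"
    by (simp add: subtopology_subtopology A'_def Int_absorb1)
  have \<rho>': "continuous_map (subtopology (tsp J) A') (subtopology (tsp Y) W) \<rho>"
    using continuous_map_from_subtopology[OF \<rho>(1), of A'] unfolding sub
    by (auto simp: continuous_map_in_subtopology A'_def)
  let ?Q = "\<lambda>k. \<forall>u\<in>A'. prj X (k u) = prj J u \<and> (u \<in> M \<longrightarrow> k u = sct X (prj J u))"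
  \<comment> \<open>Over \<open>M\<close> the deformation stays in \<open>VK\<close>, hence in
    \<open>V\<close> after \<open>\<pi>\<close>, and \<open>c\<close> makes it constant at the
    section.\<close>
  have "homotopic_with ?Q (subtopology (tsp J) A') (tsp X) ((c \<circ> \<pi>) \<circ> j) ((c \<circ> \<pi>) \<circ> (h \<circ> \<rho>))"
  proof (rule homotopic_with_compose_left)
    show "homotopic_with (\<lambda>g. \<forall>u\<in>A. prj K (g u) = prj J u \<and> (u \<in> M \<longrightarrow> g u \<in> VK))
        (subtopology (tsp J) A') (tsp K) j (h \<circ> \<rho>)"
      using homotopic_from_subtopology[OF hom, of A'] unfolding sub .
    show "continuous_map (tsp K) (tsp X) (c \<circ> \<pi>)"
      using fp_map_compose[OF \<pi> fp_map_c] by (simp add: fp_map_def)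
    fix g assume g: "continuous_map (subtopology (tsp J) A') (tsp K) g"
      and gP: "\<forall>u\<in>A. prj K (g u) = prj J u \<and> (u \<in> M \<longrightarrow> g u \<in> VK)"
    show "?Q ((c \<circ> \<pi>) \<circ> g)"
    proof (intro ballI conjI impI)
      fix u assume u: "u \<in> A'"
      hence uA: "u \<in> A" by (simp add: A'_def)
      have gu: "g u \<in> topspace (tsp K)" using continuous_map_image_mem[OF g] u uA AJ by auto
      show "prj X (((c \<circ> \<pi>) \<circ> g) u) = prj J u"
        using gP uA fp_map_prj[OF fp_map_compose[OF \<pi> fp_map_c] gu] by simp
      assume "u \<in> M"
      hence "\<pi> (g u) \<in> V" using gP uA VK by blast
      thus "((c \<circ> \<pi>) \<circ> g) u = sct X (prj J u)" using cV gP uA fp_map_prj[OF \<pi> gu] by simp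
    qed
  qed
  moreover have "homotopic_with ?Q (subtopology (tsp J) A') (tsp X) ((c \<circ> (\<pi> \<circ> h)) \<circ> \<rho>) ((f \<circ> a) \<circ> \<rho>)"
  proof (rule homotopic_with_compose_right[OF _ \<rho>'])
    show "homotopic_with (\<lambda>k. \<forall>u\<in>W. prj X (k u) = prj Y u \<and> (u \<in> MY \<longrightarrow> k u = sct X (prj Y u)))
       (subtopology (tsp Y) W) (tsp X) (c \<circ> (\<pi> \<circ> h)) (f \<circ> a)"
      using l by (simp add: local_lift_def)
  qed (use \<rho>(2,3) in \<open>auto simp: A'_def\<close>)
  ultimately have H: "homotopic_with ?Q (subtopology (tsp J) A') (tsp X) (c \<circ> \<pi> \<circ> j) (f \<circ> a \<circ> \<rho>)"
    unfolding o_assoc by (rule homotopic_with_trans)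
  let ?a = "\<lambda>u. if u \<in> M then sct E (prj J u) else a (\<rho> u)"
  have pJ: "continuous_map (subtopology (tsp J) M) B (prj J)"
    using J by (intro continuous_map_from_subtopology) (simp add: fibrewise_pointed_space_def)
  have "continuous_map B (tsp X) (sct X)" "continuous_map B (tsp E) (sct E)"
    using X E by (simp_all add: fibrewise_pointed_space_def)
  note sc = this[THEN continuous_map_compose[OF pJ]]
  have aM: "a (\<rho> u) = sct E (prj J u)" if "u \<in> A'" "u \<in> M" for u
    using that \<rho>(2,3) lW(5) by (auto simp: A'_def)
  have pm: "prj J u \<in> topspace B" if "u \<in> M" for u using that AJ prj_mem[OF J] by blast
  \<comment> \<open>\<open>A'\<close> does not contain the section; adding \<open>M\<close> with the
    constant homotopy repairs this.\<close>
  have "homotopic_with (\<lambda>k. \<forall>u\<in>A' \<union> M. prj X (k u) = prj J u \<and> (u \<in> M \<longrightarrow> k u = (sct X \<circ> prj J) u))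
      (subtopology (tsp J) (A' \<union> M)) (tsp X) (c \<circ> (\<pi> \<circ> j)) (f \<circ> ?a)"
  proof (rule homotopic_with_paste[OF A' M _ sc(1)])
    show "homotopic_with (\<lambda>k. \<forall>u\<in>A'. prj X (k u) = prj J u \<and> (u \<in> M \<longrightarrow> k u = (sct X \<circ> prj J) u))
      (subtopology (tsp J) A') (tsp X) (c \<circ> \<pi> \<circ> j) (f \<circ> a \<circ> \<rho>)" using H by (simp add: o_def)
    fix u assume u: "u \<in> M"
    show "prj X ((sct X \<circ> prj J) u) = prj J u" using prj_sct[OF X pm[OF u]] by simp
    have "prj X (\<pi> (j u)) = prj J u"
      using fp_map_prj[OF fp_map_compose[OF j \<pi>], of u] u AJ by auto
    thus "(c \<circ> (\<pi> \<circ> j)) u = (sct X \<circ> prj J) u" using cV VK jM u by simp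
    show "(f \<circ> ?a) u = (sct X \<circ> prj J) u" using u fp_map_sct[OF f pm[OF u]] by simp
  qed (use aM in auto)
  moreover have "continuous_map (subtopology (tsp J) (A' \<union> M)) (tsp E) ?a"
    by (rule continuous_map_paste_open[OF A' M continuous_map_compose[OF \<rho>' lW(3)] sc(2)])
      (use aM in auto)
  moreover have "prj E (?a u) = prj J u" if "u \<in> A' \<union> M" for u
    using that prj_sct[OF E] pm lW(4) \<rho>(2) by (auto simp: A'_def)
  ultimately show ?thesis
    using A' M unfolding local_lift_def A'_def[symmetric] by (auto simp: openin_Un)
qed

text \<open>The inductive step for both constructions. Indices in \<open>I1\<close> use the left
  half and those in \<open>I2\<close> the right half; disjointness allows the lifts to be defined by
  cases on the index.\<close>

lemma lift_cover_join:
  assumes jd: "join_data B Y Z K h k"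
    and lcY: "lift_cover Y (\<lambda>i. \<pi> i \<circ> h) I1" and lcZ: "lift_cover Z (\<lambda>i. \<pi> i \<circ> k) I2"
    and I: "finite I1" "finite I2" "I1 \<inter> I2 = {}"
    and \<pi>: "\<And>i. i \<in> I1 \<union> I2 \<Longrightarrow> fp_map B K X (\<pi> i)"
    and closed: "closedin (tsp Y) (sct Y ` topspace B)" "closedin (tsp Z) (sct Z ` topspace B)"
      "closedin (tsp K) (sct K ` topspace B)"
  shows "lift_cover (fst (fjoin B Y Z K h k)) (\<lambda>i. \<pi> i \<circ> snd (fjoin B Y Z K h k)) (I1 \<union> I2)"
proof -
  interpret join_data B Y Z K h k by (rule jd)
  obtain M0 W1 a1 where M0: "openin (tsp Y) M0" "sct Y ` topspace B \<subseteq> M0"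
    and W1: "topspace (tsp Y) \<subseteq> (\<Union>i\<in>I1. W1 i)" and l1: "\<And>i. i \<in> I1 \<Longrightarrow> local_lift Y M0 (\<pi> i \<circ> h) (W1 i) (a1 i)"
    by (rule lift_coverE[OF lcY]) (rule that)
  obtain N0 W2 a2 where N0: "openin (tsp Z) N0" "sct Z ` topspace B \<subseteq> N0"
    and W2: "topspace (tsp Z) \<subseteq> (\<Union>i\<in>I2. W2 i)" and l2: "\<And>i. i \<in> I2 \<Longrightarrow> local_lift Z N0 (\<pi> i \<circ> k) (W2 i) (a2 i)"
    by (rule lift_coverE[OF lcZ]) (rule that)
  \<comment> \<open>The deformation must be collapsed after every \<open>\<pi> i\<close> at once;
    the index sets are finite, so the intersection is open.\<close>
  define VK where "VK = {w \<in> topspace (tsp K). \<forall>i\<in>I1 \<union> I2. \<pi> i w \<in> V}"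
  have "openin (tsp K) (topspace (tsp K) \<inter> (\<Inter>i\<in>I1 \<union> I2. {w \<in> topspace (tsp K). \<pi> i w \<in> V}))"
  proof (rule openin_Int_Inter[OF _ openin_topspace])
    fix S assume "S \<in> (\<lambda>i. {w \<in> topspace (tsp K). \<pi> i w \<in> V}) ` (I1 \<union> I2)"
    then obtain i where i: "i \<in> I1 \<union> I2" "S = {w \<in> topspace (tsp K). \<pi> i w \<in> V}" by blast
    have "continuous_map (tsp K) (tsp X) (\<pi> i)" using \<pi>[OF i(1)] by (simp add: fp_map_def)
    thus "openin (tsp K) S" unfolding i(2) using V(1) by (rule openin_continuous_map_preimage)
  qed (use I in auto)
  moreover have "topspace (tsp K) \<inter> (\<Inter>i\<in>I1 \<union> I2. {w \<in> topspace (tsp K). \<pi> i w \<in> V}) = VK"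
    by (auto simp: VK_def)
  ultimately have VK: "openin (tsp K) VK" by simp
  have sVK: "sct K ` topspace B \<subseteq> VK"
    using V(2) fp_map_sct[OF \<pi>] sct_mem[OF K] by (auto simp: VK_def)
  define M where "M = M0 \<inter> {y \<in> topspace (tsp Y). h y \<in> VK}"
  define N where "N = N0 \<inter> {z \<in> topspace (tsp Z). k z \<in> VK}"
  have M: "openin (tsp Y) M" "sct Y ` topspace B \<subseteq> M" "h ` M \<subseteq> VK"
    using M0 h sVK openin_continuous_map_preimage[of "tsp Y" "tsp K" h VK] VK sct_mem[OF Y]
    by (auto simp: M_def fp_map_def intro!: openin_Int)
  have N: "openin (tsp Z) N" "sct Z ` topspace B \<subseteq> N" "k ` N \<subseteq> VK"
    using N0 k sVK openin_continuous_map_preimage[of "tsp Z" "tsp K" k VK] VK sct_mem[OF Z]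
    by (auto simp: N_def fp_map_def intro!: openin_Int)
  define Q where "Q = {u \<in> topspace (tsp J). near_section M N VK u}"
  have Q: "openin (tsp J) Q" unfolding Q_def by (rule openin_near_section[OF M N VK sVK])
  have jQ: "jmap u \<in> VK" if "u \<in> Q" for u
    using that jmap_near_section[OF M N VK sVK] by (simp add: Q_def)
  define L where "L = {u \<in> topspace (tsp J). left_part u}"
  define R where "R = {u \<in> topspace (tsp J). right_part u}"
  note left = left_part_maps[OF M N VK sVK closed, folded L_def]
  note right = right_part_maps[OF M N VK sVK closed, folded R_def]
  have VK\<pi>: "\<pi> i w \<in> V" if "i \<in> I1 \<union> I2" "w \<in> VK" for i w using that by (simp add: VK_def)
  have QL: "left_end u \<in> M" if "u \<in> L" "u \<in> Q" for u using left(4) that by (simp add: Q_def)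
  have QR: "right_end u \<in> N" if "u \<in> R" "u \<in> Q" for u using right(4) that by (simp add: Q_def)
  have homL: "homotopic_with (\<lambda>g. \<forall>u\<in>L. prj K (g u) = prj J u \<and> (u \<in> Q \<longrightarrow> g u \<in> VK))
      (subtopology (tsp J) L) (tsp K) jmap (h \<circ> left_end)"
    by (rule homotopic_with_mono[OF left(5)]) (simp add: Q_def)
  have homR: "homotopic_with (\<lambda>g. \<forall>u\<in>R. prj K (g u) = prj J u \<and> (u \<in> Q \<longrightarrow> g u \<in> VK))
      (subtopology (tsp J) R) (tsp K) jmap (k \<circ> right_end)"
    by (rule homotopic_with_mono[OF right(5)]) (simp add: Q_def)
  define W where "W = (\<lambda>i. if i \<in> I1 then {u \<in> L. left_end u \<in> W1 i} \<union> Q else {u \<in> R. right_end u \<in> W2 i} \<union> Q)"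
  define a where "a = (\<lambda>i u. if u \<in> Q then sct E (prj J u) else if i \<in> I1 then a1 i (left_end u) else a2 i (right_end u))"
  have "local_lift J Q (\<pi> i \<circ> jmap) (W i) (a i)" if i: "i \<in> I1 \<union> I2" for i
  proof (cases "i \<in> I1")
    case True
    have "local_lift Y M (\<pi> i \<circ> h) (W1 i) (a1 i)"
      by (rule local_lift_mono[OF l1[OF True]]) (simp add: M_def)
    from local_lift_paste[OF fibrewise_pointed_space_J fp_map_jmap \<pi>[OF i] VK\<pi>[OF i] this
        left(1) Q jQ left(2,3) QL homL]
    show ?thesis using True by (simp add: W_def a_def cong: if_cong)
  next
    case False
    hence "i \<in> I2" using i by simp
    have "local_lift Z N (\<pi> i \<circ> k) (W2 i) (a2 i)"
      by (rule local_lift_mono[OF l2[OF \<open>i \<in> I2\<close>]]) (simp add: N_def)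
    from local_lift_paste[OF fibrewise_pointed_space_J fp_map_jmap \<pi>[OF i] VK\<pi>[OF i] this
        right(1) Q jQ right(2,3) QR homR]
    show ?thesis using False by (simp add: W_def a_def cong: if_cong)
  qed
  moreover have "topspace (tsp J) \<subseteq> (\<Union>i\<in>I1 \<union> I2. W i)"
  proof
    fix u assume u: "u \<in> topspace (tsp J)"
    consider "u \<in> Q" | "u \<in> L" | "u \<in> R"
      using join_cover[OF M N VK sVK u] u by (auto simp: Q_def L_def R_def)
    thus "u \<in> (\<Union>i\<in>I1 \<union> I2. W i)"
    proof cases
      case 1
      \<comment> \<open>A point of \<open>Q\<close> lies over some \<open>b\<close>, and the section
        point of \<open>Y\<close> over \<open>b\<close> belongs to some \<open>W1 i\<close>. Any
        such index covers \<open>Q\<close>.\<close>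
      hence "\<exists>i. i \<in> I1"
        using u prj_mem[OF fibrewise_pointed_space_J] sct_mem[OF Y] W1 by blast
      thus ?thesis using 1 by (auto simp: W_def)
    next
      case 2
      hence "left_end u \<in> topspace (tsp Y)" using continuous_map_image_mem[OF left(2)] u by auto
      thus ?thesis using 2 W1 by (auto simp: W_def)
    next
      case 3
      hence "right_end u \<in> topspace (tsp Z)" using continuous_map_image_mem[OF right(2)] u by auto
      then obtain i where "i \<in> I2" "right_end u \<in> W2 i" using W2 by blast
      moreover have "i \<notin> I1" using I(3) calculation by blast
      ultimately show ?thesis using 3 by (auto simp: W_def)
    qed
  qed
  moreover have "sct J ` topspace B \<subseteq> Q"
    using near_section_sct[OF M N VK sVK] sct_mem[OF fibrewise_pointed_space_J] by (auto simp: Q_def)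
  ultimately show ?thesis by (intro lift_coverI[OF Q])
qed

end

subsection \<open>Maps into the join\<close>

abbreviation fsub :: "('a, 'b) fsp \<Rightarrow> 'a set \<Rightarrow> ('a, 'b) fsp" where
  "fsub W S \<equiv> W\<lparr>tsp := subtopology (tsp W) S\<rparr>"

context join_data
begin

text \<open>Where both lifts exist, the two homotopies to \<open>g\<close> fit together to a path
  from \<open>h (\<alpha> x)\<close> to \<open>k (\<beta> x)\<close> with \<open>g x\<close> in the
  middle. This gives a point of the join with parameter \<open>t x\<close>, and moving the parameter
  to \<open>1/2\<close> leads back to \<open>g\<close>.\<close>

lemma join_section:
  fixes W :: "('w, 'b) fsp"
  assumes W: "fibrewise_pointed_space B W" and \<tau>: "continuous_map (tsp W) euclideanreal \<tau>"
    and g: "fp_map B W K g"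
    and s: "\<And>b. b \<in> topspace B \<Longrightarrow> 0 < \<tau> (sct W b) \<and> \<tau> (sct W b) < 1"
    and \<alpha>: "fp_map B (fsub W {x \<in> topspace (tsp W). \<tau> x < 1}) Y \<alpha>"
      "fp_homotopic B (fsub W {x \<in> topspace (tsp W). \<tau> x < 1}) K (h \<circ> \<alpha>) g"
    and \<beta>: "fp_map B (fsub W {x \<in> topspace (tsp W). 0 < \<tau> x}) Z \<beta>"
      "fp_homotopic B (fsub W {x \<in> topspace (tsp W). 0 < \<tau> x}) K (k \<circ> \<beta>) g"
  shows "\<exists>\<Phi>. fp_map B W J \<Phi> \<and> fp_homotopic B W K (jmap \<circ> \<Phi>) g"
proof -
  let ?I = "top_of_set {0..1::real}"
  define S0 where "S0 = {x \<in> topspace (tsp W). \<tau> x < 1}"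
  define S1 where "S1 = {x \<in> topspace (tsp W). 0 < \<tau> x}"
  define S where "S = S0 \<inter> S1"
  define T0 where "T0 = {x \<in> topspace (tsp W). \<tau> x < 1/3}"
  define T1 where "T1 = {x \<in> topspace (tsp W). 2/3 < \<tau> x}"
  have op: "openin (tsp W) {x \<in> topspace (tsp W). \<tau> x < a}" "openin (tsp W) {x \<in> topspace (tsp W). a < \<tau> x}" for a
    using openin_continuous_map_preimage[OF \<tau>, of "{..<a}"] openin_continuous_map_preimage[OF \<tau>, of "{a<..}"]
    by simp_all
  have oS: "openin (tsp W) S" and oT: "openin (tsp W) T0" "openin (tsp W) T1"
    unfolding S_def S0_def S1_def T0_def T1_def by (intro openin_Int op)+
  have sub: "T0 \<subseteq> S0" "T1 \<subseteq> S1" "S \<subseteq> S0" "S \<subseteq> S1" "S0 \<subseteq> topspace (tsp W)" "S1 \<subseteq> topspace (tsp W)"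
    by (auto simp: T0_def T1_def S_def S0_def S1_def)
  have cover: "x \<in> T0 \<or> x \<in> S \<or> x \<in> T1" if "x \<in> topspace (tsp W)" for x
    using that by (auto simp: T0_def T1_def S_def S0_def S1_def)
  have sS: "sct W b \<in> S" if "b \<in> topspace B" for b
    using s[OF that] sct_mem[OF W that] by (simp add: S_def S0_def S1_def)
  have \<alpha>c: "continuous_map (subtopology (tsp W) S0) (tsp Y) \<alpha>"
    and \<alpha>p: "\<And>x. x \<in> S0 \<Longrightarrow> prj Y (\<alpha> x) = prj W x" and \<alpha>s: "\<And>b. b \<in> topspace B \<Longrightarrow> \<alpha> (sct W b) = sct Y b"
    using \<alpha>(1) by (auto simp: fp_map_def S0_def)
  have \<beta>c: "continuous_map (subtopology (tsp W) S1) (tsp Z) \<beta>"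
    and \<beta>p: "\<And>x. x \<in> S1 \<Longrightarrow> prj Z (\<beta> x) = prj W x" and \<beta>s: "\<And>b. b \<in> topspace B \<Longrightarrow> \<beta> (sct W b) = sct Z b"
    using \<beta>(1) by (auto simp: fp_map_def S1_def)
  obtain F where F: "continuous_map (prod_topology ?I (subtopology (tsp W) S0)) (tsp K) F"
    and F0: "\<And>x. F (0, x) = h (\<alpha> x)" and F1: "\<And>x. F (1, x) = g x"
    and Fp: "\<And>t x. t \<in> {0..1} \<Longrightarrow> x \<in> S0 \<Longrightarrow> prj K (F (t, x)) = prj W x"
    and Fs: "\<And>t b. t \<in> {0..1} \<Longrightarrow> b \<in> topspace B \<Longrightarrow> F (t, sct W b) = sct K b"
    using \<alpha>(2) unfolding fp_homotopic_def homotopic_with_def S0_def by auto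
  obtain G where G: "continuous_map (prod_topology ?I (subtopology (tsp W) S1)) (tsp K) G"
    and G0: "\<And>x. G (0, x) = k (\<beta> x)" and G1: "\<And>x. G (1, x) = g x"
    and Gp: "\<And>t x. t \<in> {0..1} \<Longrightarrow> x \<in> S1 \<Longrightarrow> prj K (G (t, x)) = prj W x"
    and Gs: "\<And>t b. t \<in> {0..1} \<Longrightarrow> b \<in> topspace B \<Longrightarrow> G (t, sct W b) = sct K b"
    using \<beta>(2) unfolding fp_homotopic_def homotopic_with_def S1_def by auto
  \<comment> \<open>The first half runs through \<open>F\<close>, the second through
    \<open>G\<close> backwards; both reach \<open>g\<close> at time \<open>1/2\<close>.\<close>
  define \<Theta> where "\<Theta> = (\<lambda>p. if snd p \<le> 1/2 then F (2 * snd p, fst p) else G (2 - 2 * snd p, fst p))"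
  let ?WS = "subtopology (tsp W) S"
  have \<Theta>: "continuous_map (prod_topology ?WS ?I) (tsp K) \<Theta>"
    unfolding \<Theta>_def
  proof (rule continuous_map_cases_le)
    let ?P = "prod_topology ?WS ?I"
    have sn: "continuous_map ?P euclideanreal snd"
      by (rule continuous_map_into_fulltopology[OF continuous_map_snd])
    show "continuous_map ?P euclideanreal snd" by (rule sn)
    show "continuous_map ?P euclideanreal (\<lambda>p. 1/2)" by simp
    have fW: "continuous_map ?P (tsp W) fst" by (rule continuous_map_into_fulltopology[OF continuous_map_fst])
    have f0: "continuous_map ?P (subtopology (tsp W) S0) fst"
      using fW sub by (auto simp: continuous_map_in_subtopology)
    have f1: "continuous_map ?P (subtopology (tsp W) S1) fst"
      using fW sub by (auto simp: continuous_map_in_subtopology)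
    have "continuous_map (subtopology ?P {x \<in> topspace ?P. snd x \<le> 1/2}) (prod_topology ?I (subtopology (tsp W) S0))
        (\<lambda>p. (2 * snd p, fst p))"
      unfolding continuous_map_pairwise o_def fst_conv snd_conv
    proof (intro conjI)
      show "continuous_map (subtopology ?P {x \<in> topspace ?P. snd x \<le> 1/2}) ?I (\<lambda>p. 2 * snd p)"
        by (rule continuous_map_into_subtopology)
          (auto intro!: continuous_intros continuous_map_from_subtopology sn)
    qed (intro continuous_map_from_subtopology f0)
    from continuous_map_compose[OF this F]
    show "continuous_map (subtopology ?P {x \<in> topspace ?P. snd x \<le> 1/2}) (tsp K) (\<lambda>p. F (2 * snd p, fst p))"
      by (simp add: o_def)
    have "continuous_map (subtopology ?P {x \<in> topspace ?P. 1/2 \<le> snd x}) (prod_topology ?I (subtopology (tsp W) S1))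
        (\<lambda>p. (2 - 2 * snd p, fst p))"
      unfolding continuous_map_pairwise o_def fst_conv snd_conv
    proof (intro conjI)
      show "continuous_map (subtopology ?P {x \<in> topspace ?P. 1/2 \<le> snd x}) ?I (\<lambda>p. 2 - 2 * snd p)"
        by (rule continuous_map_into_subtopology)
          (auto intro!: continuous_intros continuous_map_from_subtopology sn)
    qed (intro continuous_map_from_subtopology f1)
    from continuous_map_compose[OF this G]
    show "continuous_map (subtopology ?P {x \<in> topspace ?P. 1/2 \<le> snd x}) (tsp K) (\<lambda>p. G (2 - 2 * snd p, fst p))"
      by (simp add: o_def)
    show "F (2 * snd p, fst p) = G (2 - 2 * snd p, fst p)" if "snd p = 1/2" for p :: "'w \<times> real"
    proof -
      have "2 * snd p = 1" "2 - 2 * snd p = 1" using that by simp_all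
      thus ?thesis by (simp only: F1 G1)
    qed
  qed
  have \<Theta>p: "prj K (\<Theta> (x, r)) = prj W x" if "x \<in> S" "r \<in> {0..1}" for x r
    using that sub Fp[of "2 * r" x] Gp[of "2 - 2 * r" x] by (auto simp: \<Theta>_def)
  have \<Theta>s: "\<Theta> (sct W b, r) = sct K b" if "b \<in> topspace B" "r \<in> {0..1}" for b r
    using that Fs[of "2 * r" b] Gs[of "2 - 2 * r" b] by (auto simp: \<Theta>_def)
  define \<theta> where "\<theta> = (\<lambda>x. restrict (\<lambda>r. \<Theta> (x, r)) {0..1})"
  \<comment> \<open>The slope 3 makes \<open>t\<close> equal to 0 for
    \<open>\<tau> \<le> 1/3\<close> and to 1 for \<open>\<tau> \<ge> 2/3\<close>, so on the overlaps
    of the open sets \<open>T0\<close>, \<open>S\<close>, \<open>T1\<close> the gluing relation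
    applies.\<close>
  define t where "t = (\<lambda>x. max 0 (min 1 (3 * \<tau> x - 1)))"
  define q where "q = (\<lambda>x. ((\<alpha> x, (prj W x, \<theta> x), \<beta> x), t x))"
  have \<theta>: "continuous_map ?WS (path_top (tsp K)) \<theta>"
    unfolding \<theta>_def by (rule continuous_map_curry_path[OF \<Theta>])
  have tc: "continuous_map (tsp W) euclideanreal t"
    unfolding t_def by (intro continuous_intros \<tau>)
  have t01: "t x \<in> {0..1}" for x by (simp add: t_def)
  have \<Theta>0: "\<Theta> (x, 0) = h (\<alpha> x)" "\<Theta> (x, 1) = k (\<beta> x)" "\<Theta> (x, 1/2) = g x" for x
    by (simp_all add: \<Theta>_def F0 G0 F1)
  have q_mem: "q x \<in> topspace EI" if x: "x \<in> S" for x
  proof -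
    have x': "x \<in> S0" "x \<in> S1" "x \<in> topspace (tsp W)" using x sub by auto
    have "\<alpha> x \<in> topspace (tsp Y)" "\<beta> x \<in> topspace (tsp Z)" "\<theta> x \<in> paths (tsp K)" "prj W x \<in> topspace B"
      using x x' continuous_map_image_mem[OF \<alpha>c, of x] continuous_map_image_mem[OF \<beta>c, of x]
        continuous_map_image_mem[OF \<theta>, of x] prj_mem[OF W, of x] by auto
    thus ?thesis unfolding mem_EI using \<Theta>p[OF x] t01[of x] by (simp add: q_def \<Theta>0) (simp add: \<theta>_def \<Theta>0)
  qed
  have qc: "continuous_map ?WS EI q"
  proof -
    have S': "?WS = subtopology (subtopology (tsp W) S0) S" "?WS = subtopology (subtopology (tsp W) S1) S"
      using sub by (simp_all add: subtopology_subtopology Int_absorb1)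
    have a: "continuous_map ?WS (tsp Y) \<alpha>" "continuous_map ?WS (tsp Z) \<beta>"
      using \<alpha>c \<beta>c S' continuous_map_from_subtopology by metis+
    have b: "continuous_map ?WS B (prj W)"
      using W by (intro continuous_map_from_subtopology) (simp add: fibrewise_pointed_space_def)
    have PB: "continuous_map ?WS (PB B K) (\<lambda>x. (prj W x, \<theta> x))"
      unfolding PB_def
      by (rule continuous_map_into_subtopology)
        (use b \<theta> \<Theta>p in \<open>auto simp: continuous_map_pairwise o_def \<theta>_def\<close>)
    have "continuous_map ?WS (Ehk B Y Z K h k) (\<lambda>x. (\<alpha> x, (prj W x, \<theta> x), \<beta> x))"
      unfolding Ehk_def
      by (rule continuous_map_into_subtopology)
        (use a PB in \<open>auto simp: continuous_map_pairwise o_def \<theta>_def \<Theta>0\<close>)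
    moreover have "continuous_map ?WS ?I t"
      by (rule continuous_map_into_subtopology) (use tc t01 in \<open>auto intro: continuous_map_from_subtopology\<close>)
    ultimately show ?thesis unfolding EI_def q_def by (simp add: continuous_map_pairwise o_def)
  qed
  define \<Phi> where "\<Phi> = (\<lambda>x. if \<tau> x < 1/3 then rep (UL (\<alpha> x)) else if 2/3 < \<tau> x then rep (UR (\<beta> x)) else rep (uj (q x)))"
  \<comment> \<open>On the overlaps with \<open>T0\<close> and \<open>T1\<close> the parameter is 0
    or 1, and the join identifies the point with its end in \<open>Y\<close> or
    \<open>Z\<close>.\<close>
  have \<Phi>S: "\<Phi> x = rep (uj (q x))" if "x \<in> S" for x
    using rep_0[OF q_mem[OF that]] rep_1[OF q_mem[OF that]] by (auto simp: \<Phi>_def q_def t_def)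
  have \<Phi>T0: "\<Phi> x = rep (UL (\<alpha> x))" if "x \<in> T0" for x using that by (simp add: \<Phi>_def T0_def)
  have \<Phi>T1: "\<Phi> x = rep (UR (\<beta> x))" if "x \<in> T1" for x using that by (simp add: \<Phi>_def T1_def)
  have ST: "subtopology (tsp W) T0 = subtopology (subtopology (tsp W) S0) T0"
    "subtopology (tsp W) T1 = subtopology (subtopology (tsp W) S1) T1"
    using sub by (simp_all add: subtopology_subtopology Int_absorb1)
  have \<Phi>c: "continuous_map (tsp W) (tsp J) \<Phi>"
  proof (rule continuous_map_locally)
    fix x assume x: "x \<in> topspace (tsp W)"
    have "continuous_map (subtopology (tsp W) T0) (tsp J) \<Phi>"
    proof (rule continuous_map_eq)
      show "continuous_map (subtopology (tsp W) T0) (tsp J) ((\<lambda>y. rep (UL y)) \<circ> \<alpha>)"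
        unfolding ST
        by (rule continuous_map_from_subtopology[OF continuous_map_compose[OF \<alpha>c continuous_map_into_J(1)]])
    qed (use \<Phi>T0 in auto)
    moreover have "continuous_map (subtopology (tsp W) T1) (tsp J) \<Phi>"
    proof (rule continuous_map_eq)
      show "continuous_map (subtopology (tsp W) T1) (tsp J) ((\<lambda>y. rep (UR y)) \<circ> \<beta>)"
        unfolding ST
        by (rule continuous_map_from_subtopology[OF continuous_map_compose[OF \<beta>c continuous_map_into_J(3)]])
    qed (use \<Phi>T1 in auto)
    moreover have "continuous_map ?WS (tsp J) \<Phi>"
    proof (rule continuous_map_eq)
      show "continuous_map ?WS (tsp J) ((\<lambda>q. rep (uj q)) \<circ> q)"
        by (rule continuous_map_compose[OF qc continuous_map_into_J(2)])
    qed (use \<Phi>S in auto)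
    ultimately show "\<exists>A. openin (tsp W) A \<and> x \<in> A \<and> continuous_map (subtopology (tsp W) A) (tsp J) \<Phi>"
      using cover[OF x] oS oT by blast
  qed
  have \<Phi>p: "prj J (\<Phi> x) = prj W x" if "x \<in> topspace (tsp W)" for x
    using cover[OF that]
  proof (elim disjE)
    assume "x \<in> T0" thus ?thesis using \<alpha>p sub by (auto simp: \<Phi>T0 prj_J)
  next
    assume "x \<in> T1" thus ?thesis using \<beta>p sub by (auto simp: \<Phi>T1 prj_J)
  next
    assume "x \<in> S" thus ?thesis by (simp add: \<Phi>S prj_J) (simp add: q_def)
  qed
  \<comment> \<open>Section points have \<open>0 < \<tau> < 1\<close> and hence lie in
    \<open>S\<close>; the path over them is constant, so they land on a collapsed segment whatever
    the value of \<open>t\<close>.\<close>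
  have \<Phi>s: "\<Phi> (sct W b) = sct J b" if b: "b \<in> topspace B" for b
  proof -
    have "\<theta> (sct W b) = const_path (sct K b)"
      unfolding \<theta>_def const_path_def by (rule ext) (auto simp: \<Theta>s[OF b] restrict_def)
    hence "uj (q (sct W b)) = UJ (sct Y b) b (const_path (sct K b)) (sct Z b) (t (sct W b))"
      using b by (simp add: q_def \<alpha>s \<beta>s prj_sct[OF W])
    thus ?thesis using \<Phi>S[OF sS[OF b]] rep_sct_UJ[OF b t01] by simp
  qed
  have 1: "fp_map B W J \<Phi>" unfolding fp_map_def using \<Phi>c \<Phi>p \<Phi>s by blast
  \<comment> \<open>The parameter moves linearly from \<open>t x\<close> to \<open>1/2\<close>. For
    \<open>t x = 0\<close> it is \<open>r / 2\<close>, where the path is \<open>F (r, x)\<close>;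
    for \<open>t x = 1\<close> it is \<open>1 - r / 2\<close>, where the path is
    \<open>G (r, x)\<close>. So the formula continues over \<open>T0\<close> and \<open>T1\<close>,
    where only one lift exists.\<close>
  define D where "D = (\<lambda>p. if \<tau> (snd p) < 1/3 then F p else if 2/3 < \<tau> (snd p) then G p
     else \<Theta> (snd p, t (snd p) * (1 - fst p) + fst p / 2))"
  have conv: "t x * (1 - r) + r / 2 \<in> {0..1}" if "r \<in> {0..1}" for r x
  proof -
    have "0 \<le> t x * (1 - r)" "t x * (1 - r) \<le> 1 * (1 - r)"
      using t01[of x] that mult_right_mono[of "t x" 1 "1 - r"] by auto
    thus ?thesis using that by auto
  qed
  have DS: "D (r, x) = \<Theta> (x, t x * (1 - r) + r / 2)" if "x \<in> S" "r \<in> {0..1}" for r x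
  proof -
    have "F (r, x) = \<Theta> (x, t x * (1 - r) + r / 2)" if "\<tau> x < 1/3"
    proof -
      have "t x = 0" using that by (simp add: t_def)
      thus ?thesis using \<open>r \<in> {0..1}\<close> by (simp add: \<Theta>_def)
    qed
    moreover have "G (r, x) = \<Theta> (x, t x * (1 - r) + r / 2)" if "2/3 < \<tau> x"
    proof -
      have "t x = 1" using that by (simp add: t_def)
      \<comment> \<open>At \<open>r = 1\<close> the time is exactly \<open>1/2\<close>, where
        \<open>\<Theta>\<close> takes its first branch; both branches give \<open>g x\<close>
        there.\<close>
      thus ?thesis using \<open>r \<in> {0..1}\<close> F1[of x] G1[of x] by (cases "r = 1") (simp_all add: \<Theta>_def field_simps)
    qed
    ultimately show ?thesis by (simp add: D_def)
  qed
  have DT0: "D (r, x) = F (r, x)" if "x \<in> T0" for r x using that by (simp add: D_def T0_def)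
  have DT1: "D (r, x) = G (r, x)" if "x \<in> T1" for r x using that by (simp add: D_def T1_def)
  have pt: "prod_topology ?I (subtopology (tsp W) A) = subtopology (prod_topology ?I (tsp W)) ({0..1} \<times> A)" for A
    using prod_topology_subtopology(2)[of ?I "tsp W" A] by simp
  have pst: "prod_topology ?I (subtopology T A) = subtopology (prod_topology ?I T) ({0..1} \<times> A)" for A and T :: "'w topology"
    using prod_topology_subtopology(2)[of ?I T A] by simp
  have Dc: "continuous_map (prod_topology ?I (tsp W)) (tsp K) D"
  proof (rule continuous_map_locally)
    fix p assume "p \<in> topspace (prod_topology ?I (tsp W))"
    then obtain r x where p: "p = (r, x)" "r \<in> {0..1}" "x \<in> topspace (tsp W)" by auto
    have "continuous_map (prod_topology ?I (subtopology (tsp W) T0)) (tsp K) D"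
    proof (rule continuous_map_eq)
      show "continuous_map (prod_topology ?I (subtopology (tsp W) T0)) (tsp K) F"
        unfolding ST pst[of "subtopology (tsp W) S0"] by (rule continuous_map_from_subtopology[OF F])
    qed (use DT0 in auto)
    moreover have "continuous_map (prod_topology ?I (subtopology (tsp W) T1)) (tsp K) D"
    proof (rule continuous_map_eq)
      show "continuous_map (prod_topology ?I (subtopology (tsp W) T1)) (tsp K) G"
        unfolding ST pst[of "subtopology (tsp W) S1"] by (rule continuous_map_from_subtopology[OF G])
    qed (use DT1 in auto)
    moreover have "continuous_map (prod_topology ?I ?WS) (tsp K) D"
    proof (rule continuous_map_eq)
      let ?P = "prod_topology ?I ?WS"
      have r: "continuous_map ?P euclideanreal fst"
        by (rule continuous_map_into_fulltopology[OF continuous_map_fst])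
      have x: "continuous_map ?P (tsp W) snd"
        by (rule continuous_map_into_fulltopology[OF continuous_map_snd])
      have tx: "continuous_map ?P euclideanreal (\<lambda>p. t (snd p))"
        using continuous_map_compose[OF x tc] by (simp add: o_def)
      have "continuous_map ?P ?I (\<lambda>p. t (snd p) * (1 - fst p) + fst p / 2)"
        by (rule continuous_map_into_subtopology)
          (use conv in \<open>auto intro!: continuous_intros r tx\<close>)
      hence "continuous_map ?P (prod_topology ?WS ?I) (\<lambda>p. (snd p, t (snd p) * (1 - fst p) + fst p / 2))"
        by (simp add: continuous_map_pairwise o_def continuous_map_snd)
      from continuous_map_compose[OF this \<Theta>]
      show "continuous_map ?P (tsp K) (\<lambda>p. \<Theta> (snd p, t (snd p) * (1 - fst p) + fst p / 2))" by (simp add: o_def)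
    qed (use DS in auto)
    moreover have "openin (prod_topology ?I (tsp W)) ({0..1} \<times> A)" if "openin (tsp W) A" for A
      using that by (simp add: openin_prod_Times_iff)
    ultimately show "\<exists>A. openin (prod_topology ?I (tsp W)) A \<and> p \<in> A \<and>
        continuous_map (subtopology (prod_topology ?I (tsp W)) A) (tsp K) D"
      unfolding pt using cover[OF p(3)] oS oT p(1,2) by blast
  qed
  have 2: "fp_homotopic B W K (jmap \<circ> \<Phi>) g"
    unfolding fp_homotopic_def
  proof (rule homotopic_withI[OF Dc])
    fix x assume x: "x \<in> topspace (tsp W)"
    show "D (0, x) = (jmap \<circ> \<Phi>) x" using cover[OF x]
    proof (elim disjE)
      assume "x \<in> T0" thus ?thesis by (simp add: \<Phi>T0 DT0 jmap F0)
    next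
      assume "x \<in> T1" thus ?thesis by (simp add: \<Phi>T1 DT1 jmap G0)
    next
      assume "x \<in> S" thus ?thesis using t01[of x] by (simp add: \<Phi>S DS jmap) (simp add: q_def \<theta>_def)
    qed
    show "D (1, x) = g x" using cover[OF x] by (auto simp: DT0 DT1 DS F1 G1 \<Theta>0)
  next
    fix r :: real assume r: "r \<in> {0..1}"
    have "prj K (D (r, x)) = prj W x" if x: "x \<in> topspace (tsp W)" for x
      using cover[OF x] sub r Fp Gp \<Theta>p conv by (auto simp: DT0 DT1 DS)
    moreover have "D (r, sct W b) = sct K b" if "b \<in> topspace B" for b
      using \<Theta>s[OF that conv[OF r]] DS[OF sS[OF that] r] by simp
    ultimately show "(\<forall>x\<in>topspace (tsp W). prj K (D (r, x)) = prj W x) \<and> (\<forall>b\<in>topspace B. D (r, sct W b) = sct K b)"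
      by blast
  qed (use sct_mem[OF W] in auto)
  show ?thesis using 1 2 by blast
qed

text \<open>The form that can be iterated: the positivity sets of \<open>v\<close> and
  \<open>w\<close> carry the two lifts, and that of \<open>v + w\<close> carries the lift to the
  join.\<close>

lemma join_section_sum:
  fixes W :: "('w, 'b) fsp"
  assumes W: "fibrewise_pointed_space B W" and g: "fp_map B W K g"
    and v: "continuous_map (tsp W) euclideanreal v" "continuous_map (tsp W) euclideanreal w"
      "\<And>x. x \<in> topspace (tsp W) \<Longrightarrow> 0 \<le> v x" "\<And>x. x \<in> topspace (tsp W) \<Longrightarrow> 0 \<le> w x"
    and s: "\<And>b. b \<in> topspace B \<Longrightarrow> 0 < v (sct W b)" "\<And>b. b \<in> topspace B \<Longrightarrow> 0 < w (sct W b)"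
    and \<alpha>: "fp_map B (fsub W {x \<in> topspace (tsp W). 0 < v x}) Y \<alpha>"
      "fp_homotopic B (fsub W {x \<in> topspace (tsp W). 0 < v x}) K (h \<circ> \<alpha>) g"
    and \<beta>: "fp_map B (fsub W {x \<in> topspace (tsp W). 0 < w x}) Z \<beta>"
      "fp_homotopic B (fsub W {x \<in> topspace (tsp W). 0 < w x}) K (k \<circ> \<beta>) g"
  shows "\<exists>\<Phi>. fp_map B (fsub W {x \<in> topspace (tsp W). 0 < v x + w x}) J \<Phi> \<and>
    fp_homotopic B (fsub W {x \<in> topspace (tsp W). 0 < v x + w x}) K (jmap \<circ> \<Phi>) g"
proof -
  define S where "S = {x \<in> topspace (tsp W). 0 < v x + w x}"
  \<comment> \<open>Where \<open>v + w > 0\<close>, this ratio is below 1 exactly where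
    \<open>v > 0\<close> and positive exactly where \<open>w > 0\<close>.\<close>
  define \<tau> where "\<tau> = (\<lambda>x. w x / (v x + w x))"
  have sS: "sct W ` topspace B \<subseteq> S"
    using s sct_mem[OF W] by (force simp: S_def intro: add_pos_pos)
  have W': "fibrewise_pointed_space B (fsub W S)"
    using W sS by (auto simp: fibrewise_pointed_space_def continuous_map_in_subtopology
        intro: continuous_map_from_subtopology)
  have tS: "topspace (tsp (fsub W S)) = S" by (auto simp: S_def)
  have "continuous_map (subtopology (tsp W) S) euclideanreal \<tau>"
    unfolding \<tau>_def
    by (intro continuous_map_real_divide continuous_map_add continuous_map_from_subtopology v)
      (auto simp: S_def)
  hence \<tau>: "continuous_map (tsp (fsub W S)) euclideanreal \<tau>" by simp
  have lt: "\<tau> x < 1 \<longleftrightarrow> 0 < v x" "0 < \<tau> x \<longleftrightarrow> 0 < w x" if "x \<in> S" for x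
    using that v(4)[of x] by (auto simp: S_def \<tau>_def divide_simps zero_less_mult_iff)
  have pos: "0 < v x + w x" if "x \<in> topspace (tsp W)" "0 < v x \<or> 0 < w x" for x
    using that v(3,4)[of x] by auto
  have eq: "fsub (fsub W S) {x \<in> topspace (tsp (fsub W S)). \<tau> x < 1} = fsub W {x \<in> topspace (tsp W). 0 < v x}"
    "fsub (fsub W S) {x \<in> topspace (tsp (fsub W S)). 0 < \<tau> x} = fsub W {x \<in> topspace (tsp W). 0 < w x}"
  proof -
    have "S \<inter> {x \<in> S. \<tau> x < 1} = {x \<in> topspace (tsp W). 0 < v x}"
      "S \<inter> {x \<in> S. 0 < \<tau> x} = {x \<in> topspace (tsp W). 0 < w x}"
      using lt pos by (auto simp: S_def)
    thus "fsub (fsub W S) {x \<in> topspace (tsp (fsub W S)). \<tau> x < 1} = fsub W {x \<in> topspace (tsp W). 0 < v x}"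
      "fsub (fsub W S) {x \<in> topspace (tsp (fsub W S)). 0 < \<tau> x} = fsub W {x \<in> topspace (tsp W). 0 < w x}"
      unfolding tS by (simp_all add: subtopology_subtopology)
  qed
  have g': "fp_map B (fsub W S) K g"
    using g by (auto simp: fp_map_def intro: continuous_map_from_subtopology)
  have s\<tau>: "0 < \<tau> (sct (fsub W S) b) \<and> \<tau> (sct (fsub W S) b) < 1" if "b \<in> topspace B" for b
    using s[OF that] by (simp add: \<tau>_def)
  show ?thesis
    using join_section[OF W' \<tau> g' s\<tau>] \<alpha> \<beta> unfolding eq S_def[symmetric] by blast
qed

end

subsection \<open>Fibre products and normal spaces\<close>

definition upl :: "('b, 'e, 'x) U \<Rightarrow> ('b, 'e, 'x) U" where
  "upl u = (case u of UP x y \<Rightarrow> x | _ \<Rightarrow> undefined)"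

definition upr :: "('b, 'e, 'x) U \<Rightarrow> ('b, 'e, 'x) U" where
  "upr u = (case u of UP x y \<Rightarrow> y | _ \<Rightarrow> undefined)"

lemma up_simps [simp]: "upl (UP x y) = x" "upr (UP x y) = y"
  by (simp_all add: upl_def upr_def)

lemma mem_fprod:
  "u \<in> topspace (tsp (fprod X Y)) \<longleftrightarrow>
    (\<exists>x y. u = UP x y \<and> x \<in> topspace (tsp X) \<and> y \<in> topspace (tsp Y) \<and> prj X x = prj Y y)"
  by (auto simp: fprod_def)

lemma prj_fprod [simp]: "prj (fprod X Y) (UP x y) = prj X x"
  by (simp add: fprod_def)

lemma sct_fprod [simp]: "sct (fprod X Y) b = UP (sct X b) (sct Y b)"
  by (simp add: fprod_def)

lemma continuous_map_fprod_proj: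
  "continuous_map (tsp (fprod X Y)) (tsp X) upl" "continuous_map (tsp (fprod X Y)) (tsp Y) upr"
proof -
  have eq: "upl \<circ> (\<lambda>(x, y). UP x y) = fst" "upr \<circ> (\<lambda>(x, y). UP x y) = snd" by auto
  show "continuous_map (tsp (fprod X Y)) (tsp X) upl"
    unfolding fprod_def fsp.simps
    by (rule continuous_map_from_final_top, unfold eq,
        rule continuous_map_from_subtopology[OF continuous_map_fst])
  show "continuous_map (tsp (fprod X Y)) (tsp Y) upr"
    unfolding fprod_def fsp.simps
    by (rule continuous_map_from_final_top, unfold eq,
        rule continuous_map_from_subtopology[OF continuous_map_snd])
qed

lemma continuous_map_into_fprod:
  assumes "continuous_map W (tsp X) g" "continuous_map W (tsp Y) g'"
    and "\<And>w. w \<in> topspace W \<Longrightarrow> prj X (g w) = prj Y (g' w)"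
  shows "continuous_map W (tsp (fprod X Y)) (\<lambda>w. UP (g w) (g' w))"
proof -
  let ?S = "subtopology (prod_topology (tsp X) (tsp Y)) {(x, y). prj X x = prj Y y}"
  have "continuous_map W ?S (\<lambda>w. (g w, g' w))"
    by (rule continuous_map_into_subtopology) (use assms in \<open>auto simp: continuous_map_pairwise o_def\<close>)
  from continuous_map_compose[OF this continuous_map_into_final_top[of ?S "\<lambda>(x, y). UP x y"]]
  show ?thesis by (simp add: fprod_def o_def)
qed

lemma fibrewise_pointed_space_fprod:
  assumes "fibrewise_pointed_space B X" "fibrewise_pointed_space B Y"
  shows "fibrewise_pointed_space B (fprod X Y)"
  unfolding fibrewise_pointed_space_def
proof (intro conjI ballI)
  have "continuous_map (tsp X) B (prj X)" using assms by (simp add: fibrewise_pointed_space_def)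
  from continuous_map_compose[OF continuous_map_fprod_proj(1) this]
  show "continuous_map (tsp (fprod X Y)) B (prj (fprod X Y))"
    by (rule continuous_map_eq) (auto simp: mem_fprod)
  have "continuous_map B (tsp (fprod X Y)) (\<lambda>b. UP (sct X b) (sct Y b))"
    by (rule continuous_map_into_fprod) (use assms in \<open>auto simp: fibrewise_pointed_space_def\<close>)
  moreover have "sct (fprod X Y) = (\<lambda>b. UP (sct X b) (sct Y b))" by (rule ext) simp
  ultimately show "continuous_map B (tsp (fprod X Y)) (sct (fprod X Y))" by simp
qed (use assms in \<open>auto simp: prj_sct\<close>)

lemma fp_map_fprod_proj: "fp_map B (fprod X Y) X upl" "fp_map B (fprod X Y) Y upr"
  unfolding fp_map_def using continuous_map_fprod_proj[of X Y] by (auto simp: mem_fprod)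

lemma fp_map_pair:
  assumes "fp_map B W X g" "fp_map B W Y g'"
  shows "fp_map B W (fprod X Y) (\<lambda>w. UP (g w) (g' w))"
  unfolding fp_map_def using assms
  by (auto simp: fp_map_def intro!: continuous_map_into_fprod)

lemma fp_homotopic_pair:
  assumes W: "fibrewise_pointed_space B W"
    and "fp_homotopic B W X g0 g1" "fp_homotopic B W Y g0' g1'"
  shows "fp_homotopic B W (fprod X Y) (\<lambda>w. UP (g0 w) (g0' w)) (\<lambda>w. UP (g1 w) (g1' w))"
proof -
  let ?I = "top_of_set {0..1::real}"
  obtain H where H: "continuous_map (prod_topology ?I (tsp W)) (tsp X) H"
    "\<And>x. H (0, x) = g0 x" "\<And>x. H (1, x) = g1 x"
    and Hp: "\<And>t x. t \<in> {0..1} \<Longrightarrow> x \<in> topspace (tsp W) \<Longrightarrow> prj X (H (t, x)) = prj W x"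
    and Hs: "\<And>t b. t \<in> {0..1} \<Longrightarrow> b \<in> topspace B \<Longrightarrow> H (t, sct W b) = sct X b"
    using assms(2) unfolding fp_homotopic_def homotopic_with_def by auto
  obtain G where G: "continuous_map (prod_topology ?I (tsp W)) (tsp Y) G"
    "\<And>x. G (0, x) = g0' x" "\<And>x. G (1, x) = g1' x"
    and Gp: "\<And>t x. t \<in> {0..1} \<Longrightarrow> x \<in> topspace (tsp W) \<Longrightarrow> prj Y (G (t, x)) = prj W x"
    and Gs: "\<And>t b. t \<in> {0..1} \<Longrightarrow> b \<in> topspace B \<Longrightarrow> G (t, sct W b) = sct Y b"
    using assms(3) unfolding fp_homotopic_def homotopic_with_def by auto
  show ?thesis
    unfolding fp_homotopic_def
  proof (rule homotopic_withI)
    show "continuous_map (prod_topology ?I (tsp W)) (tsp (fprod X Y)) (\<lambda>p. UP (H p) (G p))"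
      by (rule continuous_map_into_fprod[OF H(1) G(1)]) (use Hp Gp in auto)
  qed (use H G Hp Hs Gs sct_mem[OF W] in auto)
qed

text \<open>A point of the product whose coordinates both lie in their sections is a section point,
  since the coordinates lie over the same \<open>b\<close>.\<close>

lemma closedin_sct_fprod:
  assumes X: "fibrewise_pointed_space B X" "closedin (tsp X) (sct X ` topspace B)"
    and Y: "fibrewise_pointed_space B Y" "closedin (tsp Y) (sct Y ` topspace B)"
  shows "closedin (tsp (fprod X Y)) (sct (fprod X Y) ` topspace B)"
proof -
  have "closedin (tsp (fprod X Y)) ({u \<in> topspace (tsp (fprod X Y)). upl u \<in> sct X ` topspace B} \<inter>
      {u \<in> topspace (tsp (fprod X Y)). upr u \<in> sct Y ` topspace B})"
    by (intro closedin_Int closedin_continuous_map_preimage[OF continuous_map_fprod_proj(1) X(2)]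
        closedin_continuous_map_preimage[OF continuous_map_fprod_proj(2) Y(2)])
  also have "\<dots> = sct (fprod X Y) ` topspace B"
  proof (intro set_eqI iffI)
    fix u assume "u \<in> {u \<in> topspace (tsp (fprod X Y)). upl u \<in> sct X ` topspace B} \<inter>
      {u \<in> topspace (tsp (fprod X Y)). upr u \<in> sct Y ` topspace B}"
    then obtain b b' where b: "b \<in> topspace B" "b' \<in> topspace B" "u = UP (sct X b) (sct Y b')"
      "prj X (sct X b) = prj Y (sct Y b')" by (auto simp: mem_fprod)
    hence "b = b'" using X(1) Y(1) by (simp add: prj_sct)
    thus "u \<in> sct (fprod X Y) ` topspace B" using b by auto
  next
    fix u assume "u \<in> sct (fprod X Y) ` topspace B"
    thus "u \<in> {u \<in> topspace (tsp (fprod X Y)). upl u \<in> sct X ` topspace B} \<inter>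
      {u \<in> topspace (tsp (fprod X Y)). upr u \<in> sct Y ` topspace B}"
      using sct_mem[OF fibrewise_pointed_space_fprod[OF X(1) Y(1)]] by auto
  qed
  finally show ?thesis .
qed

lemma fpow_props:
  assumes X: "fibrewise_pointed_space B X" "closedin (tsp X) (sct X ` topspace B)"
  shows "fibrewise_pointed_space B (fpow X n)" "closedin (tsp (fpow X n)) (sct (fpow X n) ` topspace B)"
proof -
  have "fibrewise_pointed_space B (fpow X n) \<and> closedin (tsp (fpow X n)) (sct (fpow X n) ` topspace B)"
    by (induction n) (use X fibrewise_pointed_space_fprod closedin_sct_fprod in auto)
  thus "fibrewise_pointed_space B (fpow X n)" "closedin (tsp (fpow X n)) (sct (fpow X n) ` topspace B)"
    by auto
qed

lemma fp_map_diag: "fibrewise_pointed_space B X \<Longrightarrow> fp_map B X (fpow X n) (diag n)"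
proof (induction n)
  case 0 thus ?case using fp_map_id[of B X] by (simp add: id_def)
next
  case (Suc n)
  show ?case using fp_map_pair[OF fp_map_id[OF Suc.prems] Suc.IH[OF Suc.prems]] by simp
qed

section \<open>Transport of \<open>E\<close>, \<open>X\<close> and \<open>f\<close> into the
  universe type\<close>

definition unE :: "('b, 'e, 'x) U \<Rightarrow> 'e" where "unE u = (case u of UE e \<Rightarrow> e | _ \<Rightarrow> undefined)"
definition unX :: "('b, 'e, 'x) U \<Rightarrow> 'x" where "unX u = (case u of UX x \<Rightarrow> x | _ \<Rightarrow> undefined)"

lemma un_simps [simp]: "unE (UE e) = e" "unX (UX x) = x"
  by (simp_all add: unE_def unX_def)

lemma liftE_simps [simp]: "topspace (tsp (liftE E)) = UE ` topspace (tsp E)" "prj (liftE E) (UE e) = prj E e"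
  "sct (liftE E) b = UE (sct E b)"
  by (simp_all add: liftE_def)

lemma liftX_simps [simp]: "topspace (tsp (liftX X)) = UX ` topspace (tsp X)" "prj (liftX X) (UX x) = prj X x"
  "sct (liftX X) b = UX (sct X b)"
  by (simp_all add: liftX_def)

lemma fp_map_UE: "fp_map B E (liftE E) UE"
  unfolding fp_map_def using continuous_map_into_final_top[of "tsp E" UE] by (auto simp: liftE_def)

lemma fp_map_UX: "fp_map B X (liftX X) UX"
  unfolding fp_map_def using continuous_map_into_final_top[of "tsp X" UX] by (auto simp: liftX_def)

lemma fp_map_unE: "fp_map B (liftE E) E unE"
  unfolding fp_map_def
proof (intro conjI ballI)
  show "continuous_map (tsp (liftE E)) (tsp E) unE"
    unfolding liftE_def fsp.simps by (rule continuous_map_from_final_top) (simp add: o_def)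
qed auto

lemma fp_map_unX: "fp_map B (liftX X) X unX"
  unfolding fp_map_def
proof (intro conjI ballI)
  show "continuous_map (tsp (liftX X)) (tsp X) unX"
    unfolding liftX_def fsp.simps by (rule continuous_map_from_final_top) (simp add: o_def)
qed auto

lemma fibrewise_pointed_space_iso:
  assumes X: "fibrewise_pointed_space B X" and f: "fp_map B X X' f" and g: "fp_map B X' X g"
    and sct: "\<And>b. b \<in> topspace B \<Longrightarrow> sct X' b = f (sct X b)"
  shows "fibrewise_pointed_space B X'"
  unfolding fibrewise_pointed_space_def
proof (intro conjI ballI)
  have "continuous_map (tsp X') (tsp X) g" "continuous_map (tsp X) B (prj X)"
    using X g by (auto simp: fp_map_def fibrewise_pointed_space_def)
  from continuous_map_compose[OF this] show "continuous_map (tsp X') B (prj X')"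
    by (rule continuous_map_eq) (use g in \<open>auto simp: fp_map_def\<close>)
  have "continuous_map (tsp X) (tsp X') f" "continuous_map B (tsp X) (sct X)"
    using X f by (auto simp: fp_map_def fibrewise_pointed_space_def)
  from continuous_map_compose[OF this(2,1)] show "continuous_map B (tsp X') (sct X')"
    by (rule continuous_map_eq) (simp add: sct)
  show "prj X' (sct X' b) = b" if "b \<in> topspace B" for b
    using that sct fp_map_prj[OF f sct_mem[OF X that]] prj_sct[OF X that] by simp
qed

lemma fibrewise_pointed_space_liftE:
  "fibrewise_pointed_space B E \<Longrightarrow> fibrewise_pointed_space B (liftE E :: ('b, 'e, 'x) usp)"
  by (rule fibrewise_pointed_space_iso[OF _ fp_map_UE fp_map_unE]) auto

lemma fibrewise_pointed_space_liftX:
  "fibrewise_pointed_space B X \<Longrightarrow> fibrewise_pointed_space B (liftX X :: ('b, 'e, 'x) usp)"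
  by (rule fibrewise_pointed_space_iso[OF _ fp_map_UX fp_map_unX]) auto

lemma closedin_sct_liftE:
  assumes "closedin (tsp E) (sct E ` topspace B)"
  shows "closedin (tsp (liftE E)) (sct (liftE E) ` topspace B)"
proof -
  have "continuous_map (tsp (liftE E)) (tsp E) unE" using fp_map_unE by (simp add: fp_map_def)
  from closedin_continuous_map_preimage[OF this assms]
  have "closedin (tsp (liftE E)) {u \<in> topspace (tsp (liftE E)). unE u \<in> sct E ` topspace B}" .
  also have "{u \<in> topspace (tsp (liftE E)). unE u \<in> sct E ` topspace B} = sct (liftE E) ` topspace B"
    using closedin_subset[OF assms] by force
  finally show ?thesis .
qed

lemma closedin_sct_liftX:
  assumes "closedin (tsp X) (sct X ` topspace B)"
  shows "closedin (tsp (liftX X)) (sct (liftX X) ` topspace B)"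
proof -
  have "continuous_map (tsp (liftX X)) (tsp X) unX" using fp_map_unX by (simp add: fp_map_def)
  from closedin_continuous_map_preimage[OF this assms]
  have "closedin (tsp (liftX X)) {u \<in> topspace (tsp (liftX X)). unX u \<in> sct X ` topspace B}" .
  also have "{u \<in> topspace (tsp (liftX X)). unX u \<in> sct X ` topspace B} = sct (liftX X) ` topspace B"
    using closedin_subset[OF assms] by force
  finally show ?thesis .
qed

lemma liftf_UE [simp]: "liftf f (UE e) = UX (f e)"
  by (simp add: liftf_def)

lemma fp_map_liftf:
  assumes "fibrewise_pointed_space B E" "fp_map B E X f"
  shows "fp_map B (liftE E) (liftX X) (liftf f)"
  by (rule fp_map_eq[OF fibrewise_pointed_space_liftE[OF assms(1)]
        fp_map_compose[OF fp_map_compose[OF fp_map_unE assms(2)] fp_map_UX]]) auto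

text \<open>A shrinking argument with Urysohn functions, one cover member at a time. Every function
  is also made 1 on \<open>S\<close>, which provides the positivity on the section that the joins
  require.\<close>

lemma normal_space_functions:
  fixes T :: "'a topology"
  assumes T: "normal_space T" and S: "closedin T S"
  shows "closedin T C \<Longrightarrow> C \<subseteq> (\<Union>i\<le>n. U i) \<Longrightarrow> (\<And>i. i \<le> n \<Longrightarrow> openin T (U i) \<and> S \<subseteq> U i) \<Longrightarrow>
    \<exists>u :: nat \<Rightarrow> 'a \<Rightarrow> real. (\<forall>i\<le>n. continuous_map T euclideanreal (u i) \<and> (\<forall>x\<in>topspace T. 0 \<le> u i x) \<and>
      (\<forall>x\<in>topspace T. 0 < u i x \<longrightarrow> x \<in> U i) \<and> (\<forall>x\<in>S. 0 < u i x)) \<and> (\<forall>x\<in>C. \<exists>i\<le>n. 0 < u i x)"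
proof (induction n arbitrary: C)
  have ury: "\<exists>w. continuous_map T euclideanreal w \<and> (\<forall>x\<in>topspace T. 0 \<le> w x) \<and>
      (\<forall>x\<in>topspace T. 0 < w x \<longrightarrow> x \<in> V) \<and> (\<forall>x\<in>D \<union> S. w x = (1::real))"
    if "openin T V" "S \<subseteq> V" "closedin T D" "D \<subseteq> V" for V D
  proof -
    have "closedin T (topspace T - V)" "closedin T (D \<union> S)" "disjnt (topspace T - V) (D \<union> S)"
      using that S by (auto simp: disjnt_def)
    then obtain w where w: "continuous_map T (top_of_set {0..1::real}) w" "w ` (topspace T - V) \<subseteq> {0}"
      "w ` (D \<union> S) \<subseteq> {1}"
      using Urysohn_lemma[OF T, of "topspace T - V" "D \<union> S" 0 1] by auto
    have "\<forall>x\<in>topspace T. 0 \<le> w x" "continuous_map T euclideanreal w"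
      using w(1) by (auto simp: continuous_map_in_subtopology image_subset_iff)
    moreover have "x \<in> V" if "x \<in> topspace T" "0 < w x" for x
      using w(2) that by (cases "x \<in> V") (auto simp: image_subset_iff)
    ultimately show ?thesis using w(3) by blast
  qed
  {
    case 0
    then obtain w where "continuous_map T euclideanreal w" "\<forall>x\<in>topspace T. 0 \<le> w x"
      "\<forall>x\<in>topspace T. 0 < w x \<longrightarrow> x \<in> U 0" "\<forall>x\<in>C \<union> S. w x = (1::real)"
      using ury[of "U 0" C] by auto
    thus ?case by (intro exI[of _ "\<lambda>_. w"]) auto
  next
    case (Suc n)
    \<comment> \<open>The part of \<open>C\<close> for which only \<open>U (Suc n)\<close> is
      left.\<close>
    let ?D = "C - (\<Union>i\<le>n. U i)"
    have "closedin T ?D" using Suc.prems by (intro closedin_diff openin_Union) auto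
    moreover have "?D \<subseteq> U (Suc n)" using Suc.prems(2) by (auto simp: atMost_Suc)
    ultimately obtain w where w: "continuous_map T euclideanreal w" "\<forall>x\<in>topspace T. 0 \<le> w x"
      "\<forall>x\<in>topspace T. 0 < w x \<longrightarrow> x \<in> U (Suc n)" "\<forall>x\<in>?D \<union> S. w x = (1::real)"
      using ury[of "U (Suc n)" ?D] Suc.prems(3)[of "Suc n"] by auto
    \<comment> \<open>Where \<open>w > 1/2\<close> the new function already does the work. The rest
      is closed and misses \<open>?D\<close>, where \<open>w\<close> is 1, so the first
      \<open>n + 1\<close> sets cover it.\<close>
    let ?C = "C \<inter> {x \<in> topspace T. w x \<in> {..1/2}}"
    have "closedin T {x \<in> topspace T. w x \<in> {..1/2}}"
      by (rule closedin_continuous_map_preimage[OF w(1)]) simp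
    hence "closedin T ?C" using Suc.prems(1) by blast
    moreover have "?C \<subseteq> (\<Union>i\<le>n. U i)" using w(4) by force
    ultimately obtain u where u: "\<forall>i\<le>n. continuous_map T euclideanreal (u i) \<and> (\<forall>x\<in>topspace T. 0 \<le> u i x) \<and>
      (\<forall>x\<in>topspace T. 0 < u i x \<longrightarrow> x \<in> U i) \<and> (\<forall>x\<in>S. (0::real) < u i x)" "\<forall>x\<in>?C. \<exists>i\<le>n. 0 < u i x"
      using Suc.IH[of ?C] Suc.prems(3) by (metis (no_types, lifting) le_SucI)
    have "\<exists>i\<le>Suc n. 0 < (u(Suc n := w)) i x" if "x \<in> C" for x
    proof (cases "w x \<le> 1/2")
      case True
      hence "x \<in> ?C" using that closedin_subset[OF Suc.prems(1)] by auto
      then obtain i where "i \<le> n" "0 < u i x" using u(2) by blast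
      thus ?thesis by (intro exI[of _ i]) auto
    qed (auto intro!: exI[of _ "Suc n"])
    moreover have "continuous_map T euclideanreal ((u(Suc n := w)) i) \<and> (\<forall>x\<in>topspace T. 0 \<le> (u(Suc n := w)) i x) \<and>
      (\<forall>x\<in>topspace T. 0 < (u(Suc n := w)) i x \<longrightarrow> x \<in> U i) \<and> (\<forall>x\<in>S. 0 < (u(Suc n := w)) i x)"
      if "i \<le> Suc n" for i
      using u(1) w that by (cases "i = Suc n") auto
    ultimately show ?case by (intro exI[of _ "u(Suc n := w)"]) blast
  }
qed

section \<open>Bounds on the sectional category\<close>

lemma secat_le_mono:
  assumes "secat_le B E X f m" "m \<le> n" shows "secat_le B E X f n"
proof -
  obtain U where U: "(\<Union>i\<le>m. U i) = topspace (tsp X)"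
    "\<forall>i\<le>m. openin (tsp X) (U i) \<and> sct X ` topspace B \<subseteq> U i \<and>
           (\<exists>s. fp_map B (X\<lparr>tsp := subtopology (tsp X) (U i)\<rparr>) E s \<and>
                fp_homotopic B (X\<lparr>tsp := subtopology (tsp X) (U i)\<rparr>) X (f \<circ> s) id)"
    using assms(1) unfolding secat_le_def by blast
  \<comment> \<open>A shorter cover is padded by repeating its last member.\<close>
  have "(\<Union>i\<le>n. U (min i m)) = (\<Union>i\<le>m. U i)"
  proof
    show "(\<Union>i\<le>m. U i) \<subseteq> (\<Union>i\<le>n. U (min i m))"
    proof
      fix x assume "x \<in> (\<Union>i\<le>m. U i)"
      then obtain i where "i \<le> m" "x \<in> U i" by auto
      thus "x \<in> (\<Union>i\<le>n. U (min i m))" using assms(2) by (intro UN_I[of i]) auto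
    qed
    show "(\<Union>i\<le>n. U (min i m)) \<subseteq> (\<Union>i\<le>m. U i)"
    proof
      fix x assume "x \<in> (\<Union>i\<le>n. U (min i m))"
      then obtain i where "x \<in> U (min i m)" by auto
      thus "x \<in> (\<Union>i\<le>m. U i)" by (intro UN_I[of "min i m"]) auto
    qed
  qed
  thus ?thesis unfolding secat_le_def using U by (intro exI[of _ "\<lambda>i. U (min i m)"]) simp
qed

lemma secat_le_iff: "secat B E X f \<le> enat n \<longleftrightarrow> secat_le B E X f n"
proof
  assume *: "secat B E X f \<le> enat n"
  let ?A = "{enat n |n. secat_le B E X f n}"
  have "?A \<noteq> {}"
  proof
    assume "?A = {}"
    hence "secat B E X f = \<infinity>" unfolding secat_def by (simp add: Inf_enat_def)
    thus False using * by simp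
  qed
  \<comment> \<open>The extended naturals are well-ordered, so the infimum of a nonempty set is
    attained.\<close>
  hence "Inf ?A \<in> ?A" unfolding Inf_enat_def by (metis (mono_tags, lifting) LeastI_ex ex_in_conv)
  then obtain m where "Inf ?A = enat m" "secat_le B E X f m" by blast
  thus "secat_le B E X f n" using * secat_le_mono by (simp add: secat_def)
qed (auto simp: secat_def intro: Inf_lower)

subsection \<open>Fat wedges and Ganea spaces\<close>

abbreviation fat_left :: "(('b, 'e, 'x) U \<Rightarrow> ('b, 'e, 'x) U) \<Rightarrow> ('b, 'e, 'x) U \<Rightarrow> ('b, 'e, 'x) U" where
  "fat_left f \<equiv> (\<lambda>u. case u of UP e w \<Rightarrow> UP (f e) w | _ \<Rightarrow> undefined)"

abbreviation fat_right :: "(('b, 'e, 'x) U \<Rightarrow> ('b, 'e, 'x) U) \<Rightarrow> ('b, 'e, 'x) U \<Rightarrow> ('b, 'e, 'x) U" where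
  "fat_right j \<equiv> (\<lambda>u. case u of UP x w \<Rightarrow> UP x (j w) | _ \<Rightarrow> undefined)"

lemma fatwedge_Suc:
  "fatwedge B E X f (Suc n) = fjoin B (fprod E (fpow X n)) (fprod X (fst (fatwedge B E X f n)))
     (fpow X (Suc n)) (fat_left f) (fat_right (snd (fatwedge B E X f n)))"
  by (simp add: Let_def case_prod_beta del: fpow.simps)

lemma ganea_Suc:
  "ganea B E X f (Suc n) = fjoin B (fst (ganea B E X f n)) E X (snd (ganea B E X f n)) f"
  by (simp add: case_prod_beta)

declare fatwedge.simps(2) [simp del] ganea.simps(2) [simp del]

lemma join_data_fatwedge:
  assumes E: "fibrewise_pointed_space B E" and X: "fibrewise_pointed_space B X" "fibrewise_pointed_space B P"
    and f: "fp_map B E X f" and T: "fibrewise_pointed_space B T" and j: "fp_map B T P j"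
  shows "join_data B (fprod E P) (fprod X T) (fprod X P) (fat_left f) (fat_right j)"
proof
  show Y: "fibrewise_pointed_space B (fprod E P)" and Z: "fibrewise_pointed_space B (fprod X T)"
    and "fibrewise_pointed_space B (fprod X P)"
    using E X T by (auto intro: fibrewise_pointed_space_fprod)
  show "fp_map B (fprod E P) (fprod X P) (fat_left f)"
    by (rule fp_map_eq[OF Y fp_map_pair[OF fp_map_compose[OF fp_map_fprod_proj(1) f] fp_map_fprod_proj(2)]])
      (auto simp: mem_fprod)
  show "fp_map B (fprod X T) (fprod X P) (fat_right j)"
    by (rule fp_map_eq[OF Z fp_map_pair[OF fp_map_fprod_proj(1) fp_map_compose[OF fp_map_fprod_proj(2) j]]])
      (auto simp: mem_fprod)
qed

locale fib_map =
  fixes B :: "'b topology" and E X :: "('b, 'e, 'x) usp" and f :: "('b, 'e, 'x) U \<Rightarrow> ('b, 'e, 'x) U"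
  assumes E: "fibrewise_pointed_space B E" and X: "fibrewise_pointed_space B X"
    and f: "fp_map B E X f"
    and closed: "closedin (tsp E) (sct E ` topspace B)" "closedin (tsp X) (sct X ` topspace B)"
begin

abbreviation "T n \<equiv> fst (fatwedge B E X f n)"
abbreviation "j n \<equiv> snd (fatwedge B E X f n)"
abbreviation "G n \<equiv> fst (ganea B E X f n)"
abbreviation "p n \<equiv> snd (ganea B E X f n)"

lemmas fpow = fpow_props[OF X closed(2)]

text \<open>Closedness of the section is part of the induction because the section of a join is
  shown closed from the closed sections of all three spaces involved.\<close>

lemma fatwedge_props:
  "fibrewise_pointed_space B (T n) \<and> fp_map B (T n) (fpow X n) (j n) \<and>
    closedin (tsp (T n)) (sct (T n) ` topspace B)"
proof (induction n)
  case 0 show ?case using E f closed by simp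
next
  case (Suc n)
  interpret join_data B "fprod E (fpow X n)" "fprod X (T n)" "fprod X (fpow X n)" "fat_left f" "fat_right (j n)"
    using join_data_fatwedge[OF E X fpow(1) f] Suc by blast
  show ?case
    using fibrewise_pointed_space_J fp_map_jmap closedin_sct_J
      closedin_sct_fprod[OF E closed(1) fpow] closedin_sct_fprod[OF X closed(2), of "T n"]
      closedin_sct_fprod[OF X closed(2) fpow] Suc
    unfolding fatwedge_Suc by simp
qed

lemma join_data_T:
  "join_data B (fprod E (fpow X n)) (fprod X (T n)) (fpow X (Suc n)) (fat_left f) (fat_right (j n))"
  using join_data_fatwedge[OF E X fpow(1) f] fatwedge_props by simp

lemma ganea_props:
  "fibrewise_pointed_space B (G n) \<and> fp_map B (G n) X (p n) \<and> closedin (tsp (G n)) (sct (G n) ` topspace B)"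
proof (induction n)
  case 0 show ?case using E f closed by simp
next
  case (Suc n)
  interpret join_data B "G n" E X "p n" f
    using Suc E X f by unfold_locales auto
  show ?case
    using fibrewise_pointed_space_J fp_map_jmap closedin_sct_J closed Suc unfolding ganea_Suc by simp
qed

lemma join_data_G: "join_data B (G n) E X (p n) f"
  using ganea_props E X f by unfold_locales auto

section \<open>Global lifts assembled from nonnegative functions with local lifts\<close>

context
  fixes W :: "('w, 'b) fsp" and g :: "'w \<Rightarrow> ('b, 'e, 'x) U" and u :: "nat \<Rightarrow> 'w \<Rightarrow> real" and n :: nat
  assumes W: "fibrewise_pointed_space B W" and g: "fp_map B W X g"
    and u: "\<And>i. i \<le> n \<Longrightarrow> continuous_map (tsp W) euclideanreal (u i)"
      "\<And>i x. i \<le> n \<Longrightarrow> x \<in> topspace (tsp W) \<Longrightarrow> 0 \<le> u i x"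
      "\<And>i b. i \<le> n \<Longrightarrow> b \<in> topspace B \<Longrightarrow> 0 < u i (sct W b)"
    and single: "\<And>i. i \<le> n \<Longrightarrow> \<exists>\<alpha>. fp_map B (fsub W {x \<in> topspace (tsp W). 0 < u i x}) E \<alpha> \<and>
        fp_homotopic B (fsub W {x \<in> topspace (tsp W). 0 < u i x}) X (f \<circ> \<alpha>) g"
begin

abbreviation "partial_sum m x \<equiv> (\<Sum>i\<le>m. u i x)"
abbreviation "S m \<equiv> {x \<in> topspace (tsp W). 0 < partial_sum m x}"
abbreviation "S' i \<equiv> {x \<in> topspace (tsp W). 0 < u i x}"

lemma partial_sum:
  assumes "m \<le> n"
  shows "continuous_map (tsp W) euclideanreal (partial_sum m)"
    "\<And>x. x \<in> topspace (tsp W) \<Longrightarrow> 0 \<le> partial_sum m x"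
    "\<And>b. b \<in> topspace B \<Longrightarrow> 0 < partial_sum m (sct W b)"
proof -
  show "continuous_map (tsp W) euclideanreal (partial_sum m)"
    by (intro continuous_map_sum u) (use assms in auto)
  show "0 \<le> partial_sum m x" if "x \<in> topspace (tsp W)" for x
    by (rule sum_nonneg) (use that u(2) assms in auto)
  show "0 < partial_sum m (sct W b)" if "b \<in> topspace B" for b
    by (rule sum_pos) (use that u(3) assms in auto)
qed

lemma fibrewise_pointed_space_fsub:
  assumes "\<And>b. b \<in> topspace B \<Longrightarrow> 0 < v (sct W b)"
  shows "fibrewise_pointed_space B (fsub W {x \<in> topspace (tsp W). (0::real) < v x})"
  using W assms sct_mem[OF W]
  by (auto simp: fibrewise_pointed_space_def continuous_map_in_subtopology
      intro: continuous_map_from_subtopology)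

text \<open>Over the set where the m-th partial sum is positive one can lift to the m-th space; each
  step joins one further copy of \<open>E\<close>, with \<open>u (Suc m)\<close> as the second
  function.\<close>

lemma ganea_section:
  "m \<le> n \<Longrightarrow> \<exists>\<alpha>. fp_map B (fsub W (S m)) (G m) \<alpha> \<and> fp_homotopic B (fsub W (S m)) X (p m \<circ> \<alpha>) g"
proof (induction m)
  case 0 show ?case using single[of 0] by (simp add: o_def)
next
  case (Suc m)
  interpret join_data B "G m" E X "p m" f by (rule join_data_G)
  obtain \<alpha> where \<alpha>: "fp_map B (fsub W (S m)) (G m) \<alpha>" "fp_homotopic B (fsub W (S m)) X (p m \<circ> \<alpha>) g"
    using Suc by (auto simp: o_def)
  obtain \<beta> where \<beta>: "fp_map B (fsub W (S' (Suc m))) E \<beta>" "fp_homotopic B (fsub W (S' (Suc m))) X (f \<circ> \<beta>) g"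
    using single[OF Suc.prems] by auto
  have m: "m \<le> n" using Suc.prems by simp
  show ?case
    using join_section_sum[OF W g partial_sum(1)[OF m] u(1)[OF Suc.prems] partial_sum(2)[OF m] u(2)[OF Suc.prems]
        partial_sum(3)[OF m] u(3)[OF Suc.prems] \<alpha> \<beta>]
    unfolding ganea_Suc by (simp add: o_def)
qed

text \<open>The same induction, with the new copy of \<open>E\<close> in the left factor of the
  join, so \<open>u (Suc m)\<close> is now the first function. For \<open>m = n\<close> and
  \<open>g\<close> the identification of \<open>X\<close> with its copy, this factors the
  diagonal.\<close>

lemma fatwedge_section:
  "m \<le> n \<Longrightarrow> \<exists>\<alpha>. fp_map B (fsub W (S m)) (T m) \<alpha> \<and>
     fp_homotopic B (fsub W (S m)) (fpow X m) (j m \<circ> \<alpha>) (diag m \<circ> g)"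
proof (induction m)
  case 0 show ?case using single[of 0] by (simp add: o_def)
next
  case (Suc m)
  have m: "m \<le> n" using Suc.prems by simp
  note W1 = fibrewise_pointed_space_fsub[of "u (Suc m)", OF u(3)[OF Suc.prems]]
  note W2 = fibrewise_pointed_space_fsub[of "partial_sum m", OF partial_sum(3)[OF m]]
  interpret join_data B "fprod E (fpow X m)" "fprod X (T m)" "fpow X (Suc m)" "fat_left f" "fat_right (j m)"
    by (rule join_data_T)
  obtain \<beta> where \<beta>: "fp_map B (fsub W (S m)) (T m) \<beta>"
    "fp_homotopic B (fsub W (S m)) (fpow X m) (j m \<circ> \<beta>) (diag m \<circ> g)"
    using Suc by (auto simp: o_def)
  obtain \<alpha> where \<alpha>: "fp_map B (fsub W (S' (Suc m))) E \<alpha>" "fp_homotopic B (fsub W (S' (Suc m))) X (f \<circ> \<alpha>) g"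
    using single[OF Suc.prems] by auto
  have gd: "fp_map B W (fpow X m) (diag m \<circ> g)" for m
    by (rule fp_map_compose[OF g fp_map_diag[OF X]])
  have sub: "fp_map B (fsub W A) Y' g'" if "fp_map B W Y' g'" for A g' and Y' :: "('b, 'e, 'x) usp"
    using that by (auto simp: fp_map_def intro: continuous_map_from_subtopology)
  \<comment> \<open>Only the new coordinate is lifted to \<open>E\<close>, the others follow the
    diagonal; in \<open>\<beta>'\<close> the new coordinate is \<open>g\<close> itself and the old
    ones are lifted to the previous fat wedge. Both are homotopic to the diagonal through
    pairs.\<close>
  define \<alpha>' where "\<alpha>' = (\<lambda>x. UP (\<alpha> x) ((diag m \<circ> g) x))"
  define \<beta>' where "\<beta>' = (\<lambda>x. UP (g x) (\<beta> x))"
  have a1: "fp_map B (fsub W (S' (Suc m))) (fprod E (fpow X m)) \<alpha>'"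
    unfolding \<alpha>'_def by (rule fp_map_pair[OF \<alpha>(1) sub[OF gd]])
  have b1: "fp_map B (fsub W (S m)) (fprod X (T m)) \<beta>'"
    unfolding \<beta>'_def by (rule fp_map_pair[OF sub[OF g] \<beta>(1)])
  have "fp_homotopic B (fsub W (S' (Suc m))) (fprod X (fpow X m)) (\<lambda>x. UP ((f \<circ> \<alpha>) x) ((diag m \<circ> g) x))
      (\<lambda>x. UP (g x) ((diag m \<circ> g) x))"
    by (rule fp_homotopic_pair[OF W1 \<alpha>(2) fp_homotopic_refl[OF sub[OF gd]]])
  hence a2: "fp_homotopic B (fsub W (S' (Suc m))) (fpow X (Suc m)) (fat_left f \<circ> \<alpha>') (diag (Suc m) \<circ> g)"
    by (simp add: \<alpha>'_def o_def)
  have "fp_homotopic B (fsub W (S m)) (fprod X (fpow X m)) (\<lambda>x. UP (g x) ((j m \<circ> \<beta>) x))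
      (\<lambda>x. UP (g x) ((diag m \<circ> g) x))"
    by (rule fp_homotopic_pair[OF W2 fp_homotopic_refl[OF sub[OF g]] \<beta>(2)])
  hence b2: "fp_homotopic B (fsub W (S m)) (fpow X (Suc m)) (fat_right (j m) \<circ> \<beta>') (diag (Suc m) \<circ> g)"
    by (simp add: \<beta>'_def o_def)
  have eq: "{x \<in> topspace (tsp W). 0 < u (Suc m) x + partial_sum m x} = S (Suc m)"
    by (simp add: add.commute)
  show ?case
    using join_section_sum[OF W gd u(1)[OF Suc.prems] partial_sum(1)[OF m] u(2)[OF Suc.prems] partial_sum(2)[OF m]
        u(3)[OF Suc.prems] partial_sum(3)[OF m] a1 a2 b1 b2]
    unfolding fatwedge_Suc eq .
qed

end

end

text \<open>The coordinates of \<open>fpow X n\<close> are numbered from the right: index \<open>n\<close> is the leftmost one,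
  which matches the order in which the joins are formed.\<close>

primrec proj :: "nat \<Rightarrow> nat \<Rightarrow> ('b, 'e, 'x) U \<Rightarrow> 'x" where
  "proj 0 i = unX"
| "proj (Suc n) i = (if i = Suc n then unX \<circ> upl else proj n i \<circ> upr)"

lemma fp_map_proj: "i \<le> n \<Longrightarrow> fp_map B (fpow (liftX X) n) X (proj n i)"
proof (induction n)
  case 0 show ?case by (simp add: fp_map_unX)
next
  case (Suc n)
  thus ?case using fp_map_compose[OF fp_map_fprod_proj(1) fp_map_unX]
      fp_map_compose[OF fp_map_fprod_proj(2) Suc.IH] by auto
qed

lemma proj_diag: "i \<le> n \<Longrightarrow> proj n i (diag n (UX x)) = x"
  by (induction n) auto

lemma fp_homotopic_fsub:
  "fp_homotopic B (fsub X S) Y g0 g1 \<longleftrightarrow>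
     homotopic_with (\<lambda>g. (\<forall>x\<in>topspace (subtopology (tsp X) S). prj Y (g x) = prj X x) \<and>
       (\<forall>b\<in>topspace B. g (sct X b) = sct Y b)) (subtopology (tsp X) S) (tsp Y) g0 g1"
  by (simp add: fp_homotopic_def)

lemma fp_homotopic_restrict:
  assumes "fp_homotopic B X Y g0 g1" shows "fp_homotopic B (fsub X S) Y g0 g1"
  unfolding fp_homotopic_fsub
  by (rule homotopic_with_mono[OF homotopic_from_subtopology[OF assms[unfolded fp_homotopic_def]]]) auto

section \<open>Covers of Ganea spaces and fat wedges, and their pullback to \<open>X\<close>\<close>

context halo_data
begin

text \<open>After pulling back along \<open>\<phi>\<close>, the lifts satisfy \<open>f \<circ> a i
  \<simeq> c \<circ> g i \<circ> \<phi> \<simeq> c \<simeq> id\<close>. All these homotopies are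
  pointed: the first is the section on \<open>M\<close>, which contains the section of
  \<open>X\<close>.\<close>

lemma secat_le_if_lift_cover:
  assumes l: "lift_cover Y g {..n}" and \<phi>: "fp_map B X Y \<phi>"
    and g: "\<And>i. i \<le> n \<Longrightarrow> fp_homotopic B X X (g i \<circ> \<phi>) id"
  shows "secat_le B E X f n"
proof -
  obtain M W a where M: "openin (tsp X) M" "sct X ` topspace B \<subseteq> M"
    and W: "topspace (tsp X) \<subseteq> (\<Union>i\<in>{..n}. W i)"
    and ll: "\<And>i. i \<in> {..n} \<Longrightarrow> local_lift X M (g i \<circ> \<phi>) (W i) (a i)"
    by (rule lift_coverE[OF lift_cover_pullback[OF l X \<phi>]]) (rule that)
  have WX: "W i \<subseteq> topspace (tsp X)" if "i \<le> n" for i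
    using ll[of i] that by (auto simp: local_lift_def dest: openin_subset)
  have "openin (tsp X) (W i) \<and> sct X ` topspace B \<subseteq> W i \<and>
      (\<exists>s. fp_map B (fsub X (W i)) E s \<and> fp_homotopic B (fsub X (W i)) X (f \<circ> s) id)" if i: "i \<le> n" for i
  proof -
    have li: "openin (tsp X) (W i)" "M \<subseteq> W i" "continuous_map (subtopology (tsp X) (W i)) (tsp E) (a i)"
      "\<forall>u\<in>W i. prj E (a i u) = prj X u" "\<forall>u\<in>M. a i u = sct E (prj X u)"
      and hom: "homotopic_with (\<lambda>k. \<forall>u\<in>W i. prj X (k u) = prj X u \<and> (u \<in> M \<longrightarrow> k u = sct X (prj X u)))
        (subtopology (tsp X) (W i)) (tsp X) (c \<circ> (g i \<circ> \<phi>)) (f \<circ> a i)"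
      using ll[of i] i unfolding local_lift_def by auto
    have sM: "sct X b \<in> M" "sct X b \<in> W i" if "b \<in> topspace B" for b using M li(2) that by auto
    have 1: "fp_map B (fsub X (W i)) E (a i)"
      unfolding fp_map_def using li sM by (auto simp: prj_sct[OF X])
    have "fp_homotopic B (fsub X (W i)) X (c \<circ> (g i \<circ> \<phi>)) (f \<circ> a i)"
      unfolding fp_homotopic_fsub
      by (rule homotopic_with_mono[OF hom]) (use sM in \<open>auto simp: prj_sct[OF X]\<close>)
    moreover have "fp_homotopic B X X (c \<circ> (g i \<circ> \<phi>)) id"
      using fp_homotopic_trans[OF fp_homotopic_compose_left[OF g[OF i] fp_map_c]] fp_homotopic_sym[OF c] by simp
    hence "fp_homotopic B (fsub X (W i)) X (c \<circ> (g i \<circ> \<phi>)) id"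
      by (rule fp_homotopic_restrict)
    ultimately have "fp_homotopic B (fsub X (W i)) X (f \<circ> a i) id"
      using fp_homotopic_trans fp_homotopic_sym by blast
    thus ?thesis using 1 li sM by blast
  qed
  moreover have "(\<Union>i\<le>n. W i) = topspace (tsp X)" using W WX by fastforce
  ultimately show ?thesis unfolding secat_le_def by blast
qed

context
  assumes base: "\<And>i. lift_cover E (\<lambda>_. f) {i}"
    and closed: "closedin (tsp E) (sct E ` topspace B)" "closedin (tsp X) (sct X ` topspace B)"
begin

interpretation L: fib_map B "liftE E :: ('b, 'e, 'x) usp" "liftX X :: ('b, 'e, 'x) usp" "liftf f"
  by unfold_locales
    (use E X f closed fibrewise_pointed_space_liftE fibrewise_pointed_space_liftX fp_map_liftf
      closedin_sct_liftE closedin_sct_liftX in blast)+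

lemma lift_cover_liftE: "lift_cover (liftE E :: ('b, 'e, 'x) usp) (\<lambda>_. unX \<circ> liftf f) {i}"
  by (rule lift_cover_cong[OF lift_cover_pullback[OF base fibrewise_pointed_space_liftE[OF E] fp_map_unE]]) auto

text \<open>Each step adds the index \<open>Suc n\<close> for the new copy of \<open>E\<close>; the
  map to be lifted is the structure map for every index.\<close>

lemma ganea_cover: "lift_cover (L.G n) (\<lambda>_. unX \<circ> L.p n) {..n}"
proof (induction n)
  case 0 show ?case using lift_cover_liftE[of 0] by (simp add: atMost_0 o_def)
next
  case (Suc n)
  have "lift_cover (L.G (Suc n)) (\<lambda>_. unX \<circ> L.p (Suc n)) ({..n} \<union> {Suc n})"
    unfolding ganea_Suc
    by (rule lift_cover_join[OF L.join_data_G Suc lift_cover_liftE])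
      (use L.ganea_props closedin_sct_liftE closedin_sct_liftX closed in \<open>auto intro: fp_map_unX\<close>)
  thus ?case by (simp add: atMost_Suc o_def)
qed

text \<open>The left factor of the join lifts the new coordinate \<open>Suc n\<close>, which it
  carries in \<open>E\<close>; the right factor lifts the remaining coordinates through the previous
  fat wedge. So the index sets \<open>{Suc n}\<close> and \<open>{..n}\<close> add up.\<close>

lemma fatwedge_cover: "lift_cover (L.T n) (\<lambda>i. proj n i \<circ> L.j n) {..n}"
proof (induction n)
  case 0 show ?case using lift_cover_liftE[of 0] by (simp add: atMost_0 o_def)
next
  case (Suc n)
  let ?E = "liftE E :: ('b, 'e, 'x) usp" and ?X = "liftX X :: ('b, 'e, 'x) usp"
  note jd = L.join_data_T[of n]
  have "lift_cover (fprod ?E (fpow ?X n)) (\<lambda>_. (unX \<circ> liftf f) \<circ> upl) {Suc n}"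
    by (rule lift_cover_pullback[OF lift_cover_liftE join_data.Y[OF jd] fp_map_fprod_proj(1)])
  hence Y: "lift_cover (fprod ?E (fpow ?X n)) (\<lambda>i. proj (Suc n) i \<circ> fat_left (liftf f)) {Suc n}"
    by (rule lift_cover_cong) (auto simp: mem_fprod)
  have "lift_cover (fprod ?X (L.T n)) (\<lambda>i. (proj n i \<circ> L.j n) \<circ> upr) {..n}"
    by (rule lift_cover_pullback[OF Suc join_data.Z[OF jd] fp_map_fprod_proj(2)])
  hence Z: "lift_cover (fprod ?X (L.T n)) (\<lambda>i. proj (Suc n) i \<circ> fat_right (L.j n)) {..n}"
    by (rule lift_cover_cong) (auto simp: mem_fprod)
  have "lift_cover (L.T (Suc n)) (\<lambda>i. proj (Suc n) i \<circ> L.j (Suc n)) ({Suc n} \<union> {..n})"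
    unfolding fatwedge_Suc
  proof (rule lift_cover_join[OF jd Y Z])
    show "fp_map B (fpow ?X (Suc n)) X (proj (Suc n) i)" if "i \<in> {Suc n} \<union> {..n}" for i
      using that by (intro fp_map_proj) auto
    show "closedin (tsp (fprod ?E (fpow ?X n))) (sct (fprod ?E (fpow ?X n)) ` topspace B)"
      "closedin (tsp (fprod ?X (L.T n))) (sct (fprod ?X (L.T n)) ` topspace B)"
      "closedin (tsp (fpow ?X (Suc n))) (sct (fpow ?X (Suc n)) ` topspace B)"
      using L.fatwedge_props closedin_sct_fprod L.fpow fibrewise_pointed_space_liftE[OF E]
        fibrewise_pointed_space_liftX[OF X] closedin_sct_liftE[OF closed(1)] closedin_sct_liftX[OF closed(2)]
      by blast+
  qed auto
  thus ?case by (simp add: atMost_Suc o_def)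
qed

end

end

subsection \<open>The equivalence\<close>

lemma fp_map_restrict: "fp_map B X Y g \<Longrightarrow> fp_map B (fsub X S) Y g"
  by (auto simp: fp_map_def intro: continuous_map_from_subtopology)

text \<open>Normality replaces the open cover by functions with positivity sets inside it. Their sum
  is positive on all of \<open>X\<close>, so the partial lifts over the last partial sum are global;
  \<open>UX\<close> and \<open>unX\<close> move them between \<open>X\<close> and its copy.\<close>

lemma sections_if_secat_le:
  fixes E :: "('e, 'b) fsp" and X :: "('x, 'b) fsp" and f :: "'e \<Rightarrow> 'x"
  defines "E' \<equiv> (liftE E :: ('b, 'e, 'x) usp)" and "X' \<equiv> (liftX X :: ('b, 'e, 'x) usp)"
    and "f' \<equiv> (liftf f :: ('b, 'e, 'x) U \<Rightarrow> ('b, 'e, 'x) U)"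
  assumes E: "fibrewise_pointed_space B E" and X: "fibrewise_pointed_space B X" and f: "fp_map B E X f"
    and closed: "closedin (tsp E) (sct E ` topspace B)" "closedin (tsp X) (sct X ` topspace B)"
    and normal: "normal_space (tsp X)" and sec: "secat_le B E X f n"
  shows "\<exists>\<phi>. fp_map B X' (fst (fatwedge B E' X' f' n)) \<phi> \<and>
           fp_homotopic B X' (fpow X' n) (snd (fatwedge B E' X' f' n) \<circ> \<phi>) (diag n)"
    and "\<exists>\<sigma>. fp_map B X' (fst (ganea B E' X' f' n)) \<sigma> \<and>
           fp_homotopic B X' X' (snd (ganea B E' X' f' n) \<circ> \<sigma>) id"
proof -
  interpret L: fib_map B E' X' f'
    unfolding E'_def X'_def f'_def
    by unfold_locales
      (use E X f closed fibrewise_pointed_space_liftE fibrewise_pointed_space_liftX fp_map_liftf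
        closedin_sct_liftE closedin_sct_liftX in blast)+
  obtain U where U: "(\<Union>i\<le>n. U i) = topspace (tsp X)"
    and U': "\<forall>i\<le>n. openin (tsp X) (U i) \<and> sct X ` topspace B \<subseteq> U i \<and>
      (\<exists>s. fp_map B (fsub X (U i)) E s \<and> fp_homotopic B (fsub X (U i)) X (f \<circ> s) id)"
    using sec unfolding secat_le_def by blast
  obtain u :: "nat \<Rightarrow> 'x \<Rightarrow> real" where u: "\<forall>i\<le>n. continuous_map (tsp X) euclideanreal (u i) \<and>
      (\<forall>x\<in>topspace (tsp X). 0 \<le> u i x) \<and> (\<forall>x\<in>topspace (tsp X). 0 < u i x \<longrightarrow> x \<in> U i) \<and>
      (\<forall>x\<in>sct X ` topspace B. 0 < u i x)" and upos: "\<forall>x\<in>topspace (tsp X). \<exists>i\<le>n. 0 < u i x"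
    using normal_space_functions[OF normal closed(2), of "topspace (tsp X)" U n] U U' by auto
  have UX: "fp_map B X X' UX" unfolding X'_def by (rule fp_map_UX)
  have single: "\<exists>\<alpha>. fp_map B (fsub X {x \<in> topspace (tsp X). 0 < u i x}) E' \<alpha> \<and>
      fp_homotopic B (fsub X {x \<in> topspace (tsp X). 0 < u i x}) X' (f' \<circ> \<alpha>) UX" if i: "i \<le> n" for i
  proof -
    let ?A = "{x \<in> topspace (tsp X). 0 < u i x}"
    obtain s where s: "fp_map B (fsub X (U i)) E s" "fp_homotopic B (fsub X (U i)) X (f \<circ> s) id"
      using U'[rule_format, OF i] by (elim conjE exE)
    have "?A \<subseteq> U i" using u i by blast
    hence A: "fsub (fsub X (U i)) ?A = fsub X ?A" by (simp add: subtopology_subtopology Int_absorb1)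
    have eq: "f' \<circ> (UE \<circ> s) = UX \<circ> (f \<circ> s)" by (auto simp: f'_def)
    have "fp_map B (fsub X (U i)) E' (UE \<circ> s)"
      unfolding E'_def by (rule fp_map_compose[OF s(1) fp_map_UE])
    moreover have "fp_homotopic B (fsub X (U i)) X' (f' \<circ> (UE \<circ> s)) UX"
      unfolding eq using fp_homotopic_compose_left[OF s(2) UX] by simp
    ultimately show ?thesis
      using fp_map_restrict[of B "fsub X (U i)" E' "UE \<circ> s" ?A]
        fp_homotopic_restrict[of B "fsub X (U i)" X' "f' \<circ> (UE \<circ> s)" UX ?A]
      unfolding A by (intro exI[of _ "UE \<circ> s"] conjI)
  qed
  have u1: "continuous_map (tsp X) euclideanreal (u i)" if "i \<le> n" for i using u that by blast
  have u2: "0 \<le> u i x" if "i \<le> n" "x \<in> topspace (tsp X)" for i x using u that by blast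
  have u3: "0 < u i (sct X b)" if "i \<le> n" "b \<in> topspace B" for i b using u that by blast
  have "0 < (\<Sum>i\<le>n. u i x)" if x: "x \<in> topspace (tsp X)" for x
  proof -
    obtain i where "i \<le> n" "0 < u i x" using upos x by blast
    thus ?thesis using u2 x by (intro sum_pos2[of _ i]) auto
  qed
  hence "{x \<in> topspace (tsp X). 0 < (\<Sum>i\<le>n. u i x)} = topspace (tsp X)" by blast
  hence S: "fsub X {x \<in> topspace (tsp X). 0 < (\<Sum>i\<le>n. u i x)} = X" by simp
  have unX: "fp_map B X' X unX" unfolding X'_def by (rule fp_map_unX)
  have inv: "UX (unX v) = v" if "v \<in> topspace (tsp X')" for v using that by (auto simp: X'_def)
  have "\<exists>\<alpha>. fp_map B (fsub X {x \<in> topspace (tsp X). 0 < (\<Sum>i\<le>n. u i x)}) (L.T n) \<alpha> \<and>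
      fp_homotopic B (fsub X {x \<in> topspace (tsp X). 0 < (\<Sum>i\<le>n. u i x)}) (fpow X' n) (L.j n \<circ> \<alpha>) (diag n \<circ> UX)"
    by (rule L.fatwedge_section[where n = n, OF X UX]) (rule u1 u2 u3 single order_refl; assumption)+
  then obtain \<alpha> where \<alpha>: "fp_map B X (L.T n) \<alpha>" "fp_homotopic B X (fpow X' n) (L.j n \<circ> \<alpha>) (diag n \<circ> UX)"
    unfolding S by (elim exE conjE)
  have "fp_homotopic B X' (fpow X' n) (L.j n \<circ> (\<alpha> \<circ> unX)) (diag n)"
    by (rule fp_homotopic_eq[OF L.X fp_homotopic_compose_right[OF \<alpha>(2) unX]]) (auto simp: inv)
  thus "\<exists>\<phi>. fp_map B X' (L.T n) \<phi> \<and> fp_homotopic B X' (fpow X' n) (L.j n \<circ> \<phi>) (diag n)"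
    using fp_map_compose[OF unX \<alpha>(1)] by (intro exI[of _ "\<alpha> \<circ> unX"] conjI)
  have "\<exists>\<beta>. fp_map B (fsub X {x \<in> topspace (tsp X). 0 < (\<Sum>i\<le>n. u i x)}) (L.G n) \<beta> \<and>
      fp_homotopic B (fsub X {x \<in> topspace (tsp X). 0 < (\<Sum>i\<le>n. u i x)}) X' (L.p n \<circ> \<beta>) UX"
    by (rule L.ganea_section[where n = n, OF X UX]) (rule u1 u2 u3 single order_refl; assumption)+
  then obtain \<beta> where \<beta>: "fp_map B X (L.G n) \<beta>" "fp_homotopic B X X' (L.p n \<circ> \<beta>) UX"
    unfolding S by (elim exE conjE)
  have "fp_homotopic B X' X' (L.p n \<circ> (\<beta> \<circ> unX)) id"
    by (rule fp_homotopic_eq[OF L.X fp_homotopic_compose_right[OF \<beta>(2) unX]]) (auto simp: inv)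
  thus "\<exists>\<sigma>. fp_map B X' (L.G n) \<sigma> \<and> fp_homotopic B X' X' (L.p n \<circ> \<sigma>) id"
    using fp_map_compose[OF unX \<beta>(1)] by (intro exI[of _ "\<beta> \<circ> unX"] conjI)
qed

theorem theorem3p7:
  fixes B :: "'b topology"
    and E :: "('e, 'b) fsp" and X :: "('x, 'b) fsp" and f :: "'e \<Rightarrow> 'x"
    and n :: nat
  defines "E' \<equiv> (liftE E :: ('b, 'e, 'x) usp)"
      and "X' \<equiv> (liftX X :: ('b, 'e, 'x) usp)"
      and "f' \<equiv> (liftf f :: ('b, 'e, 'x) U \<Rightarrow> ('b, 'e, 'x) U)"
  assumes "fibrewise_pointed_space B E" and "fibrewise_pointed_space B X"
    and "fp_map B E X f"
    and "fib_well_pointed B E TYPE(('b, 'e, 'x) U)"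
    and "fib_well_pointed B X TYPE(('b, 'e, 'x) U)"
    and "(normal_space (tsp E) \<and> normal_space (tsp X)) \<or>
         (fp_closed_cofibration B E X f TYPE(('b, 'e, 'x) U) \<and> normal_space (tsp X))"
  shows "(secat B E X f \<le> enat n \<longleftrightarrow>
            (\<exists>\<phi>. fp_map B X' (fst (fatwedge B E' X' f' n)) \<phi> \<and>
                 fp_homotopic B X' (fpow X' n) (snd (fatwedge B E' X' f' n) \<circ> \<phi>) (diag n)))
       \<and> (secat B E X f \<le> enat n \<longleftrightarrow>
            (\<exists>\<sigma>. fp_map B X' (fst (ganea B E' X' f' n)) \<sigma> \<and>
                 fp_homotopic B X' X' (snd (ganea B E' X' f' n) \<circ> \<sigma>) id))"
proof -
  note E = assms(4) and X = assms(5) and f = assms(6)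
  have closed: "closedin (tsp E) (sct E ` topspace B)" "closedin (tsp X) (sct X ` topspace B)"
    using assms(7,8) by (simp_all add: fib_well_pointed_def)
  have normal: "normal_space (tsp X)" using assms(9) by blast
  \<comment> \<open>The cylinder coordinate \<open>UC\<close> embeds the cylinder over
    \<open>X\<close> into the universe type, over which well-pointedness is assumed to have the
    extension property.\<close>
  have "inj (\<lambda>(x, t). UC (UX x) t :: ('b, 'e, 'x) U)" by (auto simp: inj_on_def)
  from well_pointed_halo[OF this X assms(8)] obtain V c where V: "openin (tsp X) V" "sct X ` topspace B \<subseteq> V"
    "fp_homotopic B X X id c" "\<And>x. x \<in> V \<Longrightarrow> c x = sct X (prj X x)" by blast
  have "inj (\<lambda>(x, t). UC (UE x) t :: ('b, 'e, 'x) U)" by (auto simp: inj_on_def)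
  from well_pointed_halo[OF this E assms(7)] obtain V' c' where V': "openin (tsp E) V'" "sct E ` topspace B \<subseteq> V'"
    "fp_homotopic B E E id c'" "\<And>x. x \<in> V' \<Longrightarrow> c' x = sct E (prj E x)" by blast
  interpret halo_data B E X f V c using E X f V by unfold_locales auto
  have base: "lift_cover E (\<lambda>_. f) {i}" for i by (rule lift_cover_base[OF V'])
  have UX: "fp_map B X X' UX" unfolding X'_def by (rule fp_map_UX)
  have unX: "fp_map B X' X unX" unfolding X'_def by (rule fp_map_unX)
  have fat: "secat_le B E X f n" if \<phi>: "fp_map B X' (fst (fatwedge B E' X' f' n)) \<phi>"
    "fp_homotopic B X' (fpow X' n) (snd (fatwedge B E' X' f' n) \<circ> \<phi>) (diag n)" for \<phi>
  proof (rule secat_le_if_lift_cover)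
    show "lift_cover (fst (fatwedge B E' X' f' n)) (\<lambda>i. proj n i \<circ> snd (fatwedge B E' X' f' n)) {..n}"
      unfolding E'_def X'_def f'_def by (rule fatwedge_cover[OF base closed])
    show "fp_map B X (fst (fatwedge B E' X' f' n)) (\<phi> \<circ> UX)" by (rule fp_map_compose[OF UX \<phi>(1)])
    fix i assume i: "i \<le> n"
    have pr: "fp_map B (fpow X' n) X (proj n i)" unfolding X'_def by (rule fp_map_proj[OF i])
    \<comment> \<open>Composing the factorization of the diagonal with the i-th projection gives a
      homotopy to the identity of \<open>X\<close>.\<close>
    show "fp_homotopic B X X ((proj n i \<circ> snd (fatwedge B E' X' f' n)) \<circ> (\<phi> \<circ> UX)) id"
      by (rule fp_homotopic_eq[OF X fp_homotopic_compose_right[OF fp_homotopic_compose_left[OF \<phi>(2) pr] UX]])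
        (auto simp: proj_diag[OF i])
  qed
  have gan: "secat_le B E X f n" if \<sigma>: "fp_map B X' (fst (ganea B E' X' f' n)) \<sigma>"
    "fp_homotopic B X' X' (snd (ganea B E' X' f' n) \<circ> \<sigma>) id" for \<sigma>
  proof (rule secat_le_if_lift_cover)
    show "lift_cover (fst (ganea B E' X' f' n)) (\<lambda>_. unX \<circ> snd (ganea B E' X' f' n)) {..n}"
      unfolding E'_def X'_def f'_def by (rule ganea_cover[OF base closed])
    show "fp_map B X (fst (ganea B E' X' f' n)) (\<sigma> \<circ> UX)" by (rule fp_map_compose[OF UX \<sigma>(1)])
    show "fp_homotopic B X X ((unX \<circ> snd (ganea B E' X' f' n)) \<circ> (\<sigma> \<circ> UX)) id"
      by (rule fp_homotopic_eq[OF X fp_homotopic_compose_right[OF fp_homotopic_compose_left[OF \<sigma>(2) unX] UX]])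
        auto
  qed
  note sections = sections_if_secat_le[OF E X f closed normal, of n, folded E'_def X'_def f'_def]
  show ?thesis
    unfolding secat_le_iff by (intro conjI iffI; (elim exE conjE)?) (rule sections fat gan; assumption)+
qed

end
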